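(* For $\lambda\in(-1/2,0)\cup(0,1/2)$, $$\Gamma(z;\lambda_+)=\Gamma(z;\lambda_-)\left[\mathbf 1-\frac{1}{z}\vec{f}_2(z,\lambda)\vec{g}_2^{\,t}(z,\lambda)\right],$$ where $\Gamma(z;\lambda)$, $\vec f_2$, $\vec g_2$ are as defined in the context.
   Context: Fix real numbers $b_L<0<b_R$; $z\in\mathbb C\setminus[b_L,b_R]$. $\mathbf 1$ is the $2\times 2$ identity, $\sigma_2=\begin{bmatrix}0&-i\\ i&0\end{bmatrix}$, $^t$ is transpose; subscripts $\lambda_\pm$ (and $a_\pm(\lambda)$) denote boundary values on $(-1/2,1/2)$ from the upper/lower half-plane of $\lambda$. $a=a(\lambda)=\frac{1}{i\pi}\ln\left(\frac{i+\sqrt{4\lambda^2-1}}{2\lambda}\right)$, $\lambda\notin[-1/2,1/2]$, with the principal logarithm and $\sqrt{4\lambda^2-1}=2\lambda+O(1)$ as $\lambda\to\infty$ (cut $[-1/2,1/2]$). $h_\infty(\eta)=e^{a\pi i}\eta^{-a}{}_2F_1(a,a+1;2a+2;\frac1\eta)$, $s_\infty(\eta)=-e^{-a\pi i}\eta^{a+1}{}_2F_1(-a-1,-a;-2a;\frac1\eta)$ for $\operatorname{Im}\eta>0$ with principal branches, extended to $\mathbb C\setminus((-\infty,0]\cup[1,\infty))$ by analytic continuation across $(0,1)$; prime is $d/d\eta$. $\hat\Gamma(\eta)=\begin{bmatrix} h_\infty & s_\infty \\ h_\infty' & s_\infty' \end{bmatrix}(\eta)$, $M_1(z)=\frac{b_R(z-b_L)}{z(b_R-b_L)}$,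 $$Q(\lambda)=\begin{bmatrix} -\tan(a\pi) & 0 \\ 0 & 4^{2a+1}e^{a\pi i}\frac{\Gamma(a+3/2)\Gamma(a+1/2)}{\Gamma(a)\Gamma(a+2)} \end{bmatrix}\begin{bmatrix} 1 & e^{a\pi i} \\ -e^{a\pi i} & 1 \end{bmatrix}$$ ($\Gamma(\cdot)$ with one argument is Euler's Gamma function), and $$\Gamma(z;\lambda)=\sigma_2Q^{-1}(\lambda)\hat{\Gamma}^{-1}\left(M_1(\infty)\right)\begin{bmatrix} 1 & \frac{b_Lb_R}{z(b_R-b_L)(a+1)} \\ 0 & 1 \end{bmatrix}\hat{\Gamma}\left(M_1(z)\right)Q(\lambda)\sigma_2 .$$ Set $\alpha(\lambda)=\frac{e^{-a\pi i}\tan(a\pi)\Gamma(a)}{4^{a+1}\Gamma(a+3/2)}$, $\beta(\lambda)=\frac{4^{a}e^{a\pi i}\Gamma(a+1/2)}{\Gamma(a+2)}$ and $$d_R(z;\lambda)=\alpha(\lambda)h_\infty'(M_1(z))+\beta(\lambda)s_\infty'(M_1(z)),\quad d_L(z;\lambda)=-e^{a\pi i}\alpha(\lambda)h_\infty'(M_1(z))+e^{-a\pi i}\beta(\lambda)s_\infty'(M_1(z)).$$ For $\lambda\in(-1/2,0)$, $d_R$ and $d_L$ are evaluated with $a=a_-(\lambda)$ (they take the same value with $a=a_+(\lambda)$). For $\lambda\in(-1/2,0)\cup(0,1/2)$, $$\vec{f}_2(z,\lambda)=\frac{-2b_Rb_L|\lambda|\,(2a_-(-|\lambda|)+1)}{b_R-b_L}\begin{bmatrix}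 d_R(z;-|\lambda|) \\ \mathrm{sgn}(\lambda)\,d_L(z;-|\lambda|) \end{bmatrix},\qquad \vec{g}_2(z,\lambda)=\begin{bmatrix} -\mathrm{sgn}(\lambda)\,d_L(z;-|\lambda|) \\ d_R(z;-|\lambda|) \end{bmatrix}.$$ *)

theory Defs
  imports "HOL-Complex_Analysis.Complex_Analysis"
begin

(* The holomorphic extension of f from U to V. It is unique on V when V is a region and U is a
   nonempty open subset of V; outside V the value is unspecified. *)
definition analytic_continuation ::
    "(complex \<Rightarrow> complex) \<Rightarrow> complex set \<Rightarrow> complex set \<Rightarrow> complex \<Rightarrow> complex" where
  "analytic_continuation f U V =
     (SOME F. F holomorphic_on V \<and> (\<forall>z\<in>U. F z = f z))"

(* Principal branch, cut along [1, infinity). *)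
definition hyp2F1 :: "complex \<Rightarrow> complex \<Rightarrow> complex \<Rightarrow> complex \<Rightarrow> complex" where
  "hyp2F1 a b c =
     analytic_continuation (eval_fps (fps_hypergeo [a, b] [c] 1)) (ball 0 1)
       (- complex_of_real ` {1..})"

(* The factored form is the branch with cut [-1/2, 1/2] and value 2*l + O(1) at infinity:
   1 - 1/(4*l^2) is a nonpositive real exactly for nonzero l in [-1/2, 1/2]. *)
definition sqrt4 :: "complex \<Rightarrow> complex" where
  "sqrt4 l = 2 * l * csqrt (1 - 1 / (4 * l\<^sup>2))"

definition a_fun :: "complex \<Rightarrow> complex" where
  "a_fun l = 1 / (\<i> * of_real pi) * Ln ((\<i> + sqrt4 l) / (2 * l))"

definition a_minus :: "real \<Rightarrow> complex" where
  "a_minus l = Lim (at (complex_of_real l) within {m. Im m < 0}) a_fun"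

(* From here on a is a free parameter, instantiated by a_fun or a_minus at the end. *)

abbreviation eta_domain :: "complex set" where
  "eta_domain \<equiv> - complex_of_real ` ({..0} \<union> {1..})"

definition h_inf :: "complex \<Rightarrow> complex \<Rightarrow> complex" where
  "h_inf a = analytic_continuation
     (\<lambda>\<eta>. exp (a * of_real pi * \<i>) * \<eta> powr (- a) * hyp2F1 a (a + 1) (2 * a + 2) (1 / \<eta>))
     {\<eta>. Im \<eta> > 0} eta_domain"

definition s_inf :: "complex \<Rightarrow> complex \<Rightarrow> complex" where
  "s_inf a = analytic_continuation
     (\<lambda>\<eta>. - exp (- a * of_real pi * \<i>) * \<eta> powr (a + 1)
            * hyp2F1 (- a - 1) (- a) (- 2 * a) (1 / \<eta>))
     {\<eta>. Im \<eta> > 0} eta_domain"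

(* The matrix with rows (p, q) and (r, s). *)
definition mat2 :: "complex \<Rightarrow> complex \<Rightarrow> complex \<Rightarrow> complex \<Rightarrow> complex^2^2" where
  "mat2 p q r s = vector [vector [p, q], vector [r, s]]"

definition Gamma_hat :: "complex \<Rightarrow> complex \<Rightarrow> complex^2^2" where
  "Gamma_hat a \<eta> = mat2 (h_inf a \<eta>) (s_inf a \<eta>)
                         (deriv (h_inf a) \<eta>) (deriv (s_inf a) \<eta>)"

definition M1 :: "real \<Rightarrow> real \<Rightarrow> complex \<Rightarrow> complex" where
  "M1 bL bR z = of_real bR * (z - of_real bL) / (z * (of_real bR - of_real bL))"

definition M1_infinity :: "real \<Rightarrow> real \<Rightarrow> complex" where
  "M1_infinity bL bR = of_real bR / (of_real bR - of_real bL)"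

lemma M1_at_infinity: "(M1 bL bR \<longlongrightarrow> M1_infinity bL bR) at_infinity"
proof -
  have "((\<lambda>z. M1_infinity bL bR * (1 - of_real bL * inverse z))
          \<longlongrightarrow> M1_infinity bL bR * (1 - of_real bL * 0)) at_infinity"
    by (intro tendsto_intros tendsto_inverse_0)
  moreover have "\<forall>\<^sub>F z in at_infinity. M1_infinity bL bR * (1 - of_real bL * inverse z) = M1 bL bR z"
    unfolding eventually_at_infinity
    by (rule exI[of _ 1]) (auto simp: M1_def M1_infinity_def divide_simps)
  ultimately show ?thesis
    by (auto intro: Lim_transform_eventually)
qed

definition sigma2 :: "complex^2^2" where
  "sigma2 = mat2 0 (- \<i>) \<i> 0"

definition Q_mat :: "complex \<Rightarrow> complex^2^2" where
  "Q_mat a =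
     mat2 (- tan (a * of_real pi)) 0
          0 (4 powr (2 * a + 1) * exp (a * of_real pi * \<i>)
             * (Gamma (a + 3 / 2) * Gamma (a + 1 / 2)) / (Gamma a * Gamma (a + 2)))
     ** mat2 1 (exp (a * of_real pi * \<i>))
             (- exp (a * of_real pi * \<i>)) 1"

definition Gamma_RHP :: "real \<Rightarrow> real \<Rightarrow> complex \<Rightarrow> complex \<Rightarrow> complex^2^2" where
  "Gamma_RHP bL bR z l =
     (let a = a_fun l in
      sigma2 ** matrix_inv (Q_mat a) ** matrix_inv (Gamma_hat a (M1_infinity bL bR))
      ** mat2 1 (of_real bL * of_real bR / (z * (of_real bR - of_real bL) * (a + 1)))
              0 1
      ** Gamma_hat a (M1 bL bR z) ** Q_mat a ** sigma2)"

definition alpha :: "complex \<Rightarrow> complex" where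
  "alpha a = exp (- a * of_real pi * \<i>) * tan (a * of_real pi) * Gamma a
               / (4 powr (a + 1) * Gamma (a + 3 / 2))"

definition beta :: "complex \<Rightarrow> complex" where
  "beta a = 4 powr a * exp (a * of_real pi * \<i>) * Gamma (a + 1 / 2) / Gamma (a + 2)"

(* For real l in (-1/2, 0), evaluated with the boundary value of a from below. *)
definition d_R :: "real \<Rightarrow> real \<Rightarrow> complex \<Rightarrow> real \<Rightarrow> complex" where
  "d_R bL bR z l =
     (let a = a_minus l in
      alpha a * deriv (h_inf a) (M1 bL bR z) + beta a * deriv (s_inf a) (M1 bL bR z))"

definition d_L :: "real \<Rightarrow> real \<Rightarrow> complex \<Rightarrow> real \<Rightarrow> complex" where
  "d_L bL bR z l =
     (let a = a_minus l in
      - exp (a * of_real pi * \<i>) * alpha a * deriv (h_inf a) (M1 bL bR z)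
      + exp (- a * of_real pi * \<i>) * beta a * deriv (s_inf a) (M1 bL bR z))"

definition f2 :: "real \<Rightarrow> real \<Rightarrow> complex \<Rightarrow> real \<Rightarrow> complex^2" where
  "f2 bL bR z l =
     (- 2 * of_real bR * of_real bL * of_real \<bar>l\<bar> * (2 * a_minus (- \<bar>l\<bar>) + 1)
        / (of_real bR - of_real bL))
     *s vector [d_R bL bR z (- \<bar>l\<bar>), of_real (sgn l) * d_L bL bR z (- \<bar>l\<bar>)]"

definition g2 :: "real \<Rightarrow> real \<Rightarrow> complex \<Rightarrow> real \<Rightarrow> complex^2" where
  "g2 bL bR z l = vector [- of_real (sgn l) * d_L bL bR z (- \<bar>l\<bar>), d_R bL bR z (- \<bar>l\<bar>)]"

definition outer :: "complex^2 \<Rightarrow> complex^2 \<Rightarrow> complex^2^2" where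
  "outer u v = (\<chi> i j. u $ i * v $ j)"

end

(* With eta = M1(z), the functions h_inf and s_inf solve eta (1 - eta) y'' + a (a + 1) y = 0, and
   s_inf a = h_inf (-1 - a). The triangular factor of Gamma splits as T(M1(inf)) T(eta)^-1 with
   T(eta) = [[1, eta/(a+1)], [0, 1]], so Gamma = Xi(M1(inf))^-1 Xi(eta) for Xi = T^-1 Gamma_hat Q sigma2.
   For l < 0 the two boundary values of a are exchanged by a -> -1 - a. This swaps the columns of
   Gamma_hat, which Q absorbs by the reflection formula of Euler's Gamma function, and only T changes;
   as T is unipotent and the Wronskian is constant, the jump is the identity plus a nilpotent matrix of
   rank one. The case l > 0 is reduced to l < 0 by a -> -a: the contiguous relation between a and a - 1
   shows that this conjugates Gamma by diag(-1, 1).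
   All values of a that occur are nonreal, so no Gamma factor has a pole and every denominator is nonzero.
   Existence of the analytic continuations and their continuity in a come from solutions of the
   differential equation on starlike domains, which are entire in a (a + 1). *)

theory Submission
  imports Defs
begin

section \<open>Second-order linear equations on starlike domains\<close>

text \<open>The obstacle is that \<open>h_inf a\<close> is picked by a choice operator for each
  \<open>a\<close> separately and is needed at \<open>M1_infinity\<close>, a point of (0, 1) that
  the series in 1/\<open>\<eta>\<close> does not reach. It is therefore written in a basis of
  solutions that depends on \<open>a\<close> only through \<open>k = a * (a + 1)\<close>; the two
  coefficients are Wronskians with the series, taken at one point of the upper half-plane outside
  the unit disc. The two symmetries act on \<open>Xi\<close> from the left in different ways. Under
  a -> -a the left factor is free of \<open>\<eta>\<close> and cancels between the two points; under
  a -> -1 - a it contains one entry linear in \<open>\<eta>\<close>, and the difference of its two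
  values is the jump. Let \<open>a\<close> be the value below -|l|. Then -1 - a lies above -|l|, -a
  above |l|, and a + 1 = -(-1 - a) below |l|. So a -> -a exchanges the two sides, and the jump at
  |l| is the inverse of the jump at -|l|, conjugated by diag(-1, 1): this is the origin of
  \<open>sgn l\<close> in \<open>f2\<close> and \<open>g2\<close>. The explicit |l| in
  \<open>f2\<close> comes from the relation 2 |l| sin(a pi) = -1.\<close>

lemma ray_primitive_bound:
  fixes F f :: "complex \<Rightarrow> complex"
  assumes F: "\<And>w. w \<in> closed_segment x0 x \<Longrightarrow> (F has_field_derivative f w) (at w)"
    and F0: "F x0 = 0"
    and f: "\<And>w. w \<in> closed_segment x0 x \<Longrightarrow> norm (f w) \<le> D * dist x0 w ^ n"
  shows "norm (F x) \<le> D * dist x0 x ^ Suc n / (real n + 1)"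
proof -
  define g where "g t = x0 + of_real t * (x - x0)" for t :: real
  have g: "g t \<in> closed_segment x0 x" "dist x0 (g t) = t * dist x0 x" if "0 \<le> t" "t \<le> 1" for t
  proof -
    show "g t \<in> closed_segment x0 x"
      using that unfolding g_def closed_segment_def
      by (auto simp: algebra_simps scaleR_conv_of_real intro!: exI[of _ t])
    have "dist x0 (g t) = norm (of_real t * (x - x0))"
      by (simp add: g_def dist_norm norm_minus_commute)
    then show "dist x0 (g t) = t * dist x0 x"
      using that by (simp add: norm_mult dist_norm norm_minus_commute)
  qed
  have dg: "((F \<circ> g) has_vector_derivative (x - x0) * f (g t)) (at t)" if "0 \<le> t" "t \<le> 1" for t
  proof -
    have "(g has_vector_derivative (x - x0)) (at t)"
      unfolding g_def by (auto intro!: derivative_eq_intros simp: scaleR_conv_of_real)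
    from field_vector_diff_chain_at[OF this F[OF g(1)[OF that]]] show ?thesis .
  qed
  \<comment> \<open>The derivative of the real majorant is exactly the bound for \<open>f\<close>
    along the ray, so one integration gains a power of the distance and the divisor n + 1.\<close>
  have "norm ((F \<circ> g) 1 - (F \<circ> g) 0)
      \<le> D * dist x0 x ^ Suc n / (real n + 1) * 1 ^ Suc n
        - D * dist x0 x ^ Suc n / (real n + 1) * 0 ^ Suc n"
  proof (rule differentiable_bound_general[where f' = "\<lambda>t. (x - x0) * f (g t)"
        and \<phi> = "\<lambda>t. D * dist x0 x ^ Suc n / (real n + 1) * t ^ Suc n"
        and \<phi>' = "\<lambda>t. D * dist x0 x ^ Suc n * t ^ n"])
    show "continuous_on {0..1} (F \<circ> g)"
      using has_vector_derivative_continuous[OF dg] by (intro continuous_at_imp_continuous_on) auto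
    show "continuous_on {0..1::real} (\<lambda>t. D * dist x0 x ^ Suc n / (real n + 1) * t ^ Suc n)"
      by (intro continuous_intros)
    fix t :: real assume t: "0 < t" "t < 1"
    show "((F \<circ> g) has_vector_derivative (x - x0) * f (g t)) (at t)"
      using dg t by simp
    have "((\<lambda>t. D * dist x0 x ^ Suc n / (real n + 1) * t ^ Suc n) has_field_derivative
          D * dist x0 x ^ Suc n / (real n + 1) * (real (Suc n) * t ^ n)) (at t)"
      by (rule derivative_eq_intros refl | simp)+
    moreover have "D * dist x0 x ^ Suc n / (real n + 1) * (real (Suc n) * t ^ n)
        = D * dist x0 x ^ Suc n * t ^ n"
      by (simp add: field_simps)
    ultimately show "((\<lambda>t. D * dist x0 x ^ Suc n / (real n + 1) * t ^ Suc n)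
        has_vector_derivative D * dist x0 x ^ Suc n * t ^ n) (at t)"
      by (simp add: has_real_derivative_iff_has_vector_derivative)
    have "norm (f (g t)) \<le> D * dist x0 (g t) ^ n"
      using g(1) t by (intro f) auto
    also have "\<dots> = D * dist x0 x ^ n * t ^ n"
      using g(2)[of t] t by (simp add: power_mult_distrib)
    finally have "norm (x - x0) * norm (f (g t)) \<le> dist x0 x * (D * dist x0 x ^ n * t ^ n)"
      by (intro mult_mono) (auto simp: dist_norm norm_minus_commute)
    then show "norm ((x - x0) * f (g t)) \<le> D * dist x0 x ^ Suc n * t ^ n"
      by (simp add: norm_mult mult_ac)
  qed simp
  then show ?thesis
    by (simp add: g_def F0)
qed

text \<open>Picard iteration, organised as a power series in \<open>k\<close>: the \<open>n\<close>-th coefficient is bounded by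
  \<open>C M\<^sup>n r\<^sup>2\<^sup>n / (2n)!\<close> along rays, so the series is entire in \<open>k\<close>.\<close>

lemma linear_ode_solution:
  fixes q :: "complex \<Rightarrow> complex"
  assumes S: "open S" "x0 \<in> S" and star: "\<And>x. x \<in> S \<Longrightarrow> closed_segment x0 x \<subseteq> S"
    and q: "q holomorphic_on S"
  obtains Y Y' :: "complex \<Rightarrow> complex \<Rightarrow> complex" where
    "\<And>k x. x \<in> S \<Longrightarrow> (Y k has_field_derivative Y' k x) (at x)"
    "\<And>k x. x \<in> S \<Longrightarrow> (Y' k has_field_derivative k * q x * Y k x) (at x)"
    "\<And>k. Y k x0 = c0" "\<And>k. Y' k x0 = c1"
    "\<And>x k. x \<in> S \<Longrightarrow> isCont (\<lambda>k. Y k x) k"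
    "\<And>x k. x \<in> S \<Longrightarrow> isCont (\<lambda>k. Y' k x) k"
proof -
  have "\<exists>g. (\<forall>x\<in>S. (g has_field_derivative f x) (at x)) \<and> g x0 = 0"
    if "f holomorphic_on S" for f
  proof -
    have "\<exists>g. \<forall>x\<in>S. (g has_field_derivative f x) (at x)"
      using that S star holomorphic_on_imp_differentiable_at[OF that]
      by (intro holomorphic_starlike_primitive[of S f "{}"] holomorphic_on_imp_continuous_on)
        (auto simp: starlike_def)
    then obtain g where "\<forall>x\<in>S. (g has_field_derivative f x) (at x)" ..
    then show ?thesis
      by (intro exI[of _ "\<lambda>x. g x - g x0"]) (auto intro!: derivative_eq_intros)
  qed
  then have "\<forall>f. \<exists>g. f holomorphic_on S \<longrightarrow>
      (\<forall>x\<in>S. (g has_field_derivative f x) (at x)) \<and> g x0 = 0"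
    by blast
  \<comment> \<open>\<open>P\<close> is an antiderivative operator normalised at \<open>x0\<close>;
    choosing it once for all functions turns the Picard iteration into a primitive
    recursion.\<close>
  then obtain P where "\<forall>f. f holomorphic_on S \<longrightarrow>
      (\<forall>x\<in>S. (P f has_field_derivative f x) (at x)) \<and> P f x0 = 0"
    by (rule choice[THEN exE])
  then have P: "\<And>f x. f holomorphic_on S \<Longrightarrow> x \<in> S \<Longrightarrow> (P f has_field_derivative f x) (at x)"
    and P0: "\<And>f. f holomorphic_on S \<Longrightarrow> P f x0 = 0"
    by blast+
  have hP: "P f holomorphic_on S" if "f holomorphic_on S" for f
    using P[OF that] S(1) by (auto simp: holomorphic_on_open)
  \<comment> \<open>Comparing powers of \<open>k\<close> in Y'' = k q Y makes the second derivative
    of \<open>\<phi> (Suc n)\<close> equal to q times \<open>\<phi> n\<close>. The initial data sit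
    in the term n = 0; \<open>\<psi>\<close> and \<open>\<rho>\<close> are the first and second
    derivatives of \<open>\<phi>\<close>.\<close>
  define \<phi> where "\<phi> = rec_nat (\<lambda>x. c0 + c1 * (x - x0)) (\<lambda>n f. P (P (\<lambda>x. q x * f x)))"
  define \<psi> where "\<psi> n = (case n of 0 \<Rightarrow> \<lambda>x. c1 | Suc m \<Rightarrow> P (\<lambda>x. q x * \<phi> m x))" for n
  define \<rho> where "\<rho> n = (case n of 0 \<Rightarrow> \<lambda>x. 0 | Suc m \<Rightarrow> (\<lambda>x. q x * \<phi> m x))" for n
  have \<phi>_0: "\<phi> 0 = (\<lambda>x. c0 + c1 * (x - x0))" and \<phi>_Suc: "\<phi> (Suc n) = P (\<psi> (Suc n))" for n
    by (simp_all add: \<phi>_def \<psi>_def)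
  have \<psi>_0: "\<psi> 0 = (\<lambda>x. c1)" and \<psi>_Suc: "\<psi> (Suc n) = P (\<lambda>x. q x * \<phi> n x)" for n
    by (simp_all add: \<psi>_def)
  have \<rho>_0: "\<rho> 0 = (\<lambda>x. 0)" and \<rho>_Suc: "\<rho> (Suc n) = (\<lambda>x. q x * \<phi> n x)" for n
    by (simp_all add: \<rho>_def)
  have h\<phi>: "\<phi> n holomorphic_on S" for n
  proof (induction n)
    case 0
    show ?case unfolding \<phi>_0 by (intro holomorphic_intros)
  next
    case (Suc n)
    then show ?case unfolding \<phi>_Suc \<psi>_Suc by (intro hP holomorphic_intros q)
  qed
  have hq\<phi>: "(\<lambda>x. q x * \<phi> n x) holomorphic_on S" for n
    by (intro holomorphic_intros q h\<phi>)
  have h\<psi>: "\<psi> n holomorphic_on S" for n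
    by (cases n) (auto simp: \<psi>_0 \<psi>_Suc intro: hP hq\<phi>)
  have d\<phi>: "(\<phi> n has_field_derivative \<psi> n x) (at x)" if "x \<in> S" for n x
  proof (cases n)
    case 0
    then show ?thesis by (auto simp: \<phi>_0 \<psi>_0 intro!: derivative_eq_intros)
  next
    case (Suc m)
    then show ?thesis using P[OF h\<psi> that] by (simp add: \<phi>_Suc)
  qed
  have d\<psi>: "(\<psi> n has_field_derivative \<rho> n x) (at x)" if "x \<in> S" for n x
    using P[OF hq\<phi> that] by (cases n) (auto simp: \<psi>_0 \<rho>_0 \<psi>_Suc \<rho>_Suc)

  \<comment> \<open>Summable majorants, uniform on a ball, for the series and both termwise
    derivatives: this is what termwise differentiation requires.\<close>
  have main: "\<exists>d>0. ball x1 d \<subseteq> S \<and> (\<forall>k. \<exists>B1 B2 B3. summable B1 \<and> summable B2 \<and> summable B3 \<and>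
      (\<forall>x\<in>ball x1 d. \<forall>n. norm (k ^ n * \<phi> n x) \<le> B1 n \<and> norm (k ^ n * \<psi> n x) \<le> B2 n
         \<and> norm (k ^ n * \<rho> n x) \<le> B3 n))" if x1: "x1 \<in> S" for x1
  proof -
    obtain d where d: "d > 0" "cball x1 d \<subseteq> S"
      using S(1) x1 by (meson open_contains_cball)
    \<comment> \<open>\<open>K\<close> collects the segments from \<open>x0\<close> to the closed
      ball. It is compact, so \<open>q\<close> is bounded on it, and it is star-shaped about
      \<open>x0\<close>, so an induction along rays never leaves it.\<close>
    define K where "K = (\<lambda>(t, x). x0 + of_real t * (x - x0)) ` ({0..1::real} \<times> cball x1 d)"
    have "compact K"
      unfolding K_def case_prod_unfold
      by (intro compact_continuous_image compact_Times continuous_intros compact_Icc compact_cball)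
    have seg: "closed_segment x0 x = (\<lambda>t. x0 + of_real t * (x - x0)) ` {0..1}" for x
      by (auto simp: closed_segment_def scaleR_conv_of_real algebra_simps image_iff)
    have K_eq: "K = (\<Union>x\<in>cball x1 d. closed_segment x0 x)"
      unfolding K_def seg by (auto simp: image_iff Bex_def)
    have "K \<subseteq> S"
      using star d(2) unfolding K_eq by blast
    have K_star: "closed_segment x0 w \<subseteq> K" if "w \<in> K" for w
    proof -
      from that obtain x where "x \<in> cball x1 d" "w \<in> closed_segment x0 x"
        unfolding K_eq by blast
      moreover from this have "closed_segment x0 w \<subseteq> closed_segment x0 x"
        by (simp add: subset_closed_segment)
      ultimately show ?thesis unfolding K_eq by blast
    qed
    have ball_K: "x \<in> K" if "x \<in> ball x1 d" for x
      using that ends_in_segment(2)[of x x0] unfolding K_eq by (auto intro!: bexI[of _ x])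
    have "bounded (q ` K)"
      by (intro compact_imp_bounded compact_continuous_image \<open>compact K\<close>
          holomorphic_on_imp_continuous_on holomorphic_on_subset[OF q \<open>K \<subseteq> S\<close>])
    then obtain M where M: "M > 0" "\<And>w. w \<in> K \<Longrightarrow> norm (q w) \<le> M"
      by (metis bounded_pos image_eqI)
    obtain R where R: "\<And>w. w \<in> K \<Longrightarrow> dist x0 w \<le> R"
      using compact_imp_bounded[OF \<open>compact K\<close>] bounded_any_center[of K x0] by blast
    have "R \<ge> 0"
      using order_trans[OF zero_le_dist R[of x1]] ball_K[of x1] d(1) by simp
    define C where "C = norm c0 + norm c1 * R"
    have "C \<ge> 0" using \<open>R \<ge> 0\<close> by (simp add: C_def)
    have b: "norm (\<phi> n w) \<le> C * M ^ n * dist x0 w ^ (2 * n) / fact (2 * n) \<and>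
        norm (\<psi> (Suc n) w) \<le> C * M ^ Suc n * dist x0 w ^ (2 * n + 1) / fact (2 * n + 1)"
      if "w \<in> K" for n w
      using that
    proof (induction n arbitrary: w)
      case 0
      have c: "norm (\<phi> 0 w) \<le> C" if "w \<in> K" for w
      proof -
        have "norm (\<phi> 0 w) \<le> norm c0 + norm c1 * dist x0 w"
          unfolding \<phi>_0 using norm_triangle_ineq[of c0 "c1 * (w - x0)"]
          by (simp add: norm_mult dist_norm norm_minus_commute)
        also have "\<dots> \<le> C" unfolding C_def using R[OF that] by (simp add: mult_left_mono)
        finally show ?thesis .
      qed
      have "norm (\<psi> (Suc 0) w) \<le> C * M * dist x0 w ^ Suc 0 / (real 0 + 1)"
        unfolding \<psi>_Suc
      proof (rule ray_primitive_bound[where f = "\<lambda>x. q x * \<phi> 0 x"])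
        fix u assume "u \<in> closed_segment x0 w"
        then have u: "u \<in> K" using K_star 0 by blast
        then show "(P (\<lambda>x. q x * \<phi> 0 x) has_field_derivative q u * \<phi> 0 u) (at u)"
          using P[OF hq\<phi>] \<open>K \<subseteq> S\<close> by blast
        show "norm (q u * \<phi> 0 u) \<le> C * M * dist x0 u ^ 0"
          using mult_mono[OF M(2)[OF u] c[OF u]] M(1) by (simp add: norm_mult mult_ac)
      qed (simp add: P0 hq\<phi>)
      with c[OF 0] show ?case by simp
    next
      case (Suc n)
      have c: "norm (\<phi> (Suc n) w) \<le> C * M ^ Suc n * dist x0 w ^ (2 * n + 2) / fact (2 * n + 2)"
        if "w \<in> K" for w
      proof -
        have "norm (\<phi> (Suc n) w) \<le> C * M ^ Suc n / fact (2 * n + 1)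
            * dist x0 w ^ Suc (2 * n + 1) / (real (2 * n + 1) + 1)"
          unfolding \<phi>_Suc
        proof (rule ray_primitive_bound[where f = "\<psi> (Suc n)"])
          fix u assume "u \<in> closed_segment x0 w"
          then have u: "u \<in> K" using K_star that by blast
          then show "(P (\<psi> (Suc n)) has_field_derivative \<psi> (Suc n) u) (at u)"
            using P[OF h\<psi>] \<open>K \<subseteq> S\<close> by blast
          show "norm (\<psi> (Suc n) u) \<le> C * M ^ Suc n / fact (2 * n + 1) * dist x0 u ^ (2 * n + 1)"
            using Suc.IH[OF u] by simp
        qed (simp add: P0 h\<psi>)
        then show ?thesis by (simp add: field_simps)
      qed
      have "norm (\<psi> (Suc (Suc n)) w) \<le> C * M ^ Suc (Suc n) / fact (2 * n + 2)
            * dist x0 w ^ Suc (2 * n + 2) / (real (2 * n + 2) + 1)"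
        unfolding \<psi>_Suc[of "Suc n"]
      proof (rule ray_primitive_bound[where f = "\<lambda>x. q x * \<phi> (Suc n) x"])
        fix u assume "u \<in> closed_segment x0 w"
        then have u: "u \<in> K" using K_star Suc.prems by blast
        then show "(P (\<lambda>x. q x * \<phi> (Suc n) x) has_field_derivative q u * \<phi> (Suc n) u) (at u)"
          using P[OF hq\<phi>] \<open>K \<subseteq> S\<close> by blast
        show "norm (q u * \<phi> (Suc n) u) \<le> C * M ^ Suc (Suc n) / fact (2 * n + 2) * dist x0 u ^ (2 * n + 2)"
          using mult_mono[OF M(2)[OF u] c[OF u]] M(1) by (simp add: norm_mult mult_ac)
      qed (simp add: P0 hq\<phi>)
      moreover have "fact (2 * Suc n + 1) = (fact (2 * n + 2) :: real) * (real (2 * n + 2) + 1)"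
        by (simp add: field_simps)
      ultimately show ?case using c[OF Suc.prems] by (simp add: mult_ac)
    qed
    have b1: "norm (\<phi> n x) \<le> C * (M * R\<^sup>2) ^ n / fact n" if "x \<in> K" for n x
    proof -
      have "norm (\<phi> n x) \<le> C * M ^ n * dist x0 x ^ (2 * n) / fact (2 * n)"
        using b[OF that] by blast
      \<comment> \<open>Weakening the factorial of 2n to that of n turns the majorant into an
        exponential series, summable for every \<open>k\<close>.\<close>
      also have "\<dots> \<le> C * M ^ n * R ^ (2 * n) / fact n"
        using \<open>C \<ge> 0\<close> M(1) R[OF that] \<open>R \<ge> 0\<close>
        by (intro frac_le mult_mono power_mono mult_nonneg_nonneg fact_mono) auto
      finally show ?thesis by (simp add: power_mult_distrib mult_ac flip: power_mult)
    qed
    have b2: "norm (\<psi> (Suc n) x) \<le> C * M * R * (M * R\<^sup>2) ^ n / fact n" if "x \<in> K" for n x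
    proof -
      have "norm (\<psi> (Suc n) x) \<le> C * M ^ Suc n * dist x0 x ^ (2 * n + 1) / fact (2 * n + 1)"
        using b[OF that] by blast
      also have "\<dots> \<le> C * M ^ Suc n * R ^ (2 * n + 1) / fact n"
        using \<open>C \<ge> 0\<close> M(1) R[OF that] \<open>R \<ge> 0\<close>
        by (intro frac_le mult_mono power_mono mult_nonneg_nonneg fact_mono) auto
      finally show ?thesis by (simp add: power_mult_distrib mult_ac flip: power_mult)
    qed
    have b3: "norm (\<rho> (Suc n) x) \<le> M * (C * (M * R\<^sup>2) ^ n / fact n)" if "x \<in> K" for n x
      unfolding \<rho>_Suc norm_mult using mult_mono[OF M(2)[OF that] b1[OF that]] M(1) by simp
    have ex: "summable (\<lambda>n. c * (r ^ n / fact n))" for c r :: real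
      using summable_mult[OF summable_exp[of r], of c] by (simp add: divide_inverse mult.commute)
    have "\<exists>B1 B2 B3. summable B1 \<and> summable B2 \<and> summable B3 \<and>
      (\<forall>x\<in>ball x1 d. \<forall>n. norm (k ^ n * \<phi> n x) \<le> B1 n \<and> norm (k ^ n * \<psi> n x) \<le> B2 n
         \<and> norm (k ^ n * \<rho> n x) \<le> B3 n)" for k
    proof (intro exI conjI)
      let ?r = "norm k * (M * R\<^sup>2)"
      show "summable (\<lambda>n. C * (?r ^ n / fact n))"
        by (rule ex)
      show "summable (\<lambda>n. case n of 0 \<Rightarrow> norm c1 | Suc n \<Rightarrow> norm k * C * M * R * (?r ^ n / fact n))"
        by (subst summable_Suc_iff[symmetric]) (simp only: nat.case ex)
      show "summable (\<lambda>n. case n of 0 \<Rightarrow> 0 | Suc n \<Rightarrow> norm k * M * C * (?r ^ n / fact n))"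
        by (subst summable_Suc_iff[symmetric]) (simp only: nat.case ex)
      show "\<forall>x\<in>ball x1 d. \<forall>n. norm (k ^ n * \<phi> n x) \<le> C * (?r ^ n / fact n)
         \<and> norm (k ^ n * \<psi> n x) \<le> (case n of 0 \<Rightarrow> norm c1 | Suc n \<Rightarrow> norm k * C * M * R * (?r ^ n / fact n))
         \<and> norm (k ^ n * \<rho> n x) \<le> (case n of 0 \<Rightarrow> 0 | Suc n \<Rightarrow> norm k * M * C * (?r ^ n / fact n))"
      proof (intro ballI allI conjI)
        fix x n assume "x \<in> ball x1 d"
        then have x: "x \<in> K" by (rule ball_K)
        show "norm (k ^ n * \<phi> n x) \<le> C * (?r ^ n / fact n)"
          using mult_left_mono[OF b1[OF x, of n], of "norm k ^ n"]
          by (simp add: norm_mult norm_power power_mult_distrib mult_ac)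
        show "norm (k ^ n * \<psi> n x) \<le> (case n of 0 \<Rightarrow> norm c1 | Suc n \<Rightarrow> norm k * C * M * R * (?r ^ n / fact n))"
        proof (cases n)
          case (Suc m)
          then show ?thesis using mult_left_mono[OF b2[OF x, of m], of "norm k ^ n"]
            by (simp add: norm_mult norm_power power_mult_distrib mult_ac)
        qed (simp add: \<psi>_0)
        show "norm (k ^ n * \<rho> n x) \<le> (case n of 0 \<Rightarrow> 0 | Suc n \<Rightarrow> norm k * M * C * (?r ^ n / fact n))"
        proof (cases n)
          case (Suc m)
          then show ?thesis using mult_left_mono[OF b3[OF x, of m], of "norm k ^ n"]
            by (simp add: norm_mult norm_power power_mult_distrib mult_ac)
        qed (simp add: \<rho>_0)
      qed
    qed
    moreover have "ball x1 d \<subseteq> S" using d(2) by (meson ball_subset_cball order_trans)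
    ultimately show ?thesis using d(1) by blast
  qed

  define Y where "Y k x = (\<Sum>n. k ^ n * \<phi> n x)" for k x
  define Y' where "Y' k x = (\<Sum>n. k ^ n * \<psi> n x)" for k x
  have sum: "summable (\<lambda>n. k ^ n * \<phi> n x)" "summable (\<lambda>n. k ^ n * \<psi> n x)" if x: "x \<in> S" for k x
  proof -
    obtain d where d: "d > 0" "\<forall>k. \<exists>B1 B2 B3. summable B1 \<and> summable B2 \<and> summable B3 \<and>
      (\<forall>x\<in>ball x d. \<forall>n. norm (k ^ n * \<phi> n x) \<le> B1 n \<and> norm (k ^ n * \<psi> n x) \<le> B2 n
         \<and> norm (k ^ n * \<rho> n x) \<le> B3 n)"
      using main[OF x] by blast
    then obtain B1 B2 where B: "summable B1" "summable B2"
      "\<forall>y\<in>ball x d. \<forall>n. norm (k ^ n * \<phi> n y) \<le> B1 n \<and> norm (k ^ n * \<psi> n y) \<le> B2 n"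
      by meson
    then show "summable (\<lambda>n. k ^ n * \<phi> n x)" "summable (\<lambda>n. k ^ n * \<psi> n x)"
      using d(1) by (auto intro: summable_comparison_test'[of B1] summable_comparison_test'[of B2])
  qed
  have "(Y k has_field_derivative Y' k x) (at x) \<and>
        (Y' k has_field_derivative k * q x * Y k x) (at x)" if x: "x \<in> S" for k x
  proof -
    obtain d where d: "d > 0" "ball x d \<subseteq> S" "\<forall>k. \<exists>B1 B2 B3. summable B1 \<and> summable B2 \<and> summable B3 \<and>
      (\<forall>x\<in>ball x d. \<forall>n. norm (k ^ n * \<phi> n x) \<le> B1 n \<and> norm (k ^ n * \<psi> n x) \<le> B2 n
         \<and> norm (k ^ n * \<rho> n x) \<le> B3 n)"
      using main[OF x] by blast
    then obtain B2 B3 where B: "summable B2" "summable B3"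
      "\<forall>y\<in>ball x d. \<forall>n. norm (k ^ n * \<psi> n y) \<le> B2 n \<and> norm (k ^ n * \<rho> n y) \<le> B3 n"
      by meson
    have "((\<lambda>x. \<Sum>n. k ^ n * \<phi> n x) has_field_derivative (\<Sum>n. k ^ n * \<psi> n x)) (at x)"
    proof (rule has_field_derivative_series'(2)[of "ball x d" _ _ x])
      fix n y assume "y \<in> ball x d"
      then have "y \<in> S" using d by blast
      then show "((\<lambda>x. k ^ n * \<phi> n x) has_field_derivative k ^ n * \<psi> n y) (at y within ball x d)"
        by (rule has_field_derivative_at_within[OF DERIV_cmult[OF d\<phi>]])
    next
      show "uniformly_convergent_on (ball x d) (\<lambda>n x. \<Sum>i<n. k ^ i * \<psi> i x)"
        using B by (intro Weierstrass_m_test'[where M = B2]) auto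
    qed (use d(1) sum[OF x] in auto)
    moreover have "((\<lambda>x. \<Sum>n. k ^ n * \<psi> n x) has_field_derivative (\<Sum>n. k ^ n * \<rho> n x)) (at x)"
    proof (rule has_field_derivative_series'(2)[of "ball x d" _ _ x])
      fix n y assume "y \<in> ball x d"
      then have "y \<in> S" using d by blast
      then show "((\<lambda>x. k ^ n * \<psi> n x) has_field_derivative k ^ n * \<rho> n y) (at y within ball x d)"
        by (rule has_field_derivative_at_within[OF DERIV_cmult[OF d\<psi>]])
    next
      show "uniformly_convergent_on (ball x d) (\<lambda>n x. \<Sum>i<n. k ^ i * \<rho> i x)"
        using B by (intro Weierstrass_m_test'[where M = B3]) auto
    qed (use d(1) sum[OF x] in auto)
    moreover have "(\<Sum>n. k ^ n * \<rho> n x) = k * q x * Y k x"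
    proof -
      have "summable (\<lambda>n. k ^ n * \<rho> n x)"
        using B d(1) by (auto intro: summable_comparison_test'[of B3])
      then have "(\<Sum>n. k ^ n * \<rho> n x) = (\<Sum>n. k ^ Suc n * \<rho> (Suc n) x)"
        by (subst suminf_split_head) (auto simp: \<rho>_0)
      also have "\<dots> = (\<Sum>n. k * q x * (k ^ n * \<phi> n x))"
        by (simp add: \<rho>_Suc mult_ac)
      also have "\<dots> = k * q x * Y k x"
        unfolding Y_def by (rule suminf_mult[OF sum(1)[OF x]])
      finally show ?thesis .
    qed
    ultimately show ?thesis
      by (simp add: Y_def[abs_def] Y'_def[abs_def])
  qed
  moreover have "Y k x0 = c0" for k
  proof -
    have "(\<lambda>n. k ^ n * \<phi> n x0) = (\<lambda>n. if n = 0 then c0 else 0)"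
    proof
      fix n show "k ^ n * \<phi> n x0 = (if n = 0 then c0 else 0)"
        by (cases n) (auto simp: \<phi>_0 \<phi>_Suc P0 h\<psi>)
    qed
    then show ?thesis
      using sums_single[of 0 "\<lambda>_. c0"] by (simp add: Y_def sums_iff)
  qed
  moreover have "Y' k x0 = c1" for k
  proof -
    have "(\<lambda>n. k ^ n * \<psi> n x0) = (\<lambda>n. if n = 0 then c1 else 0)"
    proof
      fix n show "k ^ n * \<psi> n x0 = (if n = 0 then c1 else 0)"
        by (cases n) (auto simp: \<psi>_0 \<psi>_Suc P0 hq\<phi>)
    qed
    then show ?thesis
      using sums_single[of 0 "\<lambda>_. c1"] by (simp add: Y'_def sums_iff)
  qed
  moreover have "isCont (\<lambda>k. Y k x) k" "isCont (\<lambda>k. Y' k x) k" if "x \<in> S" for x k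
    using sum[OF that] isCont_powser_converges_everywhere[of "\<lambda>n. \<phi> n x" k]
      isCont_powser_converges_everywhere[of "\<lambda>n. \<psi> n x" k]
    by (simp_all add: Y_def Y'_def mult.commute)
  ultimately show ?thesis using that[of Y Y'] by blast
qed

text \<open>The equation has no first-order term, so the derivative y w'' - y'' w equals q y w - q y
  w = 0.\<close>

lemma wronskian_constant:
  fixes q y y' w w' :: "complex \<Rightarrow> complex"
  assumes S: "open S" "connected S"
    and y: "\<And>x. x \<in> S \<Longrightarrow> (y has_field_derivative y' x) (at x)"
      "\<And>x. x \<in> S \<Longrightarrow> (y' has_field_derivative q x * y x) (at x)"
    and w: "\<And>x. x \<in> S \<Longrightarrow> (w has_field_derivative w' x) (at x)"
      "\<And>x. x \<in> S \<Longrightarrow> (w' has_field_derivative q x * w x) (at x)"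
    and "x0 \<in> S" "x \<in> S"
  shows "y x * w' x - y' x * w x = y x0 * w' x0 - y' x0 * w x0"
proof -
  have d: "((\<lambda>x. y x * w' x - y' x * w x) has_field_derivative 0) (at x)" if "x \<in> S" for x
    by (rule derivative_eq_intros y[OF that] w[OF that] refl | simp)+
  then have "continuous_on S (\<lambda>x. y x * w' x - y' x * w x)"
    by (meson DERIV_isCont continuous_at_imp_continuous_on)
  then obtain c where "\<And>x. x \<in> S \<Longrightarrow> y x * w' x - y' x * w x = c"
    using DERIV_zero_connected_constant[OF S(2,1) finite.emptyI] d by (metis (no_types, lifting) Diff_empty)
  then show ?thesis using assms by metis
qed

text \<open>Cramer's rule for a basis with Wronskian 1: the coefficients of \<open>y\<close> are its
  Wronskians with \<open>w\<close> and \<open>u\<close>, hence constants that can be read off at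
  \<open>x0\<close>. A solution known only near \<open>x0\<close> thereby acquires a formula that
  makes sense wherever \<open>u\<close> and \<open>w\<close> do.\<close>

lemma ode_solution_span:
  fixes q y y' u u' w w' :: "complex \<Rightarrow> complex"
  assumes S: "open S" "connected S"
    and y: "\<And>x. x \<in> S \<Longrightarrow> (y has_field_derivative y' x) (at x)"
      "\<And>x. x \<in> S \<Longrightarrow> (y' has_field_derivative q x * y x) (at x)"
    and u: "\<And>x. x \<in> S \<Longrightarrow> (u has_field_derivative u' x) (at x)"
      "\<And>x. x \<in> S \<Longrightarrow> (u' has_field_derivative q x * u x) (at x)"
    and w: "\<And>x. x \<in> S \<Longrightarrow> (w has_field_derivative w' x) (at x)"
      "\<And>x. x \<in> S \<Longrightarrow> (w' has_field_derivative q x * w x) (at x)"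
    and uw: "\<And>x. x \<in> S \<Longrightarrow> u x * w' x - u' x * w x = 1"
    and x: "x0 \<in> S" "x \<in> S"
  shows "y x = (y x0 * w' x0 - y' x0 * w x0) * u x + (u x0 * y' x0 - u' x0 * y x0) * w x"
proof -
  have "y x = (y x * w' x - y' x * w x) * u x + (u x * y' x - u' x * y x) * w x"
    using uw[OF x(2)] by algebra
  then show ?thesis
    using wronskian_constant[OF S y w x] wronskian_constant[OF S u y x] by simp
qed

section \<open>The hypergeometric series\<close>

definition hyp_fps :: "complex \<Rightarrow> complex fps" where
  "hyp_fps a = fps_hypergeo [a, a + 1] [2 * a + 2] 1"

text \<open>If \<open>y = \<eta>\<^sup>-\<^sup>a F(1/\<eta>)\<close> with \<open>F\<close> the series \<open>hyp_fps a\<close>, then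
  \<open>y' = - \<eta>\<^sup>-\<^sup>a\<^sup>-\<^sup>1 F\<^sub>1(1/\<eta>)\<close> with \<open>F\<^sub>1\<close> the series \<open>hyp_fps1 a\<close>.\<close>

definition hyp_fps1 :: "complex \<Rightarrow> complex fps" where
  "hyp_fps1 a = fps_const a * hyp_fps a + fps_X * fps_deriv (hyp_fps a)"

lemma nonreal_add_of_nat:
  assumes "Im a \<noteq> 0"
  shows "a + of_nat n \<noteq> 0" "a + of_nat n + 1 \<noteq> 0" "a + 1 + of_nat n \<noteq> 0"
    "2 * a + of_nat n \<noteq> 0" "2 * a + 2 + of_nat n \<noteq> 0" "2 * a + 1 + of_nat n \<noteq> 0"
    "a \<noteq> 0" "a + 1 \<noteq> 0" "2 * a + 1 \<noteq> 0" "2 * a \<noteq> 0" "2 * a - 1 \<noteq> 0" "a - 1 \<noteq> 0"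
    "2 * a + 2 \<noteq> 0"
  using assms by (auto simp: complex_eq_iff)

lemma hyp_fps_0: "hyp_fps a $ 0 = 1"
  by (simp add: hyp_fps_def)

lemma hyp_fps_Suc:
  "hyp_fps a $ Suc n
     = (a + of_nat n) * (a + 1 + of_nat n) / ((2 * a + 2 + of_nat n) * of_nat (Suc n)) * hyp_fps a $ n"
  unfolding hyp_fps_def fps_hypergeo_rec by (simp add: mult_ac)

lemma hyp_fps1_nth: "hyp_fps1 a $ n = (a + of_nat n) * hyp_fps a $ n"
  by (cases n) (simp_all add: hyp_fps1_def algebra_simps)

lemma hyp_fps_nonzero: "Im a \<noteq> 0 \<Longrightarrow> hyp_fps a $ n \<noteq> 0"
  by (induction n) (auto simp: hyp_fps_0 hyp_fps_Suc nonreal_add_of_nat simp del: of_nat_Suc)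

lemma tendsto_ratio_of_nat:
  fixes b c :: complex
  shows "(\<lambda>n. (b + of_nat n) / (c + of_nat n)) \<longlonglongrightarrow> 1"
proof -
  have lim: "filterlim (\<lambda>n. c + of_nat n :: complex) at_infinity sequentially"
    by (rule tendsto_add_filterlim_at_infinity[OF tendsto_const tendsto_of_nat])
  then have "(\<lambda>n. 1 + (b - c) / (c + of_nat n)) \<longlonglongrightarrow> 1 + 0"
    by (intro tendsto_add tendsto_const tendsto_divide_0[OF tendsto_const])
  moreover have "\<forall>\<^sub>F n in sequentially. 1 + (b - c) / (c + of_nat n) = (b + of_nat n) / (c + of_nat n)"
    using filterlim_at_infinity_imp_eventually_ne[OF lim, of 0]
    by eventually_elim (simp add: field_simps)
  ultimately show ?thesis
    using Lim_transform_eventually by fastforce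
qed

lemma conv_radius_hyp_fps:
  assumes "Im a \<noteq> 0"
  shows "fps_conv_radius (hyp_fps a) = 1"
  unfolding fps_conv_radius_def one_ereal_def
proof (rule conv_radius_ratio_limit_nonzero[OF refl])
  note nz = nonreal_add_of_nat[OF assms]
  have "(\<lambda>n. norm ((2 * a + 2 + of_nat n) / (a + of_nat n) * ((1 + of_nat n) / (a + 1 + of_nat n))))
      \<longlonglongrightarrow> norm (1 * 1 :: complex)"
    by (intro tendsto_norm tendsto_mult tendsto_ratio_of_nat)
  moreover have "norm (hyp_fps a $ n) / norm (hyp_fps a $ Suc n)
     = norm ((2 * a + 2 + of_nat n) / (a + of_nat n) * ((1 + of_nat n) / (a + 1 + of_nat n)))" for n
    using hyp_fps_nonzero[OF assms, of n]
    by (simp add: hyp_fps_Suc norm_mult norm_divide mult_ac)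
  ultimately show "(\<lambda>n. norm (hyp_fps a $ n) / norm (hyp_fps a $ Suc n)) \<longlonglongrightarrow> 1"
    by simp
qed simp

lemma conv_radius_ge_1:
  assumes "Im a \<noteq> 0"
  shows "fps_conv_radius (hyp_fps a) \<ge> 1" "fps_conv_radius (fps_deriv (hyp_fps a)) \<ge> 1"
    "fps_conv_radius (hyp_fps1 a) \<ge> 1" "fps_conv_radius (fps_deriv (hyp_fps1 a)) \<ge> 1"
proof -
  show 1: "fps_conv_radius (hyp_fps a) \<ge> 1"
    by (simp add: conv_radius_hyp_fps assms)
  show 2: "fps_conv_radius (fps_deriv (hyp_fps a)) \<ge> 1"
    using fps_conv_radius_deriv[of "hyp_fps a"] 1 by (rule order_trans[rotated])
  have "fps_conv_radius (fps_const a * hyp_fps a) \<ge> 1"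
    by (rule order_trans[OF _ fps_conv_radius_mult]) (simp add: 1)
  moreover have "fps_conv_radius (fps_X * fps_deriv (hyp_fps a)) \<ge> 1"
    by (rule order_trans[OF _ fps_conv_radius_mult]) (simp add: 2)
  ultimately show 3: "fps_conv_radius (hyp_fps1 a) \<ge> 1"
    unfolding hyp_fps1_def by (intro order_trans[OF _ fps_conv_radius_add]) simp
  show "fps_conv_radius (fps_deriv (hyp_fps1 a)) \<ge> 1"
    using fps_conv_radius_deriv[of "hyp_fps1 a"] 3 by (rule order_trans[rotated])
qed

lemma norm_less_conv_radius:
  assumes "Im a \<noteq> 0" "norm x < 1"
  shows "ereal (norm x) < fps_conv_radius (hyp_fps a)"
    "ereal (norm x) < fps_conv_radius (fps_deriv (hyp_fps a))"
    "ereal (norm x) < fps_conv_radius (hyp_fps1 a)"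
    "ereal (norm x) < fps_conv_radius (fps_deriv (hyp_fps1 a))"
  using conv_radius_ge_1[OF assms(1)] assms(2)
  by (auto intro: less_le_trans[of _ 1] simp: one_ereal_def)

section \<open>Sums of the two series and their differential equation\<close>

abbreviation hyp_H :: "complex \<Rightarrow> complex \<Rightarrow> complex" where
  "hyp_H a x \<equiv> eval_fps (hyp_fps a) x"

abbreviation hyp_H1 :: "complex \<Rightarrow> complex \<Rightarrow> complex" where
  "hyp_H1 a x \<equiv> eval_fps (hyp_fps1 a) x"

lemma hyp_H_0: "hyp_H a 0 = 1" "hyp_H1 a 0 = a"
  by (simp_all add: eval_fps_at_0 hyp_fps_0 hyp_fps1_nth)

lemma DERIV_hyp_H:
  assumes "Im a \<noteq> 0" "norm x < 1"
  shows "(hyp_H a has_field_derivative eval_fps (fps_deriv (hyp_fps a)) x) (at x)"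
    "(hyp_H1 a has_field_derivative eval_fps (fps_deriv (hyp_fps1 a)) x) (at x)"
  using norm_less_conv_radius[OF assms] by (auto intro!: has_field_derivative_eval_fps)

lemma isCont_hyp_H_arg:
  assumes "Im a \<noteq> 0" "norm x < 1"
  shows "isCont (hyp_H a) x" "isCont (hyp_H1 a) x"
  using DERIV_hyp_H[OF assms] by (auto dest: DERIV_isCont)

lemma hyp_H1_eq:
  assumes "Im a \<noteq> 0" "norm x < 1"
  shows "hyp_H1 a x = a * hyp_H a x + x * eval_fps (fps_deriv (hyp_fps a)) x"
proof -
  note r = norm_less_conv_radius[OF assms]
  have "ereal (norm x) < fps_conv_radius (fps_const a * hyp_fps a)"
    "ereal (norm x) < fps_conv_radius (fps_X * fps_deriv (hyp_fps a))"
    using r by (auto intro!: less_le_trans[OF _ fps_conv_radius_mult])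
  then show ?thesis
    using r by (simp add: hyp_fps1_def eval_fps_add eval_fps_mult)
qed

text \<open>Gauss's equation in terms of the Euler operator D = x d/dx: as \<open>hyp_H1\<close> is
  (D + a) applied to \<open>hyp_H\<close>, the claim is (x - 1)(D + a + 1)(D + a) F = -a (a + 1) F.
  Its n-th coefficient is the recursion \<open>hyp_fps_Suc\<close>.\<close>

lemma hyp_H_ode:
  assumes "Im a \<noteq> 0" "norm x < 1"
  shows "(x - 1) * ((a + 1) * hyp_H1 a x + x * eval_fps (fps_deriv (hyp_fps1 a)) x)
         = - (a * (a + 1)) * hyp_H a x"
proof -
  note r = norm_less_conv_radius[OF assms]
  define G where "G = fps_const (a + 1) * hyp_fps1 a + fps_X * fps_deriv (hyp_fps1 a)"
  have G: "G $ n = (a + 1 + of_nat n) * (a + of_nat n) * hyp_fps a $ n" for n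
    by (cases n) (simp_all add: G_def hyp_fps1_nth algebra_simps)
  have rG: "ereal (norm x) < fps_conv_radius (fps_const (a + 1) * hyp_fps1 a)"
    "ereal (norm x) < fps_conv_radius (fps_X * fps_deriv (hyp_fps1 a))"
    using r by (auto intro!: less_le_trans[OF _ fps_conv_radius_mult])
  have rG': "ereal (norm x) < fps_conv_radius G"
    unfolding G_def using rG by (auto intro!: less_le_trans[OF _ fps_conv_radius_add])
  have r1: "ereal (norm x) < fps_conv_radius (fps_X - 1 :: complex fps)"
    by (auto intro!: less_le_trans[OF _ fps_conv_radius_diff])
  have "((fps_X - 1) * G) $ n = (fps_const (- (a * (a + 1))) * hyp_fps a) $ n" for n
  proof (cases n)
    case 0
    then show ?thesis by (simp add: algebra_simps G)
  next
    case (Suc m)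
    note nz = nonreal_add_of_nat[OF assms(1)]
    have "of_nat (Suc m) \<noteq> (0 :: complex)"
      by (simp del: of_nat_Suc)
    then have "hyp_fps a $ Suc m * ((2 * a + 2 + of_nat m) * of_nat (Suc m))
        = (a + of_nat m) * (a + 1 + of_nat m) * hyp_fps a $ m"
      using nz by (simp add: hyp_fps_Suc del: of_nat_Suc)
    then show ?thesis
      by (simp add: Suc algebra_simps G)
  qed
  then have eq: "(fps_X - 1) * G = fps_const (- (a * (a + 1))) * hyp_fps a"
    by (simp add: fps_eq_iff)
  have "eval_fps ((fps_X - 1) * G) x = (x - 1) * eval_fps G x"
    using r1 rG' by (simp add: eval_fps_mult eval_fps_diff)
  moreover have "eval_fps G x = (a + 1) * hyp_H1 a x + x * eval_fps (fps_deriv (hyp_fps1 a)) x"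
    using rG r by (simp add: G_def eval_fps_add eval_fps_mult)
  moreover have "eval_fps (fps_const (- (a * (a + 1))) * hyp_fps a) x = - (a * (a + 1)) * hyp_H a x"
    using r by (subst eval_fps_mult) auto
  ultimately show ?thesis using eq by simp
qed

text \<open>With this potential, y'' = k \<open>leg_q\<close> y is the equation solved by
  \<open>h_inf\<close> and \<open>s_inf\<close>. For k = a (a + 1) the derivative y' satisfies
  Legendre's equation of degree \<open>a\<close> in the variable 1 - 2\<open>\<eta>\<close>.\<close>

definition leg_q :: "complex \<Rightarrow> complex" where
  "leg_q \<eta> = - 1 / (\<eta> * (1 - \<eta>))"

text \<open>Only the logarithmic derivative -a/\<open>\<eta>\<close> of the prefactor matters.
  Leaving \<open>p\<close> free covers both branches in use: the power of -\<open>\<eta>\<close>,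
  cut along the positive half-line, and \<open>h_pow\<close> on the upper half-plane.\<close>

lemma series_solution:
  assumes "Im a \<noteq> 0" and \<eta>: "norm \<eta> > 1"
    and p: "(p has_field_derivative - a * p \<eta> / \<eta>) (at \<eta>)"
  shows "((\<lambda>\<eta>. p \<eta> * hyp_H a (1 / \<eta>)) has_field_derivative - (p \<eta> * hyp_H1 a (1 / \<eta>) / \<eta>)) (at \<eta>)"
    and "((\<lambda>\<eta>. - (p \<eta> * hyp_H1 a (1 / \<eta>) / \<eta>)) has_field_derivative
           a * (a + 1) * leg_q \<eta> * (p \<eta> * hyp_H a (1 / \<eta>))) (at \<eta>)"
proof -
  have nz: "\<eta> \<noteq> 0" "1 - \<eta> \<noteq> 0" and n1: "norm (1 / \<eta>) < 1"
    using \<eta> by (auto simp: norm_divide divide_less_eq)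
  have inv: "((\<lambda>\<eta>. 1 / \<eta>) has_field_derivative - 1 / \<eta>\<^sup>2) (at \<eta>)"
    using nz by (auto intro!: derivative_eq_intros simp: power2_eq_square)
  note d = DERIV_chain2[OF DERIV_hyp_H(1)[OF assms(1) n1] inv]
    DERIV_chain2[OF DERIV_hyp_H(2)[OF assms(1) n1] inv]
  have "((\<lambda>\<eta>. p \<eta> * hyp_H a (1 / \<eta>)) has_field_derivative
      - a * p \<eta> / \<eta> * hyp_H a (1 / \<eta>) + (eval_fps (fps_deriv (hyp_fps a)) (1 / \<eta>) * (- 1 / \<eta>\<^sup>2)) * p \<eta>) (at \<eta>)"
    by (rule DERIV_mult[OF p d(1)])
  moreover have "- a * p \<eta> / \<eta> * hyp_H a (1 / \<eta>) + (eval_fps (fps_deriv (hyp_fps a)) (1 / \<eta>) * (- 1 / \<eta>\<^sup>2)) * p \<eta>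
      = - (p \<eta> * hyp_H1 a (1 / \<eta>) / \<eta>)"
    unfolding hyp_H1_eq[OF assms(1) n1] using nz by (simp add: field_simps power2_eq_square)
  ultimately show "((\<lambda>\<eta>. p \<eta> * hyp_H a (1 / \<eta>)) has_field_derivative - (p \<eta> * hyp_H1 a (1 / \<eta>) / \<eta>)) (at \<eta>)"
    by simp
  let ?D = "eval_fps (fps_deriv (hyp_fps1 a)) (1 / \<eta>)"
  have "((\<lambda>\<eta>. - (p \<eta> * hyp_H1 a (1 / \<eta>) / \<eta>)) has_field_derivative
      - (((- a * p \<eta> / \<eta> * hyp_H1 a (1 / \<eta>) + (?D * (- 1 / \<eta>\<^sup>2)) * p \<eta>) * \<eta> - p \<eta> * hyp_H1 a (1 / \<eta>) * 1) / (\<eta> * \<eta>))) (at \<eta>)"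
    by (intro DERIV_minus DERIV_divide DERIV_mult[OF p d(2)] DERIV_ident nz)
  moreover have "- (((- a * p \<eta> / \<eta> * hyp_H1 a (1 / \<eta>) + (?D * (- 1 / \<eta>\<^sup>2)) * p \<eta>) * \<eta> - p \<eta> * hyp_H1 a (1 / \<eta>) * 1) / (\<eta> * \<eta>))
      = a * (a + 1) * leg_q \<eta> * (p \<eta> * hyp_H a (1 / \<eta>))"
  proof -
    have "- (((- a * p \<eta> / \<eta> * hyp_H1 a (1 / \<eta>) + (?D * (- 1 / \<eta>\<^sup>2)) * p \<eta>) * \<eta> - p \<eta> * hyp_H1 a (1 / \<eta>) * 1) / (\<eta> * \<eta>))
       = p \<eta> / \<eta>\<^sup>2 * ((a + 1) * hyp_H1 a (1 / \<eta>) + 1 / \<eta> * ?D)"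
      using nz by (simp add: field_simps power2_eq_square)
    \<comment> \<open>The factor 1/\<open>\<eta>\<close> - 1 is split off because it is x - 1 at x =
      1/\<open>\<eta>\<close>, the form in which \<open>hyp_H_ode\<close> applies.\<close>
    also have "\<dots> = p \<eta> / (\<eta> * (1 - \<eta>)) * ((1 / \<eta> - 1) * ((a + 1) * hyp_H1 a (1 / \<eta>) + 1 / \<eta> * ?D))"
      using nz by (simp add: divide_simps power2_eq_square)
    also have "\<dots> = a * (a + 1) * leg_q \<eta> * (p \<eta> * hyp_H a (1 / \<eta>))"
      unfolding hyp_H_ode[OF assms(1) n1] using nz by (simp add: leg_q_def divide_simps)
    finally show ?thesis .
  qed
  ultimately show "((\<lambda>\<eta>. - (p \<eta> * hyp_H1 a (1 / \<eta>) / \<eta>)) has_field_derivative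
           a * (a + 1) * leg_q \<eta> * (p \<eta> * hyp_H a (1 / \<eta>))) (at \<eta>)"
    by simp
qed

text \<open>Consecutive coefficients have a ratio bounded uniformly for bounded \<open>a\<close>
  away from the real line. The denominator 2 a + 2 + n has imaginary part 2 Im a, which explains m /
  2 in the hypothesis and m in the bound.\<close>

lemma hyp_fps_growth:
  assumes "norm a \<le> A" "\<bar>Im a\<bar> \<ge> m / 2" "m > 0"
  shows "norm (hyp_fps a $ n) \<le> ((A + 1) * (1 + (A + 1) / m)) ^ n"
proof (induction n)
  case 0
  show ?case by (simp add: hyp_fps_0)
next
  case (Suc n)
  have A: "A \<ge> 0" using norm_ge_zero assms(1) by (rule order_trans)
  have 1: "norm ((a + of_nat n) / of_nat (Suc n)) \<le> A + 1"
  proof -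
    have "norm (a + of_nat n) \<le> A + real n"
      using norm_triangle_ineq[of a "of_nat n"] assms(1) by simp
    also have "\<dots> \<le> (A + 1) * real (Suc n)"
      using A by (simp add: algebra_simps)
    finally show ?thesis by (simp add: norm_divide divide_le_eq del: of_nat_Suc)
  qed
  have 2: "norm ((a + 1 + of_nat n) / (2 * a + 2 + of_nat n)) \<le> 1 + (A + 1) / m"
  proof -
    let ?w = "2 * a + 2 + of_nat n"
    have w: "norm ?w \<ge> m"
      using abs_Im_le_cmod[of ?w] assms(2) by simp
    then have "?w \<noteq> 0" using assms(3) by auto
    then have "(a + 1 + of_nat n) / ?w = 1 - (a + 1) / ?w"
      by (simp add: field_simps)
    moreover have "norm (1 - (a + 1) / ?w) \<le> 1 + norm (a + 1) / norm ?w"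
      using norm_triangle_ineq4[of 1 "(a + 1) / ?w"] by (simp add: norm_divide)
    moreover have "norm (a + 1) / norm ?w \<le> (A + 1) / m"
      using w assms(1,3) norm_triangle_ineq[of a 1] A by (intro frac_le) auto
    ultimately show ?thesis by simp
  qed
  have "hyp_fps a $ Suc n = (a + of_nat n) / of_nat (Suc n)
      * ((a + 1 + of_nat n) / (2 * a + 2 + of_nat n)) * hyp_fps a $ n"
    by (simp add: hyp_fps_Suc del: of_nat_Suc)
  also have "norm \<dots> \<le> (A + 1) * (1 + (A + 1) / m) * ((A + 1) * (1 + (A + 1) / m)) ^ n"
    unfolding norm_mult using A assms(3) by (intro mult_mono 1 2 Suc.IH) auto
  finally show ?case by simp
qed

lemma continuous_on_hyp_fps:
  assumes "\<And>a. a \<in> X \<Longrightarrow> Im a \<noteq> 0"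
  shows "continuous_on X (\<lambda>a. hyp_fps a $ n)"
proof (induction n)
  case (Suc n)
  then show ?case unfolding hyp_fps_Suc
    by (intro continuous_intros)
      (use assms nonreal_add_of_nat in \<open>auto simp del: of_nat_Suc\<close>)
qed (simp add: hyp_fps_0)

text \<open>A geometric bound, uniform in the parameter, suffices here: the argument at which the series is
  compared with the differential equation may be chosen depending on \<open>a0\<close>.\<close>

lemma isCont_hyp_H_param:
  assumes "Im a0 \<noteq> 0"
  shows "\<exists>r>0. r < 1 \<and> (\<forall>x. norm x < r \<longrightarrow> isCont (\<lambda>a. hyp_H a x) a0 \<and> isCont (\<lambda>a. hyp_H1 a x) a0)"
proof -
  define m where "m = \<bar>Im a0\<bar>"
  define A where "A = norm a0 + m"
  define K where "K = (A + 1) * (1 + (A + 1) / m)"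
  define X where "X = ball a0 (m / 2)"
  have m: "m > 0" using assms by (simp add: m_def)
  have A: "A \<ge> 0" using m by (simp add: A_def)
  have K: "K \<ge> 1"
  proof -
    have "1 * 1 \<le> (A + 1) * (1 + (A + 1) / m)"
      using A m by (intro mult_mono) auto
    then show ?thesis by (simp add: K_def)
  qed
  have XA: "norm a \<le> A" "\<bar>Im a\<bar> \<ge> m / 2" if "a \<in> X" for a
  proof -
    have d: "norm (a0 - a) < m / 2" using that by (simp add: X_def dist_norm)
    then show "norm a \<le> A" using norm_triangle_sub[of a a0] m by (simp add: A_def norm_minus_commute)
    show "\<bar>Im a\<bar> \<ge> m / 2" using abs_Im_le_cmod[of "a0 - a"] d unfolding m_def by simp
  qed
  have X: "Im a \<noteq> 0" if "a \<in> X" for a using XA(2)[OF that] m by auto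
  have b1: "norm (hyp_fps a $ n * x ^ n) \<le> (K * norm x) ^ n" if "a \<in> X" for a n x
    using mult_right_mono[OF hyp_fps_growth[OF XA[OF that] m, of n], of "norm x ^ n"]
    by (simp add: norm_mult norm_power K_def power_mult_distrib)
  have b2: "norm ((a + of_nat n) * hyp_fps a $ n * x ^ n) \<le> (A + 1) * (2 * K * norm x) ^ n"
    if "a \<in> X" for a n x
  proof -
    have "norm (a + of_nat n) \<le> A + real n"
      using norm_triangle_ineq[of a "of_nat n"] XA(1)[OF that] by simp
    also have "\<dots> \<le> (A + 1) * 2 ^ n"
    proof -
      have "A * 1 + real n \<le> A * 2 ^ n + 2 ^ n"
        using A of_nat_less_two_power[of n, where ?'a = real] by (intro add_mono mult_left_mono) auto
      then show ?thesis by (simp add: algebra_simps)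
    qed
    finally have "norm (a + of_nat n) * norm (hyp_fps a $ n * x ^ n) \<le> (A + 1) * 2 ^ n * (K * norm x) ^ n"
      using A by (intro mult_mono b1 that) auto
    then show ?thesis by (simp add: norm_mult power_mult_distrib mult_ac)
  qed
  \<comment> \<open>The factor 2 pays for \<open>a + of_nat n\<close> in the coefficients of
    \<open>hyp_H1\<close>, which is at most \<open>(A + 1) * 2 ^ n\<close>.\<close>
  define r where "r = 1 / (2 * K)"
  have r: "r > 0" "r < 1" using K by (auto simp: r_def)
  have "isCont (\<lambda>a. hyp_H a x) a0 \<and> isCont (\<lambda>a. hyp_H1 a x) a0" if x: "norm x < r" for x
  proof -
    have x1: "norm x < 1" and Kx: "2 * K * norm x < 1" "K * norm x < 1"
    proof -
      show "norm x < 1" using x r by simp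
      show 1: "2 * K * norm x < 1" using x K by (simp add: r_def field_simps)
      have "0 \<le> K * norm x" using K by simp
      with 1 show "K * norm x < 1" by linarith
    qed
    have "open X" "a0 \<in> X" using m by (auto simp: X_def)
    have "uniform_limit X (\<lambda>n a. \<Sum>i<n. hyp_fps a $ i * x ^ i) (\<lambda>a. \<Sum>i. hyp_fps a $ i * x ^ i) sequentially"
      using Kx K by (intro Weierstrass_m_test[where M = "\<lambda>n. (K * norm x) ^ n"] b1 summable_geometric)
        (auto simp: abs_mult)
    then have "continuous_on X (\<lambda>a. \<Sum>i. hyp_fps a $ i * x ^ i)"
      by (rule uniform_limit_theorem[rotated])
        (auto intro!: always_eventually continuous_intros continuous_on_hyp_fps X)
    then have "continuous_on X (\<lambda>a. hyp_H a x)"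
      by (simp add: eval_fps_def)
    moreover have "uniform_limit X (\<lambda>n a. \<Sum>i<n. (a + of_nat i) * hyp_fps a $ i * x ^ i)
        (\<lambda>a. \<Sum>i. (a + of_nat i) * hyp_fps a $ i * x ^ i) sequentially"
      using Kx K by (intro Weierstrass_m_test[where M = "\<lambda>n. (A + 1) * (2 * K * norm x) ^ n"] b2
          summable_mult summable_geometric) (auto simp: abs_mult)
    then have "continuous_on X (\<lambda>a. \<Sum>i. (a + of_nat i) * hyp_fps a $ i * x ^ i)"
      by (rule uniform_limit_theorem[rotated])
        (auto intro!: always_eventually continuous_intros continuous_on_hyp_fps X)
    then have "continuous_on X (\<lambda>a. hyp_H1 a x)"
      by (simp add: eval_fps_def hyp_fps1_nth)
    ultimately show ?thesis
      using \<open>open X\<close> \<open>a0 \<in> X\<close> by (simp add: continuous_on_eq_continuous_at)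
  qed
  then show ?thesis using r by blast
qed

text \<open>The witness \<open>G\<close> shows that the property under the choice operator is
  satisfiable, and the identity theorem on the connected set \<open>V\<close> leaves no other
  function. Every statement about the continuations rests on exhibiting such a
  \<open>G\<close>.\<close>

lemma analytic_continuation_eq:
  assumes "open U" "U \<noteq> {}" "U \<subseteq> V" "open V" "connected V" "G holomorphic_on V"
    and "\<And>z. z \<in> U \<Longrightarrow> G z = f z" and "z \<in> V"
  shows "analytic_continuation f U V z = G z"
proof -
  let ?F = "analytic_continuation f U V"
  have "?F holomorphic_on V \<and> (\<forall>z\<in>U. ?F z = f z)"
    unfolding analytic_continuation_def
    by (rule someI[of "\<lambda>F. F holomorphic_on V \<and> (\<forall>z\<in>U. F z = f z)" G])
      (use assms(6,7) in blast)
  then have F: "?F holomorphic_on V" "\<And>z. z \<in> U \<Longrightarrow> ?F z = G z"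
    using assms(7) by auto
  show ?thesis
    by (rule analytic_continuation_open[OF assms(1,4,2,5,3) F(1) assms(6) F(2) assms(8)])
qed

section \<open>Slit planes and their starlikeness\<close>

lemma of_real_image_iff: "z \<in> complex_of_real ` A \<longleftrightarrow> Im z = 0 \<and> Re z \<in> A"
  by (auto simp: image_iff complex_eq_iff)

lemma open_compl_of_real_image:
  assumes "closed A"
  shows "open (- complex_of_real ` A)"
proof -
  have "complex_of_real ` A = {z. Im z = 0} \<inter> Re -` A"
    by (auto simp: of_real_image_iff)
  moreover have "closed ({z. Im z = 0} \<inter> Re -` A)"
    by (intro closed_Int closed_Collect_eq continuous_closed_vimage assms continuous_intros) auto
  ultimately show ?thesis by (simp only: open_Compl)
qed

text \<open>The point of the segment at parameter t has imaginary part t Im x, so it is real only if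
  t = 0 or x is real; a real x lies to the left of \<open>d\<close>, and convexity finishes.\<close>

lemma star_slit_right:
  assumes "c < d" "x \<in> - complex_of_real ` {d..}"
  shows "closed_segment (of_real c) x \<subseteq> - complex_of_real ` {d..}"
proof
  fix w assume "w \<in> closed_segment (of_real c) x"
  then obtain t where t: "0 \<le> t" "t \<le> 1" and w: "w = (1 - t) *\<^sub>R of_real c + t *\<^sub>R x"
    unfolding in_segment by blast
  show "w \<in> - complex_of_real ` {d..}"
  proof (cases "Im x = 0 \<or> t = 0")
    case True
    then have "(1 - t) * c + t * Re x < d"
    proof
      assume "Im x = 0"
      then have "Re x < d" using assms(2) by (simp add: of_real_image_iff)
      with assms(1) t show ?thesis by (intro convex_bound_lt) auto
    next
      assume "t = 0"
      then show ?thesis using assms(1) by simp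
    qed
    then show ?thesis by (simp add: of_real_image_iff w)
  qed (simp add: of_real_image_iff w)
qed

lemma star_eta_domain:
  assumes "x \<in> eta_domain"
  shows "closed_segment (of_real (1 / 2)) x \<subseteq> eta_domain"
proof
  fix w assume "w \<in> closed_segment (of_real (1 / 2)) x"
  then obtain t where t: "0 \<le> t" "t \<le> 1" and w: "w = (1 - t) *\<^sub>R of_real (1 / 2) + t *\<^sub>R x"
    unfolding in_segment by blast
  show "w \<in> eta_domain"
  proof (cases "Im x = 0 \<or> t = 0")
    case True
    then have "(1 - t) * (1 / 2) + t * Re x < 1 \<and> (1 - t) * (- 1 / 2) + t * (- Re x) < 0"
    proof
      assume "Im x = 0"
      then have "Re x < 1" "- Re x < 0" using assms by (simp_all add: of_real_image_iff)
      with t show ?thesis by (intro conjI convex_bound_lt) auto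
    next
      assume "t = 0"
      then show ?thesis by simp
    qed
    then show ?thesis by (simp add: of_real_image_iff w)
  qed (simp add: of_real_image_iff w)
qed

lemma eta_domain_props:
  "open eta_domain" "connected eta_domain" "of_real (1 / 2) \<in> eta_domain"
  "leg_q holomorphic_on eta_domain"
proof -
  show "open eta_domain" by (intro open_compl_of_real_image closed_Un) auto
  show *: "of_real (1 / 2) \<in> eta_domain" by (simp add: of_real_image_iff)
  show "connected eta_domain"
    by (rule starlike_imp_connected, unfold starlike_def, rule bexI[OF _ *], rule ballI, erule star_eta_domain)
  show "leg_q holomorphic_on eta_domain"
    unfolding leg_q_def[abs_def] by (intro holomorphic_intros) (auto simp: of_real_image_iff)
qed

lemma has_field_derivative_powr_over:
  fixes z :: complex
  assumes "z \<notin> \<real>\<^sub>\<le>\<^sub>0"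
  shows "((\<lambda>z. z powr s) has_field_derivative s * z powr s / z) (at z)"
proof -
  have "z \<noteq> 0" using assms by auto
  then have "s * z powr (s - 1) = s * z powr s / z"
    by (simp only: powr_diff powr_to_1 if_False times_divide_eq_right)
  then show ?thesis
    using has_field_derivative_powr[OF assms, of s] by (simp only:)
qed

text \<open>The equation in the variable \<open>x = 1 / \<eta>\<close> is singular at \<open>x = 0\<close>, so the continuation is glued from
  the series on the disc and a solution on the plane slit along the whole positive half-line.\<close>

lemma hyp2F1_slit_plane:
  assumes a: "Im a \<noteq> 0"
  shows "hyp2F1 a (a + 1) (2 * a + 2) holomorphic_on - complex_of_real ` {1..}"
    and "norm x < 1 \<Longrightarrow> hyp2F1 a (a + 1) (2 * a + 2) x = hyp_H a x"
proof -
  let ?V = "- complex_of_real ` {1..}" and ?S = "- complex_of_real ` {0..}"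
  \<comment> \<open>The point -2 is a star centre of \<open>?S\<close>, and the unit ball around it
    lies in |\<open>\<eta>\<close>| > 1, where the series in 1/\<open>\<eta>\<close>
    converges.\<close>
  let ?k = "a * (a + 1)" and ?e = "- 2 :: complex"
  have oS: "open ?S" and oV: "open ?V" by (intro open_compl_of_real_image; simp)+
  have star: "closed_segment ?e x \<subseteq> ?S" if "x \<in> ?S" for x
    using star_slit_right[of "- 2" 0 x] that by simp
  have eS: "?e \<in> ?S" by (simp add: of_real_image_iff)
  have cS: "connected ?S"
    by (rule starlike_imp_connected, unfold starlike_def, rule bexI[OF _ eS], rule ballI, erule star)
  have qS: "leg_q holomorphic_on ?S"
    unfolding leg_q_def[abs_def] by (intro holomorphic_intros) (auto simp: of_real_image_iff)
  obtain u u' where u: "\<And>x. x \<in> ?S \<Longrightarrow> (u has_field_derivative u' x) (at x)"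
    "\<And>x. x \<in> ?S \<Longrightarrow> (u' has_field_derivative ?k * leg_q x * u x) (at x)" "u ?e = 1" "u' ?e = 0"
    by (rule linear_ode_solution[OF oS eS star qS, of 1 0]) blast+
  obtain w w' where w: "\<And>x. x \<in> ?S \<Longrightarrow> (w has_field_derivative w' x) (at x)"
    "\<And>x. x \<in> ?S \<Longrightarrow> (w' has_field_derivative ?k * leg_q x * w x) (at x)" "w ?e = 0" "w' ?e = 1"
    by (rule linear_ode_solution[OF oS eS star qS, of 0 1]) blast+
  have uw: "u x * w' x - u' x * w x = 1" if "x \<in> ?S" for x
    using wronskian_constant[OF oS cS u(1,2) w(1,2) eS that] u w by simp
  \<comment> \<open>The minus sign moves the cut of the power to the positive half-line, which
    \<open>?S\<close> omits.\<close>
  define p where "p \<eta> = (- \<eta>) powr (- a)" for \<eta>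
  define y where "y \<eta> = p \<eta> * hyp_H a (1 / \<eta>)" for \<eta>
  define y' where "y' \<eta> = - (p \<eta> * hyp_H1 a (1 / \<eta>) / \<eta>)" for \<eta>
  have nS: "- \<eta> \<notin> \<real>\<^sub>\<le>\<^sub>0" "\<eta> \<noteq> 0" if "\<eta> \<in> ?S" for \<eta>
    using that by (auto simp: of_real_image_iff complex_nonpos_Reals_iff)
  have p: "(p has_field_derivative - a * p \<eta> / \<eta>) (at \<eta>)" if "\<eta> \<in> ?S" for \<eta>
  proof -
    have "((\<lambda>\<eta>. (- \<eta>) powr (- a)) has_field_derivative
        (- a * (- \<eta>) powr (- a) / (- \<eta>)) * (- 1)) (at \<eta>)"
      using has_field_derivative_powr_over[OF nS(1)[OF that], of "- a"]
      by (rule DERIV_chain2) (auto intro!: derivative_eq_intros)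
    then show ?thesis unfolding p_def[abs_def] by simp
  qed
  have pnz: "p \<eta> \<noteq> 0" if "\<eta> \<in> ?S" for \<eta> using nS[OF that] by (simp add: p_def)
  let ?B = "ball ?e 1"
  have B: "norm \<eta> > 1" "\<eta> \<in> ?S" if "\<eta> \<in> ?B" for \<eta>
  proof -
    have d: "norm (- 2 - \<eta>) < 1" using that by (simp add: dist_norm)
    show "norm \<eta> > 1" using norm_triangle_ineq2[of "-2" \<eta>] norm_triangle_ineq4[of "- 2 - \<eta>" "-\<eta>"] d
      norm_triangle_ineq[of "- 2 - \<eta>" \<eta>] by simp
    show "\<eta> \<in> ?S" using abs_Re_le_cmod[of "- 2 - \<eta>"] d by (auto simp: of_real_image_iff)
  qed
  define G where "G \<eta> = (y ?e * w' ?e - y' ?e * w ?e) * u \<eta> + (u ?e * y' ?e - u' ?e * y ?e) * w \<eta>" for \<eta>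
  have yG: "y \<eta> = G \<eta>" if "\<eta> \<in> ?B" for \<eta>
    unfolding G_def
  proof (rule ode_solution_span[where S = ?B and q = "\<lambda>x. ?k * leg_q x"])
    fix x assume x: "x \<in> ?B"
    show "(y has_field_derivative y' x) (at x)" "(y' has_field_derivative ?k * leg_q x * y x) (at x)"
      using series_solution[OF a B(1)[OF x] p[OF B(2)[OF x]]] unfolding y_def[abs_def] y'_def[abs_def] .
  qed (use u w uw B that in auto)
  have hG: "G holomorphic_on ?S"
    unfolding G_def using u(1) w(1) oS
    by (intro holomorphic_intros) (auto simp: holomorphic_on_open)
  have hp: "p holomorphic_on ?S"
    using p oS by (auto simp: holomorphic_on_open)
  have invS: "1 / x \<in> ?S" if "x \<in> ?S" for x
  proof
    assume "1 / x \<in> complex_of_real ` {0..}"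
    then obtain r where r: "r \<ge> 0" "1 / x = of_real r" by auto
    have "x = 1 / (1 / x)" by simp
    also have "\<dots> = of_real (1 / r)" unfolding r by simp
    finally have "x = of_real (1 / r)" .
    then have "x \<in> complex_of_real ` {0..}"
      using r(1) by (intro image_eqI[of _ _ "1 / r"]) auto
    then show False using that by blast
  qed
  \<comment> \<open>Dividing by \<open>p\<close> recovers the continuation of the bare series from
    that of the solution. The first branch supplies the points of [0, 1), which are missing from
    \<open>?S\<close>.\<close>
  define F where "F x = (if x \<in> ball 0 1 then hyp_H a x else G (1 / x) / p (1 / x))" for x
  have hq: "(\<lambda>x. G (1 / x) / p (1 / x)) holomorphic_on ?S"
  proof (intro holomorphic_on_divide)
    have i: "(\<lambda>x. 1 / x) holomorphic_on ?S"
      by (intro holomorphic_intros) (auto simp: of_real_image_iff)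
    have sub: "(\<lambda>x. 1 / x) ` ?S \<subseteq> ?S"
      by (rule image_subsetI) (rule invS)
    show "(\<lambda>x. G (1 / x)) holomorphic_on ?S" "(\<lambda>x. p (1 / x)) holomorphic_on ?S"
      using holomorphic_on_compose_gen[OF i hG sub] holomorphic_on_compose_gen[OF i hp sub]
      by (simp_all add: o_def)
    show "\<And>x. x \<in> ?S \<Longrightarrow> p (1 / x) \<noteq> 0" by (rule pnz[OF invS])
  qed
  have hH: "hyp_H a holomorphic_on ball 0 1"
    unfolding holomorphic_on_open[OF open_ball] by (metis DERIV_hyp_H(1)[OF a] mem_ball_0)
  have agree: "hyp_H a x = G (1 / x) / p (1 / x)" if "x \<in> ball 0 1" "x \<in> ?S" for x
  proof (rule analytic_continuation_open[of "ball (- 1 / 2) (1 / 6)" "ball 0 1 \<inter> ?S" "hyp_H a"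
        "\<lambda>x. G (1 / x) / p (1 / x)" x])
    show "connected (ball 0 1 \<inter> ?S)"
    proof (rule starlike_imp_connected, unfold starlike_def, intro bexI ballI)
      show "- 1 / 2 \<in> ball 0 1 \<inter> ?S" by (simp add: of_real_image_iff)
      fix x assume x: "x \<in> ball 0 1 \<inter> ?S"
      then have "closed_segment (of_real (- 1 / 2)) x \<subseteq> ?S"
        by (intro star_slit_right) auto
      moreover have "closed_segment (- 1 / 2) x \<subseteq> ball 0 1"
        using x by (intro closed_segment_subset) auto
      ultimately show "closed_segment (- 1 / 2) x \<subseteq> ball 0 1 \<inter> ?S" by simp
    qed
    \<comment> \<open>Radius 1/6 around -1/2 forces |x| > 1/3, and |-2 - 1/x| = 2 |-1/2 - x| / |x|
      is then below 1: inversion maps the small ball into the ball around -2 where \<open>y\<close>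
      and \<open>G\<close> agree.\<close>
    have near: "x \<in> ball 0 1 \<inter> ?S \<and> 1 / x \<in> ?B" if "x \<in> ball (- 1 / 2) (1 / 6)" for x
    proof -
      have d: "norm (- 1 / 2 - x) < 1 / 6" using that by (simp add: dist_norm)
      have "norm x < 1" using norm_triangle_ineq2[of x "- 1 / 2"] d by (simp add: norm_minus_commute)
      moreover have n: "norm x > 1 / 3" using norm_triangle_ineq2[of "- 1 / 2" x] d by simp
      moreover have "x \<in> ?S" using abs_Re_le_cmod[of "- 1 / 2 - x"] d by (auto simp: of_real_image_iff)
      moreover have "norm (- 2 - 1 / x) < 1"
      proof -
        have "x \<noteq> 0" using n by auto
        then have "- 2 - 1 / x = 2 * (- 1 / 2 - x) / x" by (simp add: field_simps)
        then have "norm (- 2 - 1 / x) = 2 * norm (- 1 / 2 - x) / norm x"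
          by (simp only: norm_mult norm_divide norm_numeral)
        also have "\<dots> < 1" using d n by (simp add: divide_less_eq)
        finally show ?thesis .
      qed
      ultimately show ?thesis by (simp add: dist_norm)
    qed
    show "ball (- 1 / 2) (1 / 6) \<subseteq> ball 0 1 \<inter> ?S" by (rule subsetI) (rule conjunct1[OF near])
    show "hyp_H a x = G (1 / x) / p (1 / x)" if "x \<in> ball (- 1 / 2) (1 / 6)" for x
    proof -
      have "1 / x \<in> ?B" using near[OF that] by (rule conjunct2)
      from yG[OF this] pnz[OF B(2)[OF this]] show ?thesis by (simp add: y_def field_simps)
    qed
    show "hyp_H a holomorphic_on ball 0 1 \<inter> ?S" "(\<lambda>x. G (1 / x) / p (1 / x)) holomorphic_on ball 0 1 \<inter> ?S"
      by (rule holomorphic_on_subset[OF hH] holomorphic_on_subset[OF hq]; simp)+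
    show "open (ball 0 1 \<inter> ?S)" by (rule open_Int[OF open_ball oS])
    show "x \<in> ball 0 1 \<inter> ?S" using that by (rule IntI)
  qed simp_all
  have V_eq: "?V = ball 0 1 \<union> ?S"
  proof (intro set_eqI iffI)
    fix x assume "x \<in> ?V"
    then show "x \<in> ball 0 1 \<union> ?S"
      by (cases "Im x = 0") (auto simp: of_real_image_iff cmod_eq_Re)
  next
    fix x assume "x \<in> ball 0 1 \<union> ?S"
    then show "x \<in> ?V"
      using complex_Re_le_cmod[of x] by (auto simp: of_real_image_iff)
  qed
  have "F holomorphic_on ?V"
    unfolding F_def[abs_def] V_eq by (rule holomorphic_on_If_Un[OF hH hq open_ball oS agree])
  moreover have "\<forall>z\<in>ball 0 1. F z = hyp_H a z" by (simp add: F_def)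
  ultimately have *: "hyp2F1 a (a + 1) (2 * a + 2) holomorphic_on ?V
      \<and> (\<forall>z\<in>ball 0 1. hyp2F1 a (a + 1) (2 * a + 2) z = hyp_H a z)"
    unfolding hyp2F1_def analytic_continuation_def hyp_fps_def
    by (rule someI[of "\<lambda>F. F holomorphic_on ?V \<and> (\<forall>z\<in>ball 0 1. F z = eval_fps (fps_hypergeo [a, a + 1] [2 * a + 2] 1) z)" F, OF conjI])
  show "hyp2F1 a (a + 1) (2 * a + 2) holomorphic_on ?V"
    using * by (rule conjunct1)
  show "hyp2F1 a (a + 1) (2 * a + 2) x = hyp_H a x" if "norm x < 1"
    by (rule bspec[OF conjunct2[OF *]]) (simp add: that)
qed

section \<open>The functions h and s\<close>

definition h_pow :: "complex \<Rightarrow> complex \<Rightarrow> complex" where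
  "h_pow a \<eta> = exp (a * of_real pi * \<i>) * \<eta> powr (- a)"

definition h_ser :: "complex \<Rightarrow> complex \<Rightarrow> complex" where
  "h_ser a \<eta> = h_pow a \<eta> * hyp_H a (1 / \<eta>)"

definition h_ser' :: "complex \<Rightarrow> complex \<Rightarrow> complex" where
  "h_ser' a \<eta> = - (h_pow a \<eta> * hyp_H1 a (1 / \<eta>) / \<eta>)"

text \<open>The sign in front of \<open>s_inf\<close> is exp(-pi i), produced by the shift by -1 in
  the exponent. Every fact about \<open>s_inf\<close> thus becomes an instance of one about
  \<open>h_inf\<close>.\<close>

lemma s_inf_eq_h_inf: "s_inf a = h_inf (- 1 - a)"
proof -
  define b where "b = - 1 - a"
  have "b * of_real pi * \<i> = - a * of_real pi * \<i> - of_real pi * \<i>"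
    by (simp add: b_def algebra_simps)
  then have "exp (b * of_real pi * \<i>) = - exp (- a * of_real pi * \<i>)"
    by (simp only: exp_diff exp_pi_i) simp
  moreover have "- b = a + 1" "- a - 1 = b" "b + 1 = - a" "2 * b + 2 = - 2 * a"
    by (auto simp: b_def algebra_simps)
  ultimately have "s_inf a = h_inf b"
    unfolding s_inf_def h_inf_def by (simp only:)
  then show ?thesis by (simp only: b_def)
qed

lemma nonpos_Reals_upper: "Im \<eta> > 0 \<Longrightarrow> \<eta> \<notin> \<real>\<^sub>\<le>\<^sub>0"
  by (auto simp: complex_nonpos_Reals_iff)

lemma DERIV_h_pow:
  assumes "Im \<eta> > 0"
  shows "(h_pow a has_field_derivative - a * h_pow a \<eta> / \<eta>) (at \<eta>)"
  using DERIV_cmult[OF has_field_derivative_powr_over[OF nonpos_Reals_upper[OF assms], of "- a"],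
      of "exp (a * of_real pi * \<i>)"]
  unfolding h_pow_def[abs_def] by (simp add: mult_ac)

lemma h_ser_ode:
  assumes "Im a \<noteq> 0" "Im \<eta> > 0" "norm \<eta> > 1"
  shows "(h_ser a has_field_derivative h_ser' a \<eta>) (at \<eta>)"
    "(h_ser' a has_field_derivative a * (a + 1) * leg_q \<eta> * h_ser a \<eta>) (at \<eta>)"
  using series_solution[OF assms(1,3) DERIV_h_pow[OF assms(2)]]
  unfolding h_ser_def[abs_def] h_ser'_def[abs_def] by simp_all

section \<open>Expansion of h in a basis holomorphic on the slit domain\<close>

definition far_upper :: "complex set" where
  "far_upper = {\<eta>. Im \<eta> > 0 \<and> norm \<eta> > 1}"

lemma open_far_upper: "open far_upper"
  unfolding far_upper_def by (intro open_Collect_conj open_Collect_less continuous_intros)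

lemma open_upper: "open {\<eta>. Im \<eta> > 0}"
  by (intro open_Collect_less continuous_intros)

lemma upper_subset: "{\<eta>. Im \<eta> > 0} \<subseteq> eta_domain"
  by (auto simp: of_real_image_iff)

lemma far_upper_subset: "far_upper \<subseteq> {\<eta>. Im \<eta> > 0}"
  by (auto simp: far_upper_def)

lemma connected_upper: "connected {\<eta>. Im \<eta> > 0}"
  by (intro convex_connected convex_halfspace_Im_gt)

text \<open>One family indexed by \<open>k\<close>, fixed before \<open>a\<close> is given; without
  a common basis, continuity in \<open>a\<close> could not be transferred from the coefficients to
  \<open>h_inf\<close>.\<close>

definition fundamental_system where
  "fundamental_system u u' w w' \<longleftrightarrow>
     (\<forall>k x. x \<in> eta_domain \<longrightarrow> (u k has_field_derivative u' k x) (at x)) \<and>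
     (\<forall>k x. x \<in> eta_domain \<longrightarrow> (u' k has_field_derivative k * leg_q x * u k x) (at x)) \<and>
     (\<forall>k x. x \<in> eta_domain \<longrightarrow> (w k has_field_derivative w' k x) (at x)) \<and>
     (\<forall>k x. x \<in> eta_domain \<longrightarrow> (w' k has_field_derivative k * leg_q x * w k x) (at x)) \<and>
     (\<forall>k x. x \<in> eta_domain \<longrightarrow> u k x * w' k x - u' k x * w k x = 1) \<and>
     (\<forall>k x. x \<in> eta_domain \<longrightarrow> isCont (\<lambda>k. u k x) k \<and> isCont (\<lambda>k. u' k x) k
        \<and> isCont (\<lambda>k. w k x) k \<and> isCont (\<lambda>k. w' k x) k)"

lemma fundamental_systemD:
  assumes "fundamental_system u u' w w'" "x \<in> eta_domain"
  shows "(u k has_field_derivative u' k x) (at x)"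
    "(u' k has_field_derivative k * leg_q x * u k x) (at x)"
    "(w k has_field_derivative w' k x) (at x)"
    "(w' k has_field_derivative k * leg_q x * w k x) (at x)"
    "u k x * w' k x - u' k x * w k x = 1"
    "isCont (\<lambda>k. u k x) k" "isCont (\<lambda>k. u' k x) k" "isCont (\<lambda>k. w k x) k" "isCont (\<lambda>k. w' k x) k"
  using assms unfolding fundamental_system_def by meson+

lemma fundamental_system_exists: "\<exists>u u' w w'. fundamental_system u u' w w'"
proof -
  note E = eta_domain_props
  obtain u u' where u: "\<And>k x. x \<in> eta_domain \<Longrightarrow> (u k has_field_derivative u' k x) (at x)"
    "\<And>k x. x \<in> eta_domain \<Longrightarrow> (u' k has_field_derivative k * leg_q x * u k x) (at x)"
    "\<And>k. u k (of_real (1 / 2)) = 1" "\<And>k. u' k (of_real (1 / 2)) = 0"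
    "\<And>x k. x \<in> eta_domain \<Longrightarrow> isCont (\<lambda>k. u k x) k"
    "\<And>x k. x \<in> eta_domain \<Longrightarrow> isCont (\<lambda>k. u' k x) k"
    by (rule linear_ode_solution[OF E(1,3) star_eta_domain E(4), of 1 0], assumption, rule that, assumption+)
  obtain w w' where w: "\<And>k x. x \<in> eta_domain \<Longrightarrow> (w k has_field_derivative w' k x) (at x)"
    "\<And>k x. x \<in> eta_domain \<Longrightarrow> (w' k has_field_derivative k * leg_q x * w k x) (at x)"
    "\<And>k. w k (of_real (1 / 2)) = 0" "\<And>k. w' k (of_real (1 / 2)) = 1"
    "\<And>x k. x \<in> eta_domain \<Longrightarrow> isCont (\<lambda>k. w k x) k"
    "\<And>x k. x \<in> eta_domain \<Longrightarrow> isCont (\<lambda>k. w' k x) k"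
    by (rule linear_ode_solution[OF E(1,3) star_eta_domain E(4), of 0 1], assumption, rule that, assumption+)
  have "u k x * w' k x - u' k x * w k x = 1" if "x \<in> eta_domain" for k x
    using wronskian_constant[OF E(1,2) u(1,2)[where k = k] w(1,2)[where k = k] E(3) that] u w
    by simp
  with u w have "fundamental_system u u' w w'"
    unfolding fundamental_system_def by (intro conjI allI impI; assumption?; simp only:)
  then show ?thesis by (intro exI)
qed

text \<open>The series satisfies the same equation, so near \<open>\<eta>0\<close> it is the
  combination with Wronskian coefficients, and this combination is holomorphic on all of
  \<open>eta_domain\<close>. The point \<open>\<eta>0\<close> stays free: continuity in the
  parameter needs it far out, while comparison with the series takes it equal to
  \<open>\<eta>\<close>.\<close>

lemma h_inf_eq_combination:
  assumes B: "fundamental_system u u' w w'" and a: "Im a \<noteq> 0" and \<eta>0: "\<eta>0 \<in> far_upper" and "\<eta> \<in> eta_domain"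
  defines "k \<equiv> a * (a + 1)"
  defines "c1 \<equiv> h_ser a \<eta>0 * w' k \<eta>0 - h_ser' a \<eta>0 * w k \<eta>0"
  defines "c2 \<equiv> u k \<eta>0 * h_ser' a \<eta>0 - u' k \<eta>0 * h_ser a \<eta>0"
  shows "h_inf a \<eta> = c1 * u k \<eta> + c2 * w k \<eta>"
proof -
  note E = eta_domain_props
  define G where "G \<eta> = c1 * u k \<eta> + c2 * w k \<eta>" for \<eta>
  define f where "f = (\<lambda>\<eta>. exp (a * of_real pi * \<i>) * \<eta> powr (- a) * hyp2F1 a (a + 1) (2 * a + 2) (1 / \<eta>))"
  have "(G has_field_derivative c1 * u' k x + c2 * w' k x) (at x)" if "x \<in> eta_domain" for x
    unfolding G_def by (intro DERIV_add DERIV_cmult fundamental_systemD[OF B that])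
  then have hG: "G holomorphic_on eta_domain"
    unfolding holomorphic_on_open[OF E(1)] by metis
  have hf: "f holomorphic_on {\<eta>. Im \<eta> > 0}"
  proof -
    have "(\<lambda>\<eta>. 1 / \<eta>) holomorphic_on {\<eta>. Im \<eta> > 0}"
      by (intro holomorphic_intros) auto
    moreover have "(\<lambda>\<eta>. 1 / \<eta>) ` {\<eta>. Im \<eta> > 0} \<subseteq> - complex_of_real ` {1..}"
    proof (rule image_subsetI, rule ComplI)
      fix \<eta> :: complex assume \<eta>: "\<eta> \<in> {\<eta>. Im \<eta> > 0}" "1 / \<eta> \<in> complex_of_real ` {1..}"
      then obtain r where r: "1 / \<eta> = of_real r" by auto
      have "\<eta> = 1 / (1 / \<eta>)" by simp
      also have "\<dots> = of_real (1 / r)" unfolding r by simp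
      finally have "Im \<eta> = 0" by (metis Im_complex_of_real)
      with \<eta>(1) show False by simp
    qed
    ultimately have "(\<lambda>\<eta>. hyp2F1 a (a + 1) (2 * a + 2) (1 / \<eta>)) holomorphic_on {\<eta>. Im \<eta> > 0}"
      using holomorphic_on_compose_gen[OF _ hyp2F1_slit_plane(1)[OF a]] by (simp add: o_def)
    moreover have "h_pow a holomorphic_on {\<eta>. Im \<eta> > 0}"
      unfolding holomorphic_on_open[OF open_upper] using DERIV_h_pow by blast
    ultimately show ?thesis
      using holomorphic_on_mult unfolding f_def h_pow_def[abs_def] by blast
  qed
  obtain e where e: "e > 0" "ball \<eta>0 e \<subseteq> far_upper"
    using open_far_upper \<eta>0 by (meson open_contains_ball)
  have sub: "ball \<eta>0 e \<subseteq> {\<eta>. Im \<eta> > 0}" using e(2) far_upper_subset by (rule order_trans)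
  have near: "G x = f x" if x: "x \<in> ball \<eta>0 e" for x
  proof -
    have D: "Im y > 0 \<and> norm y > 1 \<and> y \<in> eta_domain" if "y \<in> ball \<eta>0 e" for y
    proof -
      have "y \<in> far_upper" using that e(2) by (rule subsetD[rotated])
      then show ?thesis by (simp add: far_upper_def of_real_image_iff)
    qed
    have "h_ser a x = G x"
      unfolding G_def c1_def c2_def
    proof (rule ode_solution_span[where S = "ball \<eta>0 e" and q = "\<lambda>x. k * leg_q x"])
      show "\<eta>0 \<in> ball \<eta>0 e" "x \<in> ball \<eta>0 e" using e(1) x by simp_all
      fix y assume "y \<in> ball \<eta>0 e"
      then have y: "Im y > 0" "norm y > 1" "y \<in> eta_domain" using D by blast+
      show "(h_ser a has_field_derivative h_ser' a y) (at y)"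
        "(h_ser' a has_field_derivative k * leg_q y * h_ser a y) (at y)"
        using h_ser_ode[OF a y(1,2)] unfolding k_def by simp_all
    qed (use fundamental_systemD[OF B] D in simp_all)
    moreover have "h_ser a x = f x"
      unfolding h_ser_def f_def h_pow_def
      using D[OF x] by (subst hyp2F1_slit_plane(2)[OF a]) (auto simp: norm_divide divide_less_eq)
    ultimately show ?thesis by simp
  qed
  \<comment> \<open>The definition of \<open>h_inf\<close> prescribes values on the whole upper
    half-plane, but the series argument reaches only a ball outside the unit disc; the identity
    theorem bridges the gap.\<close>
  have "G x = f x" if "Im x > 0" for x
  proof (rule analytic_continuation_open[OF open_ball open_upper _ connected_upper sub _ hf near])
    show "G holomorphic_on {\<eta>. Im \<eta> > 0}" by (rule holomorphic_on_subset[OF hG upper_subset])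
  qed (use e that in auto)
  then have "h_inf a \<eta> = G \<eta>"
    unfolding h_inf_def f_def[symmetric]
    by (intro analytic_continuation_eq[OF open_upper _ upper_subset E(1,2) hG _ assms(4)])
      (auto intro: exI[of _ \<i>])
  then show ?thesis by (simp add: G_def)
qed

lemma deriv_h_inf_eq_combination:
  assumes B: "fundamental_system u u' w w'" and a: "Im a \<noteq> 0" and \<eta>0: "\<eta>0 \<in> far_upper" and "\<eta> \<in> eta_domain"
  defines "k \<equiv> a * (a + 1)"
  defines "c1 \<equiv> h_ser a \<eta>0 * w' k \<eta>0 - h_ser' a \<eta>0 * w k \<eta>0"
  defines "c2 \<equiv> u k \<eta>0 * h_ser' a \<eta>0 - u' k \<eta>0 * h_ser a \<eta>0"
  shows "(h_inf a has_field_derivative c1 * u' k \<eta> + c2 * w' k \<eta>) (at \<eta>)"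
    and "deriv (h_inf a) \<eta> = c1 * u' k \<eta> + c2 * w' k \<eta>"
proof -
  have "((\<lambda>\<eta>. c1 * u k \<eta> + c2 * w k \<eta>) has_field_derivative c1 * u' k \<eta> + c2 * w' k \<eta>) (at \<eta>)"
    by (intro DERIV_add DERIV_cmult fundamental_systemD[OF B assms(4)])
  then show "(h_inf a has_field_derivative c1 * u' k \<eta> + c2 * w' k \<eta>) (at \<eta>)"
    by (rule has_field_derivative_transform_within_open[OF _ eta_domain_props(1) assms(4)])
      (simp only: h_inf_eq_combination[OF B a \<eta>0] c1_def c2_def k_def)
  then show "deriv (h_inf a) \<eta> = c1 * u' k \<eta> + c2 * w' k \<eta>"
    by (rule DERIV_imp_deriv)
qed

lemma two_i_far_upper: "2 * \<i> \<in> far_upper"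
  by (simp add: far_upper_def norm_mult)

lemma h_inf_ode:
  assumes a: "Im a \<noteq> 0" and \<eta>: "\<eta> \<in> eta_domain"
  shows "(h_inf a has_field_derivative deriv (h_inf a) \<eta>) (at \<eta>)"
    and "(deriv (h_inf a) has_field_derivative a * (a + 1) * leg_q \<eta> * h_inf a \<eta>) (at \<eta>)"
proof -
  obtain u u' w w' where B: "fundamental_system u u' w w'" using fundamental_system_exists by blast
  note C = h_inf_eq_combination[OF B a two_i_far_upper]
  note D = deriv_h_inf_eq_combination[OF B a two_i_far_upper]
  show "(h_inf a has_field_derivative deriv (h_inf a) \<eta>) (at \<eta>)"
    using D(1)[OF \<eta>] unfolding D(2)[OF \<eta>] .
  define k where "k = a * (a + 1)"
  define c1 where "c1 = h_ser a (2 * \<i>) * w' k (2 * \<i>) - h_ser' a (2 * \<i>) * w k (2 * \<i>)"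
  define c2 where "c2 = u k (2 * \<i>) * h_ser' a (2 * \<i>) - u' k (2 * \<i>) * h_ser a (2 * \<i>)"
  have "((\<lambda>\<eta>. c1 * u' k \<eta> + c2 * w' k \<eta>) has_field_derivative
      c1 * (k * leg_q \<eta> * u k \<eta>) + c2 * (k * leg_q \<eta> * w k \<eta>)) (at \<eta>)"
    by (intro DERIV_add DERIV_cmult fundamental_systemD[OF B \<eta>])
  then have "(deriv (h_inf a) has_field_derivative
      c1 * (k * leg_q \<eta> * u k \<eta>) + c2 * (k * leg_q \<eta> * w k \<eta>)) (at \<eta>)"
    by (rule has_field_derivative_transform_within_open[OF _ eta_domain_props(1) \<eta>])
      (simp only: D(2) c1_def c2_def k_def)
  also have "c1 * (k * leg_q \<eta> * u k \<eta>) + c2 * (k * leg_q \<eta> * w k \<eta>) = k * leg_q \<eta> * h_inf a \<eta>"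
    unfolding C[OF \<eta>] c1_def c2_def k_def by (simp add: algebra_simps)
  finally show "(deriv (h_inf a) has_field_derivative a * (a + 1) * leg_q \<eta> * h_inf a \<eta>) (at \<eta>)"
    unfolding k_def .
qed

text \<open>With \<open>\<eta>0 = \<eta>\<close> the two Wronskian coefficients collapse to the
  series, because the basis has Wronskian 1 at that point.\<close>

lemma h_inf_eq_series:
  assumes a: "Im a \<noteq> 0" and \<eta>: "\<eta> \<in> far_upper"
  shows "h_inf a \<eta> = h_ser a \<eta>" "deriv (h_inf a) \<eta> = h_ser' a \<eta>"
proof -
  have \<eta>': "\<eta> \<in> eta_domain" using \<eta> far_upper_subset upper_subset by blast
  obtain u u' w w' where B: "fundamental_system u u' w w'" using fundamental_system_exists by blast
  define k where "k = a * (a + 1)"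
  have "u k \<eta> * w' k \<eta> - u' k \<eta> * w k \<eta> = 1"
    by (rule fundamental_systemD(5)[OF B \<eta>'])
  then show "h_inf a \<eta> = h_ser a \<eta>" "deriv (h_inf a) \<eta> = h_ser' a \<eta>"
    unfolding h_inf_eq_combination[OF B a \<eta> \<eta>'] deriv_h_inf_eq_combination(2)[OF B a \<eta> \<eta>'] k_def[symmetric]
    by algebra+
qed

text \<open>In the expansion the basis is continuous in \<open>k\<close>, and the coefficients
  involve the series only at \<open>\<eta>0\<close>. Nearby parameters are nonreal as well, so the
  expansion holds in a neighbourhood of \<open>a0\<close>.\<close>

lemma isCont_h_inf:
  assumes a0: "Im a0 \<noteq> 0" and \<eta>: "\<eta> \<in> eta_domain"
  shows "isCont (\<lambda>a. h_inf a \<eta>) a0" "isCont (\<lambda>a. deriv (h_inf a) \<eta>) a0"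
proof -
  obtain u u' w w' where B: "fundamental_system u u' w w'" using fundamental_system_exists by blast
  obtain r where r: "0 < r" "r < 1"
    "\<And>x. norm x < r \<Longrightarrow> isCont (\<lambda>a. hyp_H a x) a0 \<and> isCont (\<lambda>a. hyp_H1 a x) a0"
    using isCont_hyp_H_param[OF a0] by blast
  \<comment> \<open>Here |1/\<open>\<eta>0\<close>| = r/2, inside the disc on which the series is
    known to be continuous in the parameter.\<close>
  define \<eta>0 where "\<eta>0 = \<i> * of_real (2 / r)"
  have n: "norm \<eta>0 = 2 / r" using r by (simp add: \<eta>0_def norm_mult norm_divide)
  have \<eta>0: "\<eta>0 \<in> far_upper"
  proof -
    have "2 / r > 1" using r(1,2) by (simp add: field_simps)
    moreover have "Im \<eta>0 > 0" using r(1) by (simp add: \<eta>0_def)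
    ultimately show ?thesis by (simp add: far_upper_def n)
  qed
  then have \<eta>0': "\<eta>0 \<in> eta_domain" using far_upper_subset upper_subset by blast
  have "norm (1 / \<eta>0) < r" unfolding norm_divide n using r by simp
  then have H: "isCont (\<lambda>a. hyp_H a (1 / \<eta>0)) a0" "isCont (\<lambda>a. hyp_H1 a (1 / \<eta>0)) a0"
    using r(3) by blast+
  have nz: "\<eta>0 \<noteq> 0" using n r by auto
  have "isCont (\<lambda>a. \<eta>0 powr (- a)) a0"
    using nz unfolding powr_def by (auto intro!: continuous_intros)
  moreover have "isCont (\<lambda>a. exp (a * of_real pi * \<i>)) a0"
    by (intro continuous_intros)
  ultimately have P: "isCont (\<lambda>a. h_pow a \<eta>0) a0"
    unfolding h_pow_def by (rule isCont_mult[rotated])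
  have S: "isCont (\<lambda>a. h_ser a \<eta>0) a0" "isCont (\<lambda>a. h_ser' a \<eta>0) a0"
    unfolding h_ser_def h_ser'_def using nz by (intro continuous_intros P H; simp)+
  have k: "isCont (\<lambda>a :: complex. a * (a + 1)) a0" by (intro continuous_intros)
  have U: "isCont (\<lambda>a. u (a * (a + 1)) x) a0" "isCont (\<lambda>a. u' (a * (a + 1)) x) a0"
    "isCont (\<lambda>a. w (a * (a + 1)) x) a0" "isCont (\<lambda>a. w' (a * (a + 1)) x) a0" if "x \<in> eta_domain" for x
    by (rule isCont_o2[OF k] fundamental_systemD[OF B that])+
  have ev: "\<forall>\<^sub>F a in nhds a0. Im a \<noteq> 0"
  proof -
    have "open {a. Im a \<noteq> 0}" by (intro open_Collect_neq continuous_intros)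
    then show ?thesis using a0 by (auto simp: eventually_nhds)
  qed
  let ?c1 = "\<lambda>a. h_ser a \<eta>0 * w' (a * (a + 1)) \<eta>0 - h_ser' a \<eta>0 * w (a * (a + 1)) \<eta>0"
  let ?c2 = "\<lambda>a. u (a * (a + 1)) \<eta>0 * h_ser' a \<eta>0 - u' (a * (a + 1)) \<eta>0 * h_ser a \<eta>0"
  have "isCont (\<lambda>a. ?c1 a * u (a * (a + 1)) \<eta> + ?c2 a * w (a * (a + 1)) \<eta>) a0"
    by (intro continuous_add continuous_diff continuous_mult S U \<eta> \<eta>0')
  moreover have "\<forall>\<^sub>F a in nhds a0. ?c1 a * u (a * (a + 1)) \<eta> + ?c2 a * w (a * (a + 1)) \<eta> = h_inf a \<eta>"
    using ev by eventually_elim (rule h_inf_eq_combination[OF B _ \<eta>0 \<eta>, symmetric])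
  ultimately show "isCont (\<lambda>a. h_inf a \<eta>) a0"
    by (subst isCont_cong[symmetric])
  have "isCont (\<lambda>a. ?c1 a * u' (a * (a + 1)) \<eta> + ?c2 a * w' (a * (a + 1)) \<eta>) a0"
    by (intro continuous_add continuous_diff continuous_mult S U \<eta> \<eta>0')
  moreover have "\<forall>\<^sub>F a in nhds a0. ?c1 a * u' (a * (a + 1)) \<eta> + ?c2 a * w' (a * (a + 1)) \<eta> = deriv (h_inf a) \<eta>"
    using ev by eventually_elim (rule deriv_h_inf_eq_combination(2)[OF B _ \<eta>0 \<eta>, symmetric])
  ultimately show "isCont (\<lambda>a. deriv (h_inf a) \<eta>) a0"
    by (subst isCont_cong[symmetric])
qed

section \<open>Contiguous relations and the Wronskian\<close>

text \<open>The constant of the contiguous relation between \<open>a - 1\<close> and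
  \<open>a\<close>. Its value is forced at x = 0, where \<open>hyp_H_contiguous\<close> reads a - 1
  = \<open>ladder a\<close> times -2 (2 a + 1).\<close>

definition ladder :: "complex \<Rightarrow> complex" where
  "ladder a = - (a - 1) / (2 * (2 * a + 1))"

lemma ladder_nonzero: "Im a \<noteq> 0 \<Longrightarrow> ladder a \<noteq> 0"
  using nonreal_add_of_nat(9,12)[of a]
  unfolding ladder_def divide_eq_0_iff mult_eq_0_iff neg_equal_0_iff_equal by auto

text \<open>The Pochhammer symbols at \<open>a - 1\<close> and \<open>a\<close> differ by shifts of
  their arguments, so the quotient of the coefficients telescopes to a rational function of n,
  stated here with denominators cleared.\<close>

lemma hyp_fps_shift:
  assumes "Im a \<noteq> 0"
  shows "(a - 1 + of_nat n) * (a + of_nat n) * (2 * (2 * a + 1)) * hyp_fps (a - 1) $ n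
       = (a - 1) * (2 * a + of_nat n) * (2 * a + 1 + of_nat n) * hyp_fps a $ n"
proof (induction n)
  case 0
  show ?case by (simp add: hyp_fps_0)
next
  case (Suc n)
  note nz = nonreal_add_of_nat[OF assms]
  define N :: complex where "N = of_nat n"
  define c where "c = hyp_fps (a - 1) $ n"
  define d where "d = hyp_fps a $ n"
  have N1: "N + 1 \<noteq> 0"
    unfolding N_def by (metis of_nat_Suc of_nat_eq_0_iff nat.distinct(1) add.commute)
  have n: "a + N \<noteq> 0" "a + 1 + N \<noteq> 0" "2 * a + N \<noteq> 0" "2 * a + 1 + N \<noteq> 0" "2 * a + 2 + N \<noteq> 0"
    using nz unfolding N_def by blast+
  have SN: "of_nat (Suc n) = N + 1" by (simp add: N_def)
  have c: "hyp_fps (a - 1) $ Suc n = (a - 1 + N) * (a + N) / ((2 * a + N) * (N + 1)) * c"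
    unfolding hyp_fps_Suc SN c_def N_def by (simp add: algebra_simps)
  have d: "hyp_fps a $ Suc n = (a + N) * (a + 1 + N) / ((2 * a + 2 + N) * (N + 1)) * d"
    unfolding hyp_fps_Suc SN d_def N_def by (simp add: algebra_simps)
  have IH: "(a - 1 + N) * (a + N) * (2 * (2 * a + 1)) * c = (a - 1) * (2 * a + N) * (2 * a + 1 + N) * d"
    using Suc.IH unfolding N_def c_def d_def .
  have "(a - 1 + (N + 1)) * (a + (N + 1)) * (2 * (2 * a + 1)) * ((a - 1 + N) * (a + N) / ((2 * a + N) * (N + 1)) * c)
      = (a + N) * (a + 1 + N) / ((2 * a + N) * (N + 1)) * ((a - 1 + N) * (a + N) * (2 * (2 * a + 1)) * c)"
    by (simp add: mult_ac add_ac)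
  also have "\<dots> = (a + N) * (a + 1 + N) / ((2 * a + N) * (N + 1)) * ((a - 1) * (2 * a + N) * (2 * a + 1 + N) * d)"
    unfolding IH ..
  also have "\<dots> = (a - 1) * (2 * a + (N + 1)) * (2 * a + 1 + (N + 1)) * ((a + N) * (a + 1 + N) / ((2 * a + 2 + N) * (N + 1)) * d)"
  proof -
    have e: "2 * a + (N + 1) = 2 * a + 1 + N" "2 * a + 1 + (N + 1) = 2 * a + 2 + N" by simp_all
    show ?thesis unfolding e using n N1 by (simp add: divide_simps)
  qed
  finally show ?case unfolding c d SN .
qed

text \<open>One of Gauss's contiguous relations. After \<open>hyp_fps_shift\<close> both sides have
  n-th coefficients that are rational multiples of the coefficient at \<open>a\<close>. The factor x
  - 2 becomes -(2\<open>\<eta>\<close> - 1)/\<open>\<eta>\<close> at x =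
  1/\<open>\<eta>\<close>.\<close>

lemma hyp_H_contiguous:
  assumes a: "Im a \<noteq> 0" and x: "norm x < 1"
  shows "hyp_H1 (a - 1) x = ladder a * ((x - 2) * hyp_H1 a x - 2 * (a + 1) * hyp_H a x)"
proof -
  have a': "Im (a - 1) \<noteq> 0" using a by simp
  note nz = nonreal_add_of_nat[OF a]
  note r = norm_less_conv_radius[OF a x] norm_less_conv_radius[OF a' x]
  define P where "P = (fps_X - fps_const 2) * hyp_fps1 a"
  define Q where "Q = fps_const (2 * (a + 1)) * hyp_fps a"
  have "hyp_fps1 (a - 1) $ n = (fps_const (ladder a) * (P - Q)) $ n" for n
  proof -
    define N :: complex where "N = of_nat n"
    define c where "c = hyp_fps a $ n"
    have n: "a + N \<noteq> 0" "2 * a + N \<noteq> 0" "2 * a + 1 + N \<noteq> 0" "2 * a + 1 \<noteq> 0" "a - 1 \<noteq> 0"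
      using nz unfolding N_def by blast+
    have "hyp_fps1 (a - 1) $ n = (a - 1 + N) * (a + N) * (2 * (2 * a + 1)) * hyp_fps (a - 1) $ n
        / ((a + N) * (2 * (2 * a + 1)))"
    proof -
      have "(a + N) * (2 * (2 * a + 1)) \<noteq> 0" unfolding mult_eq_0_iff using n by simp
      then show ?thesis
        by (simp only: eq_divide_eq if_True not_False_eq_True hyp_fps1_nth N_def mult_ac)
    qed
    also have "\<dots> = (a - 1) * (2 * a + N) * (2 * a + 1 + N) * c / ((a + N) * (2 * (2 * a + 1)))"
      using hyp_fps_shift[OF a, of n] unfolding N_def c_def by (simp only:)
    finally have 1: "hyp_fps1 (a - 1) $ n = \<dots>" .
    have 2: "(P - Q) $ n = N * (2 * a + 1 + N) / (a + N) * c - 2 * (2 * a + 1 + N) * c"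
    proof (cases n)
      case 0
      then show ?thesis by (simp add: P_def Q_def N_def c_def hyp_fps1_nth algebra_simps)
    next
      case (Suc m)
      have m: "of_nat m = N - 1" by (simp add: N_def Suc)
      have SN: "of_nat (Suc m) = N" by (simp add: N_def Suc)
      have "N \<noteq> 0" by (simp add: N_def Suc del: of_nat_Suc)
      have "c = (a + (N - 1)) * (a + N) / ((2 * a + 1 + N) * N) * hyp_fps a $ m"
        unfolding c_def Suc hyp_fps_Suc SN m by (simp add: algebra_simps)
      then have Z: "N * (2 * a + 1 + N) / (a + N) * c = (a + (N - 1)) * hyp_fps a $ m"
        using n \<open>N \<noteq> 0\<close> by simp
      have "P $ n = (a + (N - 1)) * hyp_fps a $ m - 2 * ((a + N) * c)"
        unfolding P_def left_diff_distrib
        by (simp add: Suc hyp_fps1_nth c_def N_def)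
      moreover have "(P - Q) $ n = P $ n - 2 * (a + 1) * c"
        by (simp add: Q_def c_def)
      ultimately show ?thesis
        unfolding Z by algebra
    qed
    show ?thesis
      unfolding 1 fps_mult_left_const_nth 2 ladder_def using n by (simp add: divide_simps) algebra
  qed
  then have eq: "hyp_fps1 (a - 1) = fps_const (ladder a) * (P - Q)"
    by (simp add: fps_eq_iff)
  have r1: "ereal (norm x) < fps_conv_radius (fps_X - fps_const 2 :: complex fps)"
    by (auto intro!: less_le_trans[OF _ fps_conv_radius_diff])
  have rP: "ereal (norm x) < fps_conv_radius P"
    unfolding P_def using r r1 by (auto intro!: less_le_trans[OF _ fps_conv_radius_mult])
  have rQ: "ereal (norm x) < fps_conv_radius Q"
    unfolding Q_def using r by (auto intro!: less_le_trans[OF _ fps_conv_radius_mult])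
  have rPQ: "ereal (norm x) < fps_conv_radius (P - Q)"
    using rP rQ by (auto intro!: less_le_trans[OF _ fps_conv_radius_diff])
  have "eval_fps P x = (x - 2) * hyp_H1 a x"
    unfolding P_def using r r1 by (simp add: eval_fps_mult eval_fps_diff)
  moreover have "eval_fps Q x = 2 * (a + 1) * hyp_H a x"
    unfolding Q_def using r by (subst eval_fps_mult) auto
  moreover have "eval_fps (fps_const (ladder a) * (P - Q)) x = ladder a * (eval_fps P x - eval_fps Q x)"
    using rP rQ rPQ by (subst eval_fps_mult) (auto simp: eval_fps_diff)
  ultimately show ?thesis unfolding eq by simp
qed

lemma h_pow_shift: "Im \<eta> > 0 \<Longrightarrow> h_pow (a - 1) \<eta> = - \<eta> * h_pow a \<eta>"
proof -
  assume "Im \<eta> > 0"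
  then have "\<eta> \<noteq> 0" by auto
  have "(a - 1) * of_real pi * \<i> = a * of_real pi * \<i> - of_real pi * \<i>"
    by (simp add: algebra_simps)
  then have "exp ((a - 1) * of_real pi * \<i>) = - exp (a * of_real pi * \<i>)"
    by (simp only: exp_diff exp_pi_i) simp
  moreover have "\<eta> powr (- (a - 1)) = \<eta> * \<eta> powr (- a)"
    using powr_add[of \<eta> 1 "- a"] by simp
  ultimately show ?thesis by (simp add: h_pow_def)
qed

lemma holomorphic_h_inf:
  assumes "Im a \<noteq> 0"
  shows "h_inf a holomorphic_on eta_domain" "deriv (h_inf a) holomorphic_on eta_domain"
  unfolding holomorphic_on_open[OF eta_domain_props(1)]
  by (meson h_inf_ode[OF assms])+

lemma far_upper_nonempty: "far_upper \<noteq> {}"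
  using two_i_far_upper by blast

text \<open>On \<open>far_upper\<close> this is \<open>hyp_H_contiguous\<close> at
  1/\<open>\<eta>\<close>, the powers being related by \<open>h_pow_shift\<close>; the identity
  theorem carries it to the slit domain.\<close>

lemma deriv_h_inf_lower:
  assumes a: "Im a \<noteq> 0" and \<eta>: "\<eta> \<in> eta_domain"
  shows "deriv (h_inf (a - 1)) \<eta>
    = ladder a * ((2 * \<eta> - 1) * deriv (h_inf a) \<eta> - 2 * (a + 1) * h_inf a \<eta>)"
proof (rule analytic_continuation_open[OF open_far_upper eta_domain_props(1) far_upper_nonempty
      eta_domain_props(2) order_trans[OF far_upper_subset upper_subset] _ _ _ \<eta>,
      of "deriv (h_inf (a - 1))"])
  have a': "Im (a - 1) \<noteq> 0" using a by simp
  show "deriv (h_inf (a - 1)) holomorphic_on eta_domain"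
    by (rule holomorphic_h_inf(2)[OF a'])
  show "(\<lambda>\<eta>. ladder a * ((2 * \<eta> - 1) * deriv (h_inf a) \<eta> - 2 * (a + 1) * h_inf a \<eta>))
      holomorphic_on eta_domain"
    by (intro holomorphic_on_mult holomorphic_on_diff holomorphic_on_const holomorphic_on_ident
        holomorphic_h_inf a)
  fix \<eta> assume \<eta>: "\<eta> \<in> far_upper"
  then have n: "Im \<eta> > 0" "norm (1 / \<eta>) < 1" "\<eta> \<noteq> 0"
    by (auto simp: far_upper_def norm_divide divide_less_eq)
  have "deriv (h_inf (a - 1)) \<eta> = h_pow a \<eta> * hyp_H1 (a - 1) (1 / \<eta>)"
    unfolding h_inf_eq_series(2)[OF a' \<eta>] h_ser'_def h_pow_shift[OF n(1)] using n(3) by simp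
  also have "\<dots> = ladder a * ((2 * \<eta> - 1) * deriv (h_inf a) \<eta> - 2 * (a + 1) * h_inf a \<eta>)"
    unfolding hyp_H_contiguous[OF a n(2)] h_inf_eq_series[OF a \<eta>] h_ser'_def h_ser_def
    using n(3) by (simp add: field_simps)
  finally show "deriv (h_inf (a - 1)) \<eta>
    = ladder a * ((2 * \<eta> - 1) * deriv (h_inf a) \<eta> - 2 * (a + 1) * h_inf a \<eta>)" .
qed

text \<open>Obtained by differentiating \<open>deriv_h_inf_lower\<close>: the equation at
  \<open>a - 1\<close> turns the left side into a multiple of \<open>h_inf (a - 1)\<close>, the
  equation at \<open>a\<close> removes the second derivative on the right, and the common factor
  \<open>a\<close> cancels.\<close>

lemma h_inf_lower:
  assumes a: "Im a \<noteq> 0" and \<eta>: "\<eta> \<in> eta_domain"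
  shows "(a - 1) * h_inf (a - 1) \<eta>
    = ladder a * ((a + 1) * (2 * \<eta> - 1) * h_inf a \<eta> + 2 * \<eta> * (1 - \<eta>) * deriv (h_inf a) \<eta>)"
proof -
  have a': "Im (a - 1) \<noteq> 0" using a by simp
  note d = h_inf_ode[OF a \<eta>]
  have "((\<lambda>\<eta>. ladder a * ((2 * \<eta> - 1) * deriv (h_inf a) \<eta> - 2 * (a + 1) * h_inf a \<eta>)) has_field_derivative
      ladder a * ((2 * 1 - 0) * deriv (h_inf a) \<eta> + a * (a + 1) * leg_q \<eta> * h_inf a \<eta> * (2 * \<eta> - 1)
        - 2 * (a + 1) * deriv (h_inf a) \<eta>)) (at \<eta>)"
    by (intro DERIV_cmult DERIV_diff DERIV_mult DERIV_const DERIV_ident d)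
  then have "(deriv (h_inf (a - 1)) has_field_derivative
      ladder a * ((2 * 1 - 0) * deriv (h_inf a) \<eta> + a * (a + 1) * leg_q \<eta> * h_inf a \<eta> * (2 * \<eta> - 1)
        - 2 * (a + 1) * deriv (h_inf a) \<eta>)) (at \<eta>)"
    by (rule has_field_derivative_transform_within_open[OF _ eta_domain_props(1) \<eta>])
      (simp only: deriv_h_inf_lower[OF a])
  then have "(a - 1) * (a - 1 + 1) * leg_q \<eta> * h_inf (a - 1) \<eta>
     = ladder a * ((2 * 1 - 0) * deriv (h_inf a) \<eta> + a * (a + 1) * leg_q \<eta> * h_inf a \<eta> * (2 * \<eta> - 1)
        - 2 * (a + 1) * deriv (h_inf a) \<eta>)"
    using h_inf_ode(2)[OF a' \<eta>] DERIV_unique by blast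
  moreover have nz: "\<eta> \<noteq> 0" "1 - \<eta> \<noteq> 0" "a \<noteq> 0"
    using \<eta> a by (auto simp: of_real_image_iff complex_eq_iff)
  moreover have "leg_q \<eta> * (\<eta> * (1 - \<eta>)) = - 1"
    using nz by (simp add: leg_q_def)
  ultimately have "a * ((a - 1) * h_inf (a - 1) \<eta>)
     = a * (ladder a * ((a + 1) * (2 * \<eta> - 1) * h_inf a \<eta> + 2 * \<eta> * (1 - \<eta>) * deriv (h_inf a) \<eta>))"
    by algebra
  then show ?thesis using nz(3) by simp
qed

text \<open>The two lowering relations form a linear system that inverts because
  (2\<open>\<eta>\<close> - 1)^2 + 4\<open>\<eta>\<close>(1 - \<open>\<eta>\<close>) = 1; the terms
  in \<open>h_inf a\<close> drop out.\<close>

lemma deriv_h_inf_raise: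
  assumes a: "Im a \<noteq> 0" and \<eta>: "\<eta> \<in> eta_domain"
  shows "ladder a * deriv (h_inf a) \<eta>
    = (2 * \<eta> - 1) * deriv (h_inf (a - 1)) \<eta> + 2 * (a - 1) * h_inf (a - 1) \<eta>"
  using h_inf_lower[OF a \<eta>] deriv_h_inf_lower[OF a \<eta>] by algebra

text \<open>As \<open>s_inf a\<close> is \<open>h_inf\<close> at -a - 1, this is the raising
  relation from -a - 1 to -a.\<close>

lemma s_inf_contiguous:
  assumes a: "Im a \<noteq> 0" and \<eta>: "\<eta> \<in> eta_domain"
  shows "(2 * \<eta> - 1) * deriv (s_inf a) \<eta> - 2 * (a + 1) * s_inf a \<eta> = ladder (- a) * deriv (h_inf (- a)) \<eta>"
proof -
  have "Im (- a) \<noteq> 0" and e: "- a - 1 = - 1 - a" using a by auto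
  from deriv_h_inf_raise[OF this(1) \<eta>] show ?thesis
    unfolding s_inf_eq_h_inf e by (simp add: algebra_simps)
qed

text \<open>The Wronskian is constant, so its value can be found as \<open>\<eta>\<close> tends to
  infinity along the imaginary axis. The two powers multiply to -\<open>\<eta>\<close>, both series
  tend to their constant terms, and -(a - (-1 - a)) remains.\<close>

lemma wronskian_h_s:
  assumes a: "Im a \<noteq> 0" and \<eta>: "\<eta> \<in> eta_domain"
  shows "h_inf a \<eta> * deriv (s_inf a) \<eta> - deriv (h_inf a) \<eta> * s_inf a \<eta> = - (2 * a + 1)"
proof -
  define b where "b = - 1 - a"
  have b: "Im b \<noteq> 0" using a by (simp add: b_def)
  have kb: "b * (b + 1) = a * (a + 1)" by (simp add: b_def algebra_simps)
  define W where "W \<eta> = h_inf a \<eta> * deriv (h_inf b) \<eta> - deriv (h_inf a) \<eta> * h_inf b \<eta>" for \<eta>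
  have const: "W \<eta>' = W \<eta>" if "\<eta>' \<in> eta_domain" for \<eta>'
    unfolding W_def
    by (rule wronskian_constant[OF eta_domain_props(1,2) h_inf_ode[OF a] h_inf_ode[OF b, unfolded kb] \<eta> that])
  define V where "V x = hyp_H1 a x * hyp_H b x - hyp_H a x * hyp_H1 b x" for x
  have "isCont V 0"
    unfolding V_def by (intro continuous_intros isCont_hyp_H_arg a b) simp_all
  then have lim: "(V \<longlongrightarrow> V 0) (at 0)" by (simp add: isCont_def)
  have WV: "W x = - V (1 / x)" if x: "x \<in> far_upper" for x
  proof -
    have n: "x \<noteq> 0" "Im x > 0" using x by (auto simp: far_upper_def)
    have e: "exp (a * of_real pi * \<i>) * exp (b * of_real pi * \<i>) = - 1"
    proof -
      have "a * of_real pi * \<i> + b * of_real pi * \<i> = - (of_real pi * \<i>)"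
        by (simp add: b_def algebra_simps)
      then show ?thesis by (simp only: exp_add[symmetric] exp_minus exp_pi_i) simp
    qed
    have p: "x powr (- a) * x powr (- b) = x"
      using n by (simp add: powr_add[symmetric] b_def)
    have "h_pow a x * h_pow b x = (exp (a * of_real pi * \<i>) * exp (b * of_real pi * \<i>)) * (x powr (- a) * x powr (- b))"
      by (simp add: h_pow_def mult_ac)
    then have hh: "h_pow a x * h_pow b x = - x"
      unfolding e p by simp
    have "W x = (h_pow a x * h_pow b x) * V (1 / x) / x"
      unfolding W_def h_inf_eq_series[OF a x] h_inf_eq_series[OF b x] h_ser_def h_ser'_def V_def
      using n(1) by (simp add: field_simps)
    then show ?thesis unfolding hh using n(1) by simp
  qed
  \<comment> \<open>The shift by 2 keeps every point in \<open>far_upper\<close>, which demands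
    modulus greater than 1.\<close>
  have "(\<lambda>n. V (1 / (\<i> * of_nat (n + 2)))) \<longlonglongrightarrow> V 0"
  proof (rule filterlim_compose[OF lim])
    have "(\<lambda>n. - \<i> * inverse (of_nat (n + 2))) \<longlonglongrightarrow> - \<i> * 0"
      by (intro tendsto_mult tendsto_const LIMSEQ_ignore_initial_segment[OF lim_inverse_n])
    moreover have "- \<i> * inverse (of_nat (n + 2)) = 1 / (\<i> * of_nat (n + 2))" for n
      by (simp add: divide_inverse)
    ultimately have "(\<lambda>n. 1 / (\<i> * of_nat (n + 2))) \<longlonglongrightarrow> 0"
      by (simp only: mult_zero_right)
    moreover have "1 / (\<i> * of_nat (n + 2)) \<noteq> 0" for n
      unfolding divide_eq_0_iff mult_eq_0_iff of_nat_eq_0_iff by simp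
    ultimately show "filterlim (\<lambda>n. 1 / (\<i> * of_nat (n + 2))) (at 0) sequentially"
      unfolding filterlim_at by (intro conjI always_eventually allI UNIV_I)
  qed
  moreover have "V (1 / (\<i> * of_nat (n + 2))) = - W \<eta>" for n
  proof -
    have "\<i> * of_nat (n + 2) \<in> far_upper"
      by (simp add: far_upper_def norm_mult del: of_nat_add of_nat_Suc)
    then show ?thesis
      using WV const far_upper_subset upper_subset by (metis minus_minus subsetD)
  qed
  ultimately have "(\<lambda>n :: nat. - W \<eta>) \<longlonglongrightarrow> V 0" by (simp only:)
  then have "V 0 = - W \<eta>" using LIMSEQ_unique tendsto_const by blast
  then show ?thesis
    by (simp add: V_def hyp_H_0 W_def s_inf_eq_h_inf b_def algebra_simps)
qed

section \<open>Boundary values of a\<close>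

text \<open>The factored form jumps across the cut, whereas \<open>csqrt (1 - 4 * l\<^sup>2)\<close>
  is continuous across (-1/2, 1/2), so boundary values can be read off from it. The two agree up to
  sign, and the sign is settled by showing Im(l c) > 0.\<close>

lemma sqrt4_upper:
  assumes "Im l > 0"
  shows "sqrt4 l = \<i> * csqrt (1 - 4 * l\<^sup>2)"
proof -
  define w where "w = 1 - 1 / (4 * l\<^sup>2)"
  define c where "c = csqrt w"
  have "l \<noteq> 0" using assms by auto
  have c2: "c\<^sup>2 = w" by (simp add: c_def)
  have Rc: "Re c \<ge> 0" unfolding c_def by (rule Re_csqrt)
  have Iw: "2 * (Re c * Im c) = Im w"
    using arg_cong[OF c2, of Im] by (simp add: power2_eq_square mult.commute)
  define v where "v = 4 * l\<^sup>2"
  define N where "N = (norm v)\<^sup>2"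
  have N: "N > 0" using \<open>l \<noteq> 0\<close> by (simp add: N_def v_def)
  have w: "w = 1 - inverse v" unfolding w_def v_def by (simp add: inverse_eq_divide)
  have "Im w = Im v / N"
    unfolding w N_def cmod_power2 by simp
  then have Iw': "Im w = 8 * (Re l * Im l) / N"
    by (simp add: power2_eq_square v_def)
  \<comment> \<open>Im w = 2 Re c Im c has the sign of Re l because Im l > 0, and Re c is
    nonnegative. On the imaginary axis the sign argument is void, but there Re w > 0 excludes Re c =
    0.\<close>
  have "Re l * Im c \<ge> 0 \<and> Re c > 0"
  proof (cases "Re l = 0")
    case True
    have "Re w = 1 - Re v / N"
      unfolding w N_def cmod_power2 by simp
    also have "Re v = - 4 * (Im l)\<^sup>2"
      using True by (simp add: power2_eq_square v_def)
    finally have "Re w > 0" using N by (simp add: add_pos_nonneg)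
    moreover have "Re w = (Re c)\<^sup>2 - (Im c)\<^sup>2"
      using arg_cong[OF c2, of Re] by (simp add: power2_eq_square)
    ultimately have "Re c \<noteq> 0" by (auto simp: power2_eq_square not_less)
    then show ?thesis using True Rc by simp
  next
    case False
    have "Re l * Im w = 8 * (Re l)\<^sup>2 * Im l / N"
      unfolding Iw' by (simp add: power2_eq_square)
    also have "\<dots> > 0"
      using False assms N by (intro divide_pos_pos mult_pos_pos) auto
    finally have "Re l * (Re c * Im c) > 0" unfolding Iw[symmetric] by (simp add: mult_ac)
    then have "Re c * (Re l * Im c) > 0" by (simp add: mult_ac)
    then show ?thesis using Rc by (simp add: zero_less_mult_iff[of "Re c"])
  qed
  then have "Re l * Im c + Im l * Re c > 0"
    using assms by (simp add: add_nonneg_pos)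
  then have "Re (- \<i> * (2 * l * c)) > 0" by simp
  moreover have "(- \<i> * (2 * l * c))\<^sup>2 = 1 - 4 * l\<^sup>2"
    using \<open>l \<noteq> 0\<close> by (simp add: power_mult_distrib c2 w_def field_simps)
  ultimately have "csqrt (1 - 4 * l\<^sup>2) = - \<i> * (2 * l * c)"
    by (intro csqrt_unique) auto
  then show ?thesis by (simp add: sqrt4_def c_def w_def)
qed

lemma sqrt4_lower:
  assumes "Im l < 0"
  shows "sqrt4 l = - \<i> * csqrt (1 - 4 * l\<^sup>2)"
proof -
  have "sqrt4 (- l) = \<i> * csqrt (1 - 4 * (- l)\<^sup>2)"
    using assms by (intro sqrt4_upper) simp
  then have "- (2 * l * csqrt (1 - 1 / (4 * l\<^sup>2))) = \<i> * csqrt (1 - 4 * l\<^sup>2)"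
    by (simp add: sqrt4_def)
  then show ?thesis
    unfolding sqrt4_def by (metis minus_minus mult_minus_left)
qed

lemma Ln_ii_times:
  assumes "y \<noteq> 0"
  shows "Ln (\<i> * of_real y) = of_real (ln \<bar>y\<bar>) + of_real (sgn y) * (\<i> * of_real pi / 2)"
proof (cases "y > 0")
  case True
  then show ?thesis using Ln_times_of_real[of y \<i>] by (simp add: mult.commute Ln_of_real)
next
  case False
  then have "Ln (of_real (- y) * (- \<i>)) = Ln (of_real (- y)) + Ln (- \<i>)"
    using assms by (intro Ln_times_of_real) auto
  moreover have "Ln (of_real (- y)) = of_real (ln (- y))"
    using False assms by (intro Ln_of_real) auto
  ultimately show ?thesis using False assms by (simp add: mult.commute)
qed

text \<open>The sign \<open>c\<close> treats both sides of the cut together. The argument of the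
  logarithm tends to i y with y real; y is nonzero since 0 <= sqrt(1 - 4 l^2) < 1, so the limit
  avoids the cut of \<open>Ln\<close>.\<close>

lemma tendsto_a_fun:
  assumes l: "l \<noteq> 0" "\<bar>l\<bar> < 1 / 2" and c: "c\<^sup>2 = 1" 
    and S: "\<And>m. m \<in> S \<Longrightarrow> sqrt4 m = \<i> * of_real c * csqrt (1 - 4 * m\<^sup>2)"
  defines "y \<equiv> (1 + c * sqrt (1 - 4 * l\<^sup>2)) / (2 * l)"
  shows "(a_fun \<longlongrightarrow> of_real (sgn y / 2) - \<i> * of_real (ln \<bar>y\<bar> / pi)) (at (of_real l) within S)"
proof -
  have l2: "4 * l\<^sup>2 < 1"
    using l(2) abs_square_less_1[of "2 * l"] by (simp add: power_mult_distrib)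
  define s where "s = sqrt (1 - 4 * l\<^sup>2)"
  have s: "s < 1" "s \<ge> 0" using l(1) l2 by (simp_all add: s_def)
  have "c = 1 \<or> c = - 1" using c by (simp add: power2_eq_1_iff)
  then have y0: "y \<noteq> 0" using l(1) s unfolding y_def s_def[symmetric] by auto
  have e: "1 - 4 * (complex_of_real l)\<^sup>2 = of_real (1 - 4 * l\<^sup>2)" by simp
  have "isCont csqrt (1 - 4 * (complex_of_real l)\<^sup>2)"
    using l2 unfolding e by (intro continuous_at_csqrt) (simp add: complex_nonpos_Reals_iff)
  then have "((\<lambda>m. csqrt (1 - 4 * m\<^sup>2)) \<longlongrightarrow> csqrt (1 - 4 * (of_real l)\<^sup>2)) (at (of_real l) within S)"
    by (intro isCont_tendsto_compose[where g = csqrt] tendsto_intros)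
  also have "csqrt (1 - 4 * (of_real l)\<^sup>2) = of_real s"
    unfolding e s_def using l2 by (subst csqrt_of_real_nonneg) auto
  finally have "((\<lambda>m. (\<i> + \<i> * of_real c * csqrt (1 - 4 * m\<^sup>2)) / (2 * m)) \<longlongrightarrow>
      (\<i> + \<i> * of_real c * of_real s) / (2 * of_real l)) (at (of_real l) within S)"
    using l(1) by (intro tendsto_intros) auto
  also have "(\<i> + \<i> * of_real c * of_real s) / (2 * of_real l) = \<i> * of_real y"
    using l(1) by (simp add: y_def s_def field_simps)
  finally have "((\<lambda>m. 1 / (\<i> * of_real pi) * Ln ((\<i> + \<i> * of_real c * csqrt (1 - 4 * m\<^sup>2)) / (2 * m))) \<longlongrightarrow>
      1 / (\<i> * of_real pi) * Ln (\<i> * of_real y)) (at (of_real l) within S)"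
    using y0 by (intro tendsto_intros) (auto simp: complex_nonpos_Reals_iff)
  moreover have "1 / (\<i> * of_real pi) * Ln (\<i> * of_real y) = of_real (sgn y / 2) - \<i> * of_real (ln \<bar>y\<bar> / pi)"
    unfolding Ln_ii_times[OF y0] by (simp add: field_simps)
  moreover have "\<forall>\<^sub>F m in at (of_real l) within S.
      1 / (\<i> * of_real pi) * Ln ((\<i> + \<i> * of_real c * csqrt (1 - 4 * m\<^sup>2)) / (2 * m)) = a_fun m"
    unfolding eventually_at_filter by (intro always_eventually) (simp add: a_fun_def S)
  ultimately show ?thesis
    using Lim_transform_eventually by fastforce
qed

text \<open>The boundary value \<open>a\<^sub>-(- m)\<close> for \<open>0 < m < 1/2\<close>.\<close>

definition a_boundary :: "real \<Rightarrow> complex" where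
  "a_boundary m = Complex (- 1 / 2) (ln ((1 + sqrt (1 - 4 * m\<^sup>2)) / (2 * m)) / pi)"

context
  fixes m p :: real
  assumes m: "0 < m" "m < 1 / 2"
  defines "p \<equiv> (1 + sqrt (1 - 4 * m\<^sup>2)) / (2 * m)"
begin

text \<open>The numbers p and 1/p are the two roots of m (x^2 + 1) = x.\<close>

lemma spec_p: "p > 1" "(1 - sqrt (1 - 4 * m\<^sup>2)) / (2 * m) = 1 / p" "m * (p + 1 / p) = 1"
proof -
  have m2: "4 * m\<^sup>2 < 1"
    using m abs_square_less_1[of "2 * m"] by (simp add: power_mult_distrib)
  define s where "s = sqrt (1 - 4 * m\<^sup>2)"
  have s: "s \<ge> 0" "s\<^sup>2 = 1 - 4 * m\<^sup>2" using m2 by (simp_all add: s_def)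
  show "p > 1" using m s(1) unfolding p_def s_def[symmetric] by (simp add: field_simps)
  then have "p \<noteq> 0" by simp
  have "(1 - s) / (2 * m) * p = 1"
    using s(2) m(1) unfolding p_def s_def[symmetric] by (simp add: field_simps power2_eq_square)
  then show 1: "(1 - sqrt (1 - 4 * m\<^sup>2)) / (2 * m) = 1 / p"
    unfolding s_def[symmetric] by (rule iffD2[OF nonzero_eq_divide_eq[OF \<open>p \<noteq> 0\<close>]])
  show "m * (p + 1 / p) = 1"
    unfolding 1[symmetric] unfolding p_def using m(1) by (simp add: field_simps)
qed

lemma a_boundary_nonreal: "Im (a_boundary m) \<noteq> 0"
  using spec_p(1) unfolding a_boundary_def p_def[symmetric] by simp

text \<open>The logarithm is taken at i times -p, -1/p, p and 1/p respectively. Changing the sign or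
  inverting this number produces the reflections a -> -1 - a and a -> -a among the four
  values.\<close>

lemma a_fun_limits:
  "(a_fun \<longlongrightarrow> - 1 - a_boundary m) (at (of_real (- m)) within {l. Im l > 0})"
  "(a_fun \<longlongrightarrow> a_boundary m) (at (of_real (- m)) within {l. Im l < 0})"
  "(a_fun \<longlongrightarrow> - a_boundary m) (at (of_real m) within {l. Im l > 0})"
  "(a_fun \<longlongrightarrow> a_boundary m + 1) (at (of_real m) within {l. Im l < 0})"
proof -
  have u: "sqrt4 l = \<i> * of_real 1 * csqrt (1 - 4 * l\<^sup>2)" if "l \<in> {l. Im l > 0}" for l
    using that by (simp add: sqrt4_upper)
  have d: "sqrt4 l = \<i> * of_real (- 1) * csqrt (1 - 4 * l\<^sup>2)" if "l \<in> {l. Im l < 0}" for l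
    using that by (simp add: sqrt4_lower)
  have a: "- m \<noteq> 0" "\<bar>- m\<bar> < 1 / 2" "m \<noteq> 0" "\<bar>m\<bar> < 1 / 2" using m by auto
  have A: "a_boundary m = - 1 / 2 + \<i> * of_real (ln p / pi)"
    unfolding a_boundary_def p_def[symmetric] by (simp add: complex_eq_iff)
  have y: "(1 + 1 * sqrt (1 - 4 * (- m)\<^sup>2)) / (2 * - m) = - p"
    "(1 + - 1 * sqrt (1 - 4 * (- m)\<^sup>2)) / (2 * - m) = - (1 / p)"
    "(1 + 1 * sqrt (1 - 4 * m\<^sup>2)) / (2 * m) = p"
    "(1 + - 1 * sqrt (1 - 4 * m\<^sup>2)) / (2 * m) = 1 / p"
    unfolding spec_p(2)[symmetric] by (simp_all add: p_def divide_minus_right)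
  have p: "p > 0" "ln (1 / p) = - ln p" using spec_p(1) by (simp_all add: ln_div)
  show "(a_fun \<longlongrightarrow> - 1 - a_boundary m) (at (of_real (- m)) within {l. Im l > 0})"
    using tendsto_a_fun[where S = "{l. Im l > 0}", OF a(1,2) _ u] p unfolding y A by simp
  show "(a_fun \<longlongrightarrow> a_boundary m) (at (of_real (- m)) within {l. Im l < 0})"
    using tendsto_a_fun[where S = "{l. Im l < 0}", OF a(1,2) _ d] p unfolding y A by simp
  show "(a_fun \<longlongrightarrow> - a_boundary m) (at (of_real m) within {l. Im l > 0})"
    using tendsto_a_fun[where S = "{l. Im l > 0}", OF a(3,4) _ u] p unfolding y A by simp
  show "(a_fun \<longlongrightarrow> a_boundary m + 1) (at (of_real m) within {l. Im l < 0})"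
    using tendsto_a_fun[where S = "{l. Im l < 0}", OF a(3,4) _ d] p unfolding y A by simp
qed

lemma a_minus_eq: "a_minus (- m) = a_boundary m"
proof -
  \<comment> \<open>\<open>Lim\<close> returns the limit only along a nontrivial filter, so the
    point must be an accumulation point of the lower half-plane.\<close>
  have "at (of_real (- m)) within {l. Im l < 0} \<noteq> (bot :: complex filter)"
  proof -
    have "complex_of_real (- m) islimpt {l. Im l < 0}"
      unfolding islimpt_approachable
    proof (intro allI impI)
      fix e :: real assume "e > 0"
      then show "\<exists>x'\<in>{l. Im l < 0}. x' \<noteq> complex_of_real (- m) \<and> dist x' (complex_of_real (- m)) < e"
        by (intro bexI[of _ "complex_of_real (- m) - \<i> * of_real (e / 2)"])
          (auto simp: dist_norm norm_mult complex_eq_iff)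
    qed
    then show ?thesis by (simp add: trivial_limit_within)
  qed
  then show ?thesis
    unfolding a_minus_def using a_fun_limits(2) by (intro tendsto_Lim)
qed

text \<open>Here e = -i/p, and the relation is 2 m sin(a pi) = -1 written in e. It is the link
  through which the spectral variable reappears in formulas that otherwise involve only
  \<open>a\<close>.\<close>

lemma exp_a_boundary:
  defines "e \<equiv> exp (a_boundary m * of_real pi * \<i>)"
  shows "of_real m * (e\<^sup>2 - 1) = - \<i> * e"
proof -
  have p: "p > 0" using spec_p(1) by simp
  have "a_boundary m * of_real pi * \<i> = - (of_real (ln p)) - of_real (pi / 2) * \<i>"
    unfolding a_boundary_def p_def[symmetric] by (simp add: complex_eq_iff)
  then have "e = exp (- complex_of_real (ln p)) / exp (of_real (pi / 2) * \<i>)"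
    unfolding e_def by (simp only: exp_diff)
  also have "exp (of_real (pi / 2) * \<i>) = \<i>"
    using cis_pi_half by (simp add: cis_conv_exp mult.commute)
  also have "exp (- complex_of_real (ln p)) = of_real (1 / p)"
    using p by (simp add: exp_of_real exp_minus inverse_eq_divide flip: of_real_minus)
  finally have e: "e = - \<i> * of_real (1 / p)" by (simp add: field_simps)
  have "of_real m * (e\<^sup>2 - 1) = - of_real (m * ((1 / p)\<^sup>2 + 1))"
    unfolding e by (simp add: power_divide algebra_simps)
  also have "m * ((1 / p)\<^sup>2 + 1) = m * (p + 1 / p) * (1 / p)"
    using p by (simp add: field_simps power2_eq_square)
  also have "\<dots> = 1 / p" unfolding spec_p(3) by simp
  finally show ?thesis unfolding e by simp
qed

end

section \<open>The matrix Q\<close>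

definition phase :: "complex \<Rightarrow> complex" where
  "phase a = exp (a * of_real pi * \<i>)"

lemma phase_nonzero: "phase a \<noteq> 0"
  by (simp add: phase_def)

lemma phase_minus: "phase (- a) = 1 / phase a"
  by (simp add: phase_def exp_minus inverse_eq_divide)

lemma phase_reflect: "phase (- 1 - a) = - 1 / phase a"
proof -
  have "(- 1 - a) * of_real pi * \<i> = - (a * of_real pi * \<i>) - of_real pi * \<i>"
    by (simp add: algebra_simps)
  then show ?thesis
    unfolding phase_def by (simp only: exp_diff exp_minus exp_pi_i) (simp add: inverse_eq_divide)
qed

text \<open>The modulus of \<open>phase a\<close> is exp(-pi Im a), hence not 1. Consequently tan(a
  pi) has neither a zero nor a pole at nonreal \<open>a\<close>.\<close>

lemma phase_square_nontrivial:
  assumes "Im a \<noteq> 0"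
  shows "(phase a)\<^sup>2 \<noteq> 1" "(phase a)\<^sup>2 \<noteq> - 1" "1 + (phase a)\<^sup>2 \<noteq> 0"
proof -
  have "norm (phase a) = exp (- (pi * Im a))"
    by (simp add: phase_def norm_exp_eq_Re mult.commute)
  then have "norm (phase a) \<noteq> 1" using assms by simp
  moreover have "norm (phase a) \<ge> 0" by simp
  ultimately have n: "norm ((phase a)\<^sup>2) \<noteq> 1"
    by (metis norm_power norm_ge_zero power2_eq_1_iff neg_0_le_iff_le zero_neq_one not_one_le_zero)
  show 1: "(phase a)\<^sup>2 \<noteq> 1" "(phase a)\<^sup>2 \<noteq> - 1" using n by auto
  then show "1 + (phase a)\<^sup>2 \<noteq> 0" by (metis add_eq_0_iff)
qed

lemma tan_phase: "tan (a * of_real pi) = - \<i> * ((phase a)\<^sup>2 - 1) / ((phase a)\<^sup>2 + 1)"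
proof -
  define e where "e = phase a"
  have e: "e \<noteq> 0" by (simp add: e_def phase_nonzero)
  have x: "exp (\<i> * (a * of_real pi)) = e" "exp (- (\<i> * (a * of_real pi))) = 1 / e"
    by (simp_all add: e_def phase_def mult_ac exp_minus inverse_eq_divide)
  have "sin (a * of_real pi) = (e - 1 / e) / (2 * \<i>)"
    unfolding sin_exp_eq x ..
  moreover have "cos (a * of_real pi) = (e + 1 / e) / 2"
    unfolding cos_exp_eq x ..
  ultimately have "tan (a * of_real pi) = ((e - 1 / e) / (2 * \<i>)) / ((e + 1 / e) / 2)"
    by (simp only: tan_def)
  also have "\<dots> = - \<i> * ((e - 1 / e) * e) / ((e + 1 / e) * e)"
    using e by (simp add: divide_simps)
  also have "\<dots> = - \<i> * (e\<^sup>2 - 1) / (e\<^sup>2 + 1)"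
  proof -
    have "(e - 1 / e) * e = e\<^sup>2 - 1" "(e + 1 / e) * e = e\<^sup>2 + 1"
      using e by (simp_all add: algebra_simps power2_eq_square)
    then show ?thesis by (simp only:)
  qed
  finally show ?thesis by (simp only: e_def)
qed

lemma tan_nonzero: "Im a \<noteq> 0 \<Longrightarrow> tan (a * complex_of_real pi) \<noteq> 0"
  using phase_square_nontrivial[of a] unfolding tan_phase by (simp add: add.commute)

lemma tan_reflect:
  fixes a :: complex
  shows "tan ((- 1 - a) * of_real pi) = - tan (a * of_real pi)"
proof -
  define e where "e = phase a"
  have e: "e \<noteq> 0" by (simp add: e_def phase_nonzero)
  have "((- 1 / e)\<^sup>2 - 1) / ((- 1 / e)\<^sup>2 + 1) = - (e\<^sup>2 - 1) / (e\<^sup>2 + 1)"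
    using e by (simp add: power_divide divide_simps) (simp add: algebra_simps)?
  then show ?thesis
    unfolding tan_phase phase_reflect e_def[symmetric]
    by (metis (no_types, lifting) minus_divide_left minus_mult_right times_divide_eq_right)
qed

lemma tan_neg:
  fixes a :: complex
  shows "tan (- a * of_real pi) = - tan (a * of_real pi)"
  by simp

section \<open>Euler's Gamma function in Q and its symmetries\<close>

lemma nonreal_not_nonpos_Int: "Im z \<noteq> 0 \<Longrightarrow> (z :: complex) \<notin> \<int>\<^sub>\<le>\<^sub>0"
  by (auto elim!: nonpos_Ints_cases)

text \<open>Apart from elementary factors, the Gamma functions of \<open>Q_mat\<close> occur only
  through the square of this quotient.\<close>

definition gamma_ratio :: "complex \<Rightarrow> complex" where
  "gamma_ratio a = Gamma (a + 1 / 2) / Gamma a"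

lemma gamma_ratio_nonzero: "Im a \<noteq> 0 \<Longrightarrow> gamma_ratio a \<noteq> 0"
  by (simp add: gamma_ratio_def Gamma_eq_zero_iff nonreal_not_nonpos_Int)

lemma Gamma_shifts:
  assumes "Im a \<noteq> 0"
  shows "Gamma (a + 3 / 2) = (a + 1 / 2) * Gamma (a + 1 / 2)"
    and "Gamma (a + 2) = (a + 1) * a * Gamma a"
proof -
  have "Gamma (a + 1 / 2 + 1) = (a + 1 / 2) * Gamma (a + 1 / 2)"
    using assms by (intro Gamma_plus1 nonreal_not_nonpos_Int) simp
  then show "Gamma (a + 3 / 2) = (a + 1 / 2) * Gamma (a + 1 / 2)"
    by (simp add: add.assoc)
  have "Gamma (a + 1 + 1) = (a + 1) * (a * Gamma a)"
    using assms Gamma_plus1[of "a + 1"] Gamma_plus1[of a] nonreal_not_nonpos_Int[of a]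
      nonreal_not_nonpos_Int[of "a + 1"] by simp
  then show "Gamma (a + 2) = (a + 1) * a * Gamma a"
    by (simp add: add.assoc)
qed

text \<open>The numerators combine by the reflection formula at a + 1/2, giving pi over a cosine,
  and the denominators by the one for Gamma(a) Gamma(-a), giving pi over a sine; pi cancels and a
  tangent is left.\<close>

lemma gamma_ratio_minus:
  assumes "Im a \<noteq> 0"
  shows "gamma_ratio a * gamma_ratio (- a) = - a * tan (a * of_real pi)"
proof -
  have s: "sin (of_real pi * (a + 1 / 2)) = cos (a * of_real pi)"
  proof -
    have "of_real pi * (a + 1 / 2) = a * of_real pi + of_real (pi / 2)"
      by (simp add: algebra_simps)
    then show ?thesis by (simp only: sin_add) (simp add: cos_of_real sin_of_real flip: of_real_divide)
  qed
  have "Gamma (a + 1 / 2) * Gamma (- a + 1 / 2) = of_real pi / cos (a * of_real pi)"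
    using Gamma_reflection_complex[of "a + 1 / 2"] unfolding s by simp
  moreover have "Gamma a * Gamma (- a) = - of_real pi / (a * sin (a * of_real pi))"
    using Gamma_reflection_complex'[of a] by (simp add: mult.commute)
  ultimately have "gamma_ratio a * gamma_ratio (- a)
      = (of_real pi / cos (a * of_real pi)) / (- of_real pi / (a * sin (a * of_real pi)))"
    unfolding gamma_ratio_def by (simp only: times_divide_times_eq)
  then show ?thesis by (simp add: tan_def mult_ac)
qed

lemma gamma_ratio_reflect:
  assumes "Im a \<noteq> 0"
  shows "(a + 1 / 2) * gamma_ratio (- 1 - a) = (a + 1) * gamma_ratio (- a)"
proof -
  have 1: "Gamma (- a + 1 / 2) = (- 1 / 2 - a) * Gamma (- 1 - a + 1 / 2)"
    using Gamma_plus1[of "- 1 / 2 - a"] assms nonreal_not_nonpos_Int[of "- 1 / 2 - a"]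
    by (simp add: algebra_simps)
  have 2: "Gamma (- a) = (- 1 - a) * Gamma (- 1 - a)"
    using Gamma_plus1[of "- 1 - a"] assms nonreal_not_nonpos_Int[of "- 1 - a"] by simp
  have "- 1 - a \<noteq> 0"
    using assms by (auto simp: complex_eq_iff)
  moreover have "Gamma (- 1 - a) \<noteq> 0"
    using assms nonreal_not_nonpos_Int[of "- 1 - a"] by (simp add: Gamma_eq_zero_iff)
  ultimately have nz: "Gamma (- 1 - a) \<noteq> 0" "- 1 - a \<noteq> 0" by auto
  show ?thesis
    unfolding gamma_ratio_def 1 2 using nz by (simp add: divide_simps) algebra
qed

text \<open>Minus the ratio of the two entries of the diagonal factor of \<open>Q\<close>; \<open>\<Gamma>\<close> depends on that factor
  only through it.\<close>

definition Q_ratio :: "complex \<Rightarrow> complex" where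
  "Q_ratio a = 4 powr (2 * a + 1) * exp (a * of_real pi * \<i>)
     * (Gamma (a + 3 / 2) * Gamma (a + 1 / 2)) / (Gamma a * Gamma (a + 2)) / tan (a * of_real pi)"

lemma Q_ratio_eq:
  assumes "Im a \<noteq> 0"
  shows "Q_ratio a = 4 powr (2 * a + 1) * phase a * ((a + 1 / 2) / (a * (a + 1)) * (gamma_ratio a)\<^sup>2)
     / tan (a * of_real pi)"
proof -
  have "Gamma a \<noteq> 0" using assms by (simp add: Gamma_eq_zero_iff nonreal_not_nonpos_Int)
  then have "(a + 1 / 2) / (a * (a + 1)) * (gamma_ratio a)\<^sup>2
      = (a + 1 / 2) * Gamma (a + 1 / 2) * Gamma (a + 1 / 2) / (Gamma a * ((a + 1) * a * Gamma a))"
    unfolding gamma_ratio_def by (simp add: power2_eq_square mult_ac)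
  then show ?thesis
    unfolding Q_ratio_def Gamma_shifts[OF assms] phase_def by simp
qed

lemma Q_ratio_nonzero:
  assumes "Im a \<noteq> 0"
  shows "Q_ratio a \<noteq> 0"
proof -
  have "a + 1 / 2 \<noteq> 0" using assms by (auto simp: complex_eq_iff)
  then show ?thesis
    unfolding Q_ratio_eq[OF assms] mult_eq_0_iff divide_eq_0_iff power_eq_0_iff
    using tan_nonzero[OF assms] gamma_ratio_nonzero[OF assms] phase_nonzero[of a]
      nonreal_add_of_nat[OF assms] by (simp add: powr_def)
qed

text \<open>The power of 4 and the phase invert, and the product of the squared Gamma quotients
  cancels against the rational factors and the tangents. The phase, the tangent and the rational
  factor each contribute a sign, whence -1.\<close>

lemma Q_ratio_reflect:
  assumes a: "Im a \<noteq> 0"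
  shows "Q_ratio (- 1 - a) = - 1 / Q_ratio a"
proof -
  have b: "Im (- 1 - a) \<noteq> 0" using a by simp
  define t where "t = tan (a * of_real pi)"
  define u where "u = gamma_ratio a"
  define v where "v = gamma_ratio (- 1 - a)"
  define p where "p = (4 :: complex) powr (2 * a + 1)"
  define e where "e = phase a"
  define w where "w = gamma_ratio (- a)"
  have half: "a + 1 / 2 \<noteq> 0" "a \<noteq> 0" "a + 1 \<noteq> 0" using a by (auto simp: complex_eq_iff)
  have t: "t \<noteq> 0" and u: "u \<noteq> 0" and e: "e \<noteq> 0" and p: "p \<noteq> 0"
    using tan_nonzero[OF a] gamma_ratio_nonzero[OF a] by (auto simp: t_def u_def e_def p_def phase_nonzero)
  have "4 powr (2 * (- 1 - a) + 1) = 1 / p"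
    unfolding p_def powr_minus_divide[symmetric] by (simp add: algebra_simps)
  then have Q': "Q_ratio (- 1 - a) = 1 / p * (- 1 / e) * ((- 1 - a + 1 / 2) / ((- 1 - a) * (- 1 - a + 1)) * v\<^sup>2) / (- t)"
    unfolding Q_ratio_eq[OF b] phase_reflect tan_reflect t_def v_def e_def by (simp only:)
  have Q: "Q_ratio a = p * e * ((a + 1 / 2) / (a * (a + 1)) * u\<^sup>2) / t"
    unfolding Q_ratio_eq[OF a] t_def u_def e_def p_def ..
  have uw: "u * w = - a * t"
    unfolding u_def w_def t_def by (rule gamma_ratio_minus[OF a])
  have vw: "(a + 1 / 2) * v = (a + 1) * w"
    unfolding v_def w_def by (rule gamma_ratio_reflect[OF a])
  have "((a + 1 / 2) * (u * v))\<^sup>2 = (a * (a + 1) * t)\<^sup>2"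
    using uw vw by algebra
  then have uv: "(a + 1 / 2)\<^sup>2 * (u\<^sup>2 * v\<^sup>2) = a\<^sup>2 * (a + 1)\<^sup>2 * t\<^sup>2"
    by (simp add: power_mult_distrib)
  have r: "(- 1 - a + 1 / 2) / ((- 1 - a) * (- 1 - a + 1)) = - ((a + 1 / 2) / (a * (a + 1)))"
  proof -
    have "- 1 - a + 1 / 2 = - (a + 1 / 2)" "(- 1 - a) * (- 1 - a + 1) = a * (a + 1)"
      by (simp_all add: algebra_simps)
    then show ?thesis by (simp only: minus_divide_left)
  qed
  define k where "k = (a + 1 / 2) / (a * (a + 1))"
  have k: "k\<^sup>2 * (u\<^sup>2 * v\<^sup>2) = t\<^sup>2"
  proof -
    have "k\<^sup>2 * (u\<^sup>2 * v\<^sup>2) = ((a + 1 / 2)\<^sup>2 * (u\<^sup>2 * v\<^sup>2)) / (a\<^sup>2 * (a + 1)\<^sup>2)"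
      unfolding k_def by (simp add: power_divide power_mult_distrib)
    then show ?thesis unfolding uv using half by simp
  qed
  have "Q_ratio (- 1 - a) * Q_ratio a = - (k\<^sup>2 * (u\<^sup>2 * v\<^sup>2)) / t\<^sup>2"
    unfolding Q Q' r k_def[symmetric] using p e t by (simp add: divide_simps power2_eq_square)
  also have "\<dots> = - 1" unfolding k using t by simp
  finally show ?thesis
    by (rule iffD2[OF nonzero_eq_divide_eq[OF Q_ratio_nonzero[OF a]]])
qed

text \<open>The powers of 4 multiply to 4^2 = 16 and the Gamma quotients reduce to a^2 tan^2. The
  rational function that survives is the reciprocal of \<open>ladder a * ladder (- a)\<close>, so
  \<open>Q_mat\<close> fits the contiguous relations.\<close>

lemma Q_ratio_minus:
  assumes a: "Im a \<noteq> 0"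
  shows "Q_ratio (- a) = 1 / (ladder a * ladder (- a) * Q_ratio a)"
proof -
  have b: "Im (- a) \<noteq> 0" using a by simp
  define t where "t = tan (a * of_real pi)"
  define u where "u = gamma_ratio a"
  define w where "w = gamma_ratio (- a)"
  define p where "p = (4 :: complex) powr (2 * a + 1)"
  define e where "e = phase a"
  have nz: "a \<noteq> 0" "a + 1 \<noteq> 0" "a - 1 \<noteq> 0" "1 - a \<noteq> 0" "2 * a + 1 \<noteq> 0" "1 - 2 * a \<noteq> 0"
    using a by (auto simp: complex_eq_iff)
  have t: "t \<noteq> 0" and e: "e \<noteq> 0" and p: "p \<noteq> 0"
    using tan_nonzero[OF a] by (auto simp: t_def e_def p_def phase_nonzero)
  have "p * 4 powr (2 * (- a) + 1) = 4 powr (2 :: complex)"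
    unfolding p_def powr_add[symmetric] by simp
  also have "(4 :: complex) powr 2 = 16"
    using powr_nat[of "4 :: complex" 2] by simp
  finally have "4 powr (2 * (- a) + 1) = 16 / p"
    using p by (simp add: field_simps)
  then have Q': "Q_ratio (- a) = 16 / p * (1 / e) * ((- a + 1 / 2) / (- a * (- a + 1)) * w\<^sup>2) / (- t)"
    unfolding Q_ratio_eq[OF b] phase_minus tan_neg t_def w_def e_def by (simp only:)
  have Q: "Q_ratio a = p * e * ((a + 1 / 2) / (a * (a + 1)) * u\<^sup>2) / t"
    unfolding Q_ratio_eq[OF a] t_def u_def e_def p_def ..
  have uw: "u * w = - a * t"
    unfolding u_def w_def t_def by (rule gamma_ratio_minus[OF a])
  then have "(u * w)\<^sup>2 = (- a * t)\<^sup>2" by simp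
  then have uw2: "u\<^sup>2 * w\<^sup>2 = a\<^sup>2 * t\<^sup>2"
    by (simp add: power_mult_distrib)
  have "Q_ratio (- a) * Q_ratio a
      = - 16 * ((- a + 1 / 2) / (- a * (- a + 1))) * ((a + 1 / 2) / (a * (a + 1))) * (u\<^sup>2 * w\<^sup>2) / t\<^sup>2"
  proof -
    define r1 where "r1 = (- a + 1 / 2) / (- a * (- a + 1))"
    define r2 where "r2 = (a + 1 / 2) / (a * (a + 1))"
    show ?thesis
      unfolding Q Q' r1_def[symmetric] r2_def[symmetric] using p e t by (simp add: power2_eq_square)
  qed
  also have "\<dots> = - 16 * ((- a + 1 / 2) / (- a * (- a + 1))) * ((a + 1 / 2) / (a * (a + 1))) * a\<^sup>2"
    unfolding uw2 using t by (simp add: mult_ac)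
  also have "\<dots> = 4 * (1 - 2 * a) * (1 + 2 * a) / ((1 - a) * (1 + a))"
  proof -
    have h: "- a + 1 / 2 = (1 - 2 * a) / 2" "a + 1 / 2 = (1 + 2 * a) / 2" "- a + 1 = 1 - a" "a + 1 = 1 + a"
      by (simp_all add: field_simps)
    have X: "- 16 * ((x / 2) / (- a * s)) * ((y / 2) / (a * r)) * a\<^sup>2 = 4 * x * y / (s * r)"
      if "s \<noteq> 0" "r \<noteq> 0" for x y s r :: complex
      using that nz(1) by (simp add: divide_simps power2_eq_square)
    show ?thesis
      unfolding h by (rule X) (use nz in \<open>simp_all add: add.commute\<close>)
  qed
  finally have QQ: "Q_ratio (- a) * Q_ratio a = 4 * (1 - 2 * a) * (1 + 2 * a) / ((1 - a) * (1 + a))" .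
  have L: "ladder a * ladder (- a) = ((1 - a) * (1 + a)) / (4 * (1 - 2 * a) * (1 + 2 * a))"
  proof -
    have "ladder a = (1 - a) / (2 * (1 + 2 * a))" "ladder (- a) = (1 + a) / (2 * (1 - 2 * a))"
      unfolding ladder_def by (simp_all add: algebra_simps minus_divide_left)
    moreover have "2 * (1 + 2 * a) * (2 * (1 - 2 * a)) = 4 * (1 - 2 * a) * (1 + 2 * a)"
      by (simp add: algebra_simps)
    ultimately show ?thesis by (simp only: times_divide_times_eq)
  qed
  have "ladder a * ladder (- a) * (Q_ratio (- a) * Q_ratio a) = 1"
    unfolding QQ L using nz by (simp add: add.commute)
  then show ?thesis
    by (metis mult.commute mult.left_commute mult_zero_left nonzero_eq_divide_eq zero_neq_one)
qed

lemma isCont_Q_ratio: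
  assumes "Im a \<noteq> 0"
  shows "isCont Q_ratio a"
proof -
  have c: "cos (a * of_real pi) \<noteq> 0"
    using tan_nonzero[OF assms] by (auto simp: tan_def)
  have G: "isCont (\<lambda>a. Gamma (a + c)) a" if "c \<in> \<real>" for c
    using assms that by (intro continuous_intros nonreal_not_nonpos_Int) (auto simp: complex_is_Real_iff)
  have "isCont (\<lambda>a. Gamma (a + 0)) a" by (rule G) simp
  then have G0: "isCont (\<lambda>a. Gamma a) a" by simp
  have nz: "Gamma a \<noteq> 0" "Gamma (a + 2) \<noteq> 0"
    using assms nonreal_not_nonpos_Int[of a] nonreal_not_nonpos_Int[of "a + 2"]
    by (auto simp: Gamma_eq_zero_iff)
  have p: "isCont (\<lambda>a. (4 :: complex) powr (2 * a + 1)) a"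
    unfolding powr_def by (auto intro!: continuous_intros)
  have r: "3 / 2 \<in> (\<real> :: complex set)" "1 / 2 \<in> (\<real> :: complex set)" "2 \<in> (\<real> :: complex set)"
    by (auto intro: Reals_divide)
  show ?thesis
    unfolding Q_ratio_def[abs_def] using c nz tan_nonzero[OF assms]
    by (intro isCont_divide isCont_mult p G[OF r(1)] G[OF r(2)] G[OF r(3)] G0 isCont_exp' isCont_tan'
        continuous_intros) auto
qed

lemma isCont_phase: "isCont phase a"
  unfolding phase_def[abs_def] by (intro continuous_intros)

text \<open>By the first identity, \<open>d_R\<close> and \<open>d_L\<close> are
  \<open>alpha\<close> times the entries of the second row of \<open>Xi\<close>. The second shows
  that \<open>alpha\<close> squared, which enters the product of \<open>f2\<close> and
  \<open>g2\<close>, is free of Gamma functions up to \<open>Q_ratio\<close>.\<close>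

lemma alpha_eq:
  assumes a: "Im a \<noteq> 0"
  shows "beta a = alpha a * Q_ratio a * phase a"
    and "(alpha a)\<^sup>2 * Q_ratio a = tan (a * of_real pi) / (2 * phase a * (2 * a + 1) * a * (a + 1))"
proof -
  define t where "t = tan (a * of_real pi)"
  define e where "e = phase a"
  define q where "q = (4 :: complex) powr a"
  define G where "G = Gamma a"
  define H where "H = Gamma (a + 1 / 2)"
  have nz: "a \<noteq> 0" "a + 1 \<noteq> 0" "2 * a + 1 \<noteq> 0" "a + 1 / 2 \<noteq> 0"
    using a by (auto simp: complex_eq_iff)
  have n: "t \<noteq> 0" "e \<noteq> 0" "q \<noteq> 0" "G \<noteq> 0" "H \<noteq> 0"
    using tan_nonzero[OF a] a
      nonreal_not_nonpos_Int[of a] nonreal_not_nonpos_Int[of "a + 1 / 2"]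
    by (auto simp: t_def e_def q_def phase_nonzero G_def H_def Gamma_eq_zero_iff)
  have p1: "(4 :: complex) powr (a + 1) = 4 * q"
    by (simp add: powr_add q_def)
  have p2: "(4 :: complex) powr (2 * a + 1) = 4 * q\<^sup>2"
  proof -
    have "2 * a + 1 = a + a + 1" by simp
    then show ?thesis by (simp only: powr_add q_def) (simp add: power2_eq_square)
  qed
  have e': "exp (- a * of_real pi * \<i>) = 1 / e"
    using phase_minus[of a] by (simp add: phase_def e_def)
  have A: "alpha a = (1 / e) * t * G / (4 * q * ((a + 1 / 2) * H))"
    unfolding alpha_def Gamma_shifts[OF a] p1 e' t_def G_def H_def ..
  have B: "beta a = q * e * H / ((a + 1) * a * G)"
    unfolding beta_def Gamma_shifts[OF a] q_def e_def phase_def G_def H_def ..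
  have Q: "Q_ratio a = 4 * q\<^sup>2 * e * ((a + 1 / 2) * H * H) / (G * ((a + 1) * a * G)) / t"
    unfolding Q_ratio_def Gamma_shifts[OF a] p2 t_def e_def phase_def G_def H_def ..
  define k where "k = a + 1 / 2"
  have k: "k \<noteq> 0" "2 * a + 1 = 2 * k" using nz by (simp_all add: k_def)
  show "beta a = alpha a * Q_ratio a * phase a"
    unfolding A B Q e_def[symmetric] k_def[symmetric]
    using n nz k(1) by (simp add: divide_simps power2_eq_square)
  show "(alpha a)\<^sup>2 * Q_ratio a = tan (a * of_real pi) / (2 * phase a * (2 * a + 1) * a * (a + 1))"
    unfolding A Q e_def[symmetric] t_def[symmetric] k(2) k_def[symmetric]
    using n nz k(1) by (simp add: divide_simps power2_eq_square)
qed

section \<open>The jump\<close>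

abbreviation ent :: "complex^2^2 \<Rightarrow> 2 \<Rightarrow> 2 \<Rightarrow> complex" where
  "ent A i j \<equiv> A $ i $ j"

lemma mat2_nth [simp]:
  "ent (mat2 p q r s) 1 1 = p" "ent (mat2 p q r s) 1 2 = q" "ent (mat2 p q r s) 2 1 = r" "ent (mat2 p q r s) 2 2 = s"
  by (simp_all add: mat2_def)

lemma matrix2_eq_iff:
  fixes A B :: "complex^2^2"
  shows "A = B \<longleftrightarrow> ent A 1 1 = ent B 1 1 \<and> ent A 1 2 = ent B 1 2 \<and> ent A 2 1 = ent B 2 1 \<and> ent A 2 2 = ent B 2 2"
  by (auto simp: vec_eq_iff forall_2)

lemma matrix2_mult_nth:
  fixes A B :: "complex^2^2"
  shows "ent (A ** B) i j = ent A i 1 * ent B 1 j + ent A i 2 * ent B 2 j"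
  by (simp add: matrix_matrix_mult_def sum_2)

lemma mat1_nth: "ent (mat 1 :: complex^2^2) 1 1 = 1" "ent (mat 1 :: complex^2^2) 1 2 = 0"
  "ent (mat 1 :: complex^2^2) 2 1 = 0" "ent (mat 1 :: complex^2^2) 2 2 = 1"
  by (simp_all add: mat_def)

lemma matrix_inv_mult:
  fixes A :: "complex^2^2"
  assumes "det A \<noteq> 0"
  shows "matrix_inv A ** A = mat 1" "A ** matrix_inv A = mat 1"
proof -
  have "\<exists>B. A ** B = mat 1 \<and> B ** A = mat 1"
    using assms invertible_det_nz[of A] by (simp add: invertible_def)
  then have "A ** matrix_inv A = mat 1 \<and> matrix_inv A ** A = mat 1"
    unfolding matrix_inv_def by (rule someI_ex)
  then show "matrix_inv A ** A = mat 1" "A ** matrix_inv A = mat 1" by simp_all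
qed

lemma matrix_cancel_left:
  fixes A :: "complex^2^2"
  assumes "det A \<noteq> 0" "A ** B = A ** C"
  shows "B = C"
proof -
  have "(matrix_inv A ** A) ** B = (matrix_inv A ** A) ** C"
    using assms(2) by (simp flip: matrix_mul_assoc)
  then show ?thesis using matrix_inv_mult(1)[OF assms(1)] by simp
qed

text \<open>Gamma as a function of \<open>a\<close> alone: a boundary value is then a limit of
  \<open>a_fun\<close> passed through a map continuous at every nonreal \<open>a\<close>.\<close>

definition Gamma_a :: "real \<Rightarrow> real \<Rightarrow> complex \<Rightarrow> complex \<Rightarrow> complex^2^2" where
  "Gamma_a bL bR z a = sigma2 ** matrix_inv (Q_mat a) ** matrix_inv (Gamma_hat a (M1_infinity bL bR))
      ** mat2 1 (of_real bL * of_real bR / (z * (of_real bR - of_real bL) * (a + 1))) 0 1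
      ** Gamma_hat a (M1 bL bR z) ** Q_mat a ** sigma2"

lemma Gamma_RHP_eq: "Gamma_RHP bL bR z = (\<lambda>l. Gamma_a bL bR z (a_fun l))"
  by (simp add: Gamma_RHP_def Gamma_a_def Let_def fun_eq_iff)

text \<open>The product \<open>T\<^sup>-\<^sup>1 Gamma_hat Q sigma2\<close> divided by the scalar \<open>\<i> tan (a \<pi>)\<close>.\<close>

definition Xi :: "complex \<Rightarrow> complex \<Rightarrow> complex^2^2" where
  "Xi a \<eta> =
     (let h = h_inf a \<eta>; s = s_inf a \<eta>; h' = deriv (h_inf a) \<eta>; s' = deriv (s_inf a) \<eta>;
          e = phase a; r = Q_ratio a
      in mat2 (- e * (h - \<eta> * h' / (a + 1)) + r * (s - \<eta> * s' / (a + 1)))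
              ((h - \<eta> * h' / (a + 1)) + r * e * (s - \<eta> * s' / (a + 1)))
              (- e * h' + r * s') (h' + r * e * s'))"

text \<open>The term in \<open>\<eta>\<close> is a row operation, so the determinant is the
  Wronskian times constants and does not depend on \<open>\<eta>\<close>.\<close>

lemma det_Xi:
  assumes a: "Im a \<noteq> 0" and \<eta>: "\<eta> \<in> eta_domain"
  shows "det (Xi a \<eta>) = (2 * a + 1) * Q_ratio a * (1 + (phase a)\<^sup>2)" "det (Xi a \<eta>) \<noteq> 0"
proof -
  have "det (Xi a \<eta>) = - (h_inf a \<eta> * deriv (s_inf a) \<eta> - deriv (h_inf a) \<eta> * s_inf a \<eta>)
      * Q_ratio a * (1 + (phase a)\<^sup>2)"
  proof -
    define c where "c = \<eta> / (a + 1)"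
    have c: "\<eta> * y / (a + 1) = c * y" for y by (simp add: c_def)
    show ?thesis unfolding det_2 Xi_def Let_def mat2_nth c by algebra
  qed
  then show 1: "det (Xi a \<eta>) = (2 * a + 1) * Q_ratio a * (1 + (phase a)\<^sup>2)"
    unfolding wronskian_h_s[OF a \<eta>] by simp
  show "det (Xi a \<eta>) \<noteq> 0"
    unfolding 1 mult_eq_0_iff using nonreal_add_of_nat(9)[OF a] Q_ratio_nonzero[OF a]
      phase_square_nontrivial(3)[OF a] by simp
qed

lemma Q_mat_eq: "Q_mat a = mat2 (- tan (a * of_real pi)) (- tan (a * of_real pi) * phase a)
    (- tan (a * of_real pi) * Q_ratio a * phase a) (tan (a * of_real pi) * Q_ratio a)"
  if "Im a \<noteq> 0"
  using tan_nonzero[OF that]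
  by (simp add: matrix2_eq_iff Q_mat_def matrix2_mult_nth phase_def Q_ratio_def)

lemma Xi_eq:
  assumes "Im a \<noteq> 0"
  shows "ent (mat2 1 (- \<eta> / (a + 1)) 0 1 ** Gamma_hat a \<eta> ** Q_mat a ** sigma2) i j
     = \<i> * tan (a * of_real pi) * ent (Xi a \<eta>) i j"
proof -
  have "mat2 1 (- \<eta> / (a + 1)) 0 1 ** Gamma_hat a \<eta> ** Q_mat a ** sigma2
     = (\<chi> i j. \<i> * tan (a * of_real pi) * ent (Xi a \<eta>) i j)"
    unfolding matrix2_eq_iff Q_mat_eq[OF assms] Gamma_hat_def sigma2_def matrix2_mult_nth Xi_def Let_def
    by (simp add: algebra_simps)
  then show ?thesis by simp
qed

text \<open>Stated without inverses: since \<open>Xi\<close> is invertible at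
  \<open>M1_infinity\<close>, this equation determines \<open>Gamma_a\<close>, and each symmetry of
  \<open>Xi\<close> passes to \<open>Gamma_a\<close> by cancellation.\<close>

lemma Gamma_a_char:
  assumes a: "Im a \<noteq> 0" and "bL < 0" "0 < bR" "z \<noteq> 0"
    and E: "M1_infinity bL bR \<in> eta_domain"
  shows "Xi a (M1_infinity bL bR) ** Gamma_a bL bR z a = Xi a (M1 bL bR z)"
proof -
  define \<eta>0 where "\<eta>0 = M1_infinity bL bR"
  define \<eta> where "\<eta> = M1 bL bR z"
  define T where "T x = mat2 1 (- x / (a + 1)) 0 1" for x
  define N where "N = mat2 1 (of_real bL * of_real bR / (z * (of_real bR - of_real bL) * (a + 1))) 0 1"
  define Q where "Q = Q_mat a"
  define S where "S = Gamma_hat a \<eta>0"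
  define t where "t = tan (a * of_real pi)"
  have t: "t \<noteq> 0" using tan_nonzero[OF a] by (simp add: t_def)
  have "det Q = - (t\<^sup>2) * Q_ratio a * (1 + (phase a)\<^sup>2)"
    unfolding Q_def Q_mat_eq[OF a] det_2 mat2_nth t_def by (simp add: power2_eq_square algebra_simps)
  then have "det Q \<noteq> 0"
    using t Q_ratio_nonzero[OF a] phase_square_nontrivial(3)[OF a] by simp
  note Q = matrix_inv_mult[OF this]
  have "det S = - (2 * a + 1)"
    using wronskian_h_s[OF a E] unfolding S_def \<eta>0_def Gamma_hat_def det_2 mat2_nth by algebra
  then have "det S \<noteq> 0"
    using nonreal_add_of_nat(9)[OF a] by (simp only: neg_equal_0_iff_equal not_False_eq_True)
  note S = matrix_inv_mult[OF this]
  have \<sigma>: "sigma2 ** sigma2 = mat 1"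
    by (simp add: matrix2_eq_iff sigma2_def matrix2_mult_nth mat1_nth)
  have "of_real bR - of_real bL \<noteq> (0 :: complex)"
    using assms by (simp flip: of_real_diff)
  then have "\<eta>0 - \<eta> = of_real bL * of_real bR / (z * (of_real bR - of_real bL))"
    unfolding \<eta>0_def \<eta>_def M1_def M1_infinity_def using \<open>z \<noteq> 0\<close> by (simp add: divide_simps) (simp add: algebra_simps)
  moreover have "a + 1 \<noteq> 0" by (rule nonreal_add_of_nat(8)[OF a])
  ultimately have "N = mat2 1 ((\<eta>0 - \<eta>) / (a + 1)) 0 1"
    unfolding N_def by (simp only: divide_divide_eq_left)
  then have TN: "T \<eta>0 ** N = T \<eta>"
    unfolding T_def matrix2_eq_iff matrix2_mult_nth by (simp add: diff_divide_distrib)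
  have G: "Gamma_a bL bR z a = sigma2 ** matrix_inv Q ** matrix_inv S ** N ** Gamma_hat a \<eta> ** Q ** sigma2"
    by (simp add: Gamma_a_def Q_def S_def N_def \<eta>_def \<eta>0_def)
  have "(T \<eta>0 ** S ** Q ** sigma2) ** Gamma_a bL bR z a
      = T \<eta>0 ** (S ** (Q ** (sigma2 ** sigma2) ** matrix_inv Q) ** matrix_inv S) ** N ** Gamma_hat a \<eta> ** Q ** sigma2"
    unfolding G by (simp only: matrix_mul_assoc)
  also have "\<dots> = T \<eta> ** Gamma_hat a \<eta> ** Q ** sigma2"
    unfolding \<sigma> matrix_mul_rid Q S TN ..
  finally have main: "(T \<eta>0 ** S ** Q ** sigma2) ** Gamma_a bL bR z a = T \<eta> ** Gamma_hat a \<eta> ** Q ** sigma2" .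
  have "ent (Xi a \<eta>0 ** Gamma_a bL bR z a) i j = ent (Xi a \<eta>) i j" for i j
  proof -
    have "\<i> * t * (ent (Xi a \<eta>0 ** Gamma_a bL bR z a) i j)
        = ent ((T \<eta>0 ** S ** Q ** sigma2) ** Gamma_a bL bR z a) i j"
      unfolding matrix2_mult_nth[of _ "Gamma_a bL bR z a"] T_def S_def Q_def Xi_eq[OF a] t_def
      by (simp add: algebra_simps)
    also have "\<dots> = \<i> * t * ent (Xi a \<eta>) i j"
      unfolding main unfolding T_def Q_def Xi_eq[OF a] t_def ..
    finally show ?thesis using t by simp
  qed
  then show ?thesis by (simp add: vec_eq_iff \<eta>0_def \<eta>_def)
qed

lemma isCont_Gamma_a:
  assumes a0: "Im a0 \<noteq> 0" and b: "bL < 0" "0 < bR" "z \<noteq> 0"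
    and E: "M1_infinity bL bR \<in> eta_domain" "M1 bL bR z \<in> eta_domain"
  shows "isCont (Gamma_a bL bR z) a0"
proof -
  have s: "isCont (\<lambda>a. s_inf a \<eta>) a0" "isCont (\<lambda>a. deriv (s_inf a) \<eta>) a0" if "\<eta> \<in> eta_domain" for \<eta>
    unfolding s_inf_eq_h_inf
    by (rule isCont_o2[OF _ isCont_h_inf(1)] isCont_o2[OF _ isCont_h_inf(2)],
        intro continuous_intros, use a0 that in auto)+
  have cX: "isCont (\<lambda>a. ent (Xi a \<eta>) i j) a0" if \<eta>: "\<eta> \<in> eta_domain" for \<eta> i j
  proof -
    have 1: "a0 + 1 \<noteq> 0" by (rule nonreal_add_of_nat(8)[OF a0])
    have h: "isCont (\<lambda>a. h_inf a \<eta> - \<eta> * deriv (h_inf a) \<eta> / (a + 1)) a0"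
      "isCont (\<lambda>a. s_inf a \<eta> - \<eta> * deriv (s_inf a) \<eta> / (a + 1)) a0"
      by (intro isCont_diff isCont_divide isCont_mult isCont_add continuous_ident continuous_const
          isCont_h_inf a0 \<eta> s 1)+
    have "isCont (\<lambda>a. ent (Xi a \<eta>) 1 1) a0" "isCont (\<lambda>a. ent (Xi a \<eta>) 1 2) a0"
      "isCont (\<lambda>a. ent (Xi a \<eta>) 2 1) a0" "isCont (\<lambda>a. ent (Xi a \<eta>) 2 2) a0"
      unfolding Xi_def Let_def mat2_nth
      by (intro isCont_add isCont_mult isCont_minus h isCont_h_inf s isCont_phase isCont_Q_ratio a0 \<eta>)+
    then show ?thesis
      using exhaust_2[of i] exhaust_2[of j] by (elim disjE) simp_all
  qed
  let ?X = "\<lambda>a. Xi a (M1_infinity bL bR)" and ?Y = "\<lambda>a. Xi a (M1 bL bR z)"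
  \<comment> \<open>Cramer's rule expresses the entries rationally in those of \<open>Xi\<close>,
    avoiding any appeal to continuity of \<open>matrix_inv\<close>, which is defined by
    choice.\<close>
  have cramer: "ent (Gamma_a bL bR z a) i j =
      (if i = 1 then (ent (?X a) 2 2 * ent (?Y a) 1 j - ent (?X a) 1 2 * ent (?Y a) 2 j) / det (?X a)
       else (ent (?X a) 1 1 * ent (?Y a) 2 j - ent (?X a) 2 1 * ent (?Y a) 1 j) / det (?X a))"
    if "Im a \<noteq> 0" for a i j
  proof -
    have nz: "det (?X a) \<noteq> 0" by (rule det_Xi(2)[OF that E(1)])
    have "i = 1 \<or> i = 2" by (rule exhaust_2)
    then show ?thesis
      using nz unfolding Gamma_a_char[OF that b E(1), symmetric] matrix2_mult_nth det_2
      by (auto simp: field_simps)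
  qed
  have ev: "\<forall>\<^sub>F a in nhds a0. Im a \<noteq> 0"
  proof -
    have "open {a. Im a \<noteq> 0}" by (intro open_Collect_neq continuous_intros)
    then show ?thesis using a0 by (auto simp: eventually_nhds)
  qed
  have "isCont (\<lambda>a. ent (Gamma_a bL bR z a) i j) a0" for i j
  proof -
    have "det (?X a0) \<noteq> 0" by (rule det_Xi(2)[OF a0 E(1)])
    then have nz: "ent (?X a0) 1 1 * ent (?X a0) 2 2 - ent (?X a0) 1 2 * ent (?X a0) 2 1 \<noteq> 0"
      unfolding det_2 .
    have "isCont (\<lambda>a. (ent (?X a) 2 2 * ent (?Y a) 1 j - ent (?X a) 1 2 * ent (?Y a) 2 j) / det (?X a)) a0"
      "isCont (\<lambda>a. (ent (?X a) 1 1 * ent (?Y a) 2 j - ent (?X a) 2 1 * ent (?Y a) 1 j) / det (?X a)) a0"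
      unfolding det_2 by (intro isCont_diff isCont_divide isCont_mult cX E nz)+
    then have "isCont (\<lambda>a. if i = 1 then (ent (?X a) 2 2 * ent (?Y a) 1 j - ent (?X a) 1 2 * ent (?Y a) 2 j) / det (?X a)
       else (ent (?X a) 1 1 * ent (?Y a) 2 j - ent (?X a) 2 1 * ent (?Y a) 1 j) / det (?X a)) a0"
      by (cases "i = 1") simp_all
    moreover have "\<forall>\<^sub>F a in nhds a0. (if i = 1 then (ent (?X a) 2 2 * ent (?Y a) 1 j - ent (?X a) 1 2 * ent (?Y a) 2 j) / det (?X a)
       else (ent (?X a) 1 1 * ent (?Y a) 2 j - ent (?X a) 2 1 * ent (?Y a) 1 j) / det (?X a)) = ent (Gamma_a bL bR z a) i j"
      using ev by eventually_elim (rule cramer[symmetric])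
    ultimately show ?thesis by (subst isCont_cong[symmetric])
  qed
  then show ?thesis
    unfolding isCont_def by (intro vec_tendstoI)
qed

text \<open>The combination h - \<open>\<eta>\<close> h'/(a + 1), formed at \<open>- a\<close>, is a
  constant multiple of the same combination of s formed at \<open>a\<close>, and conversely. This
  makes the left factor free of \<open>\<eta>\<close>; \<open>k\<close> is the remaining common
  scale.\<close>

lemma Xi_minus:
  assumes a: "Im a \<noteq> 0" and \<eta>: "\<eta> \<in> eta_domain"
  defines "k \<equiv> 1 / (Q_ratio a * phase a * ladder (- a))"
  shows "Xi (- a) \<eta> = mat2 (k * (a + 1) / (1 - a)) 0 (- 2 * k * (a + 1)) (- k) ** Xi a \<eta> ** mat2 (- 1) 0 0 1"
proof -
  have b: "Im (- a) \<noteq> 0" using a by simp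
  define h where "h = h_inf a \<eta>"
  define s where "s = s_inf a \<eta>"
  define h' where "h' = deriv (h_inf a) \<eta>"
  define s' where "s' = deriv (s_inf a) \<eta>"
  define H where "H = h_inf (- a) \<eta>"
  define S where "S = s_inf (- a) \<eta>"
  define H' where "H' = deriv (h_inf (- a)) \<eta>"
  define S' where "S' = deriv (s_inf (- a)) \<eta>"
  define g where "g = ladder a"
  define G where "G = ladder (- a)"
  define e where "e = phase a"
  define r where "r = Q_ratio a"
  define A where "A = h - \<eta> * h' / (a + 1)"
  define B where "B = s - \<eta> * s' / (a + 1)"
  have nz: "g \<noteq> 0" "G \<noteq> 0" "e \<noteq> 0" "r \<noteq> 0" "a + 1 \<noteq> 0" "1 - a \<noteq> 0"
    using ladder_nonzero[OF a] ladder_nonzero[OF b] Q_ratio_nonzero[OF a] phase_nonzero[of a] a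
    by (auto simp: g_def G_def e_def r_def complex_eq_iff)
  have sm: "s_inf (- a) = h_inf (a - 1)" "s_inf a = h_inf (- a - 1)"
  proof -
    have "- 1 - - a = a - 1" "- 1 - a = - a - 1" by algebra+
    then show "s_inf (- a) = h_inf (a - 1)" "s_inf a = h_inf (- a - 1)"
      unfolding s_inf_eq_h_inf by (simp_all only:)
  qed
  \<comment> \<open>Relations 1 and 3 lower the index from \<open>a\<close> and from
    \<open>- a\<close>, while 2 and 4 are the companion relations for s; together they express all
    functions at \<open>- a\<close> by those at \<open>a\<close>.\<close>
  have 1: "S' = g * ((2 * \<eta> - 1) * h' - 2 * (a + 1) * h)"
    using deriv_h_inf_lower[OF a \<eta>] unfolding S'_def sm g_def h'_def h_def .
  have 2: "(2 * \<eta> - 1) * s' - 2 * (a + 1) * s = G * H'"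
    using s_inf_contiguous[OF a \<eta>] unfolding s'_def s_def G_def H'_def .
  have 3: "s' = G * ((2 * \<eta> - 1) * H' - 2 * (1 - a) * H)"
    using deriv_h_inf_lower[OF b \<eta>] unfolding s'_def sm G_def H'_def H_def by (simp add: add.commute)
  have 4: "(2 * \<eta> - 1) * S' - 2 * (1 - a) * S = g * h'"
    using s_inf_contiguous[OF b \<eta>] unfolding S'_def S_def g_def h'_def by (simp add: add.commute)
  have A: "(a + 1) * A = (a + 1) * h - \<eta> * h'" and B: "(a + 1) * B = (a + 1) * s - \<eta> * s'"
    unfolding A_def B_def using nz by (simp_all add: field_simps)
  have S': "S' = - g * (2 * (a + 1) * A + h')"
    using 1 A by algebra
  have H': "H' = - (2 * (a + 1) * B + s') / G"
    using 2 B nz(2) by (simp add: field_simps) algebra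
  have C: "H - \<eta> * H' / (- a + 1) = (a + 1) / (1 - a) * B / G"
  proof -
    have "2 * G * ((1 - a) * H - \<eta> * H') = - (s' + G * H')"
      using 3 by algebra
    also have "G * H' = - (2 * (a + 1) * B + s')" unfolding H' using nz by simp
    finally have "((1 - a) * H - \<eta> * H') * G = (a + 1) * B"
      by algebra
    then have "(1 - a) * H - \<eta> * H' = (a + 1) * B / G"
      by (rule iffD2[OF nonzero_eq_divide_eq[OF nz(2)]])
    moreover have "H - \<eta> * H' / (- a + 1) = ((1 - a) * H - \<eta> * H') / (1 - a)"
      using nz(6) by (simp add: field_simps)
    ultimately show ?thesis by simp
  qed
  have D: "S - \<eta> * S' / (- a + 1) = (a + 1) / (1 - a) * A * g"
  proof -
    have "(1 - a) * S - \<eta> * S' = (a + 1) * A * g"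
      using 4 S' by algebra
    moreover have "S - \<eta> * S' / (- a + 1) = ((1 - a) * S - \<eta> * S') / (1 - a)"
      using nz(6) by (simp add: field_simps)
    ultimately show ?thesis by simp
  qed
  have Xa: "Xi a \<eta> = mat2 (- e * A + r * B) (A + r * e * B) (- e * h' + r * s') (h' + r * e * s')"
    by (simp add: Xi_def Let_def e_def r_def A_def B_def h_def s_def h'_def s'_def)
  define q where "q = (a + 1) / (1 - a)"
  have Xb: "Xi (- a) \<eta> = mat2 (- (1 / e) * (q * B / G) + 1 / (g * G * r) * (q * A * g))
      (q * B / G + 1 / (g * G * r) * (1 / e) * (q * A * g))
      (- (1 / e) * (- (2 * (a + 1) * B + s') / G) + 1 / (g * G * r) * (- g * (2 * (a + 1) * A + h')))
      (- (2 * (a + 1) * B + s') / G + 1 / (g * G * r) * (1 / e) * (- g * (2 * (a + 1) * A + h')))"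
    unfolding Xi_def Let_def phase_minus Q_ratio_minus[OF a]
    unfolding H_def[symmetric] S_def[symmetric] H'_def[symmetric] S'_def[symmetric] e_def[symmetric]
      r_def[symmetric] g_def[symmetric] G_def[symmetric] C D
    unfolding H' S' q_def[symmetric] ..
  have k: "k = 1 / (r * e * G)" "k * (a + 1) / (1 - a) = q / (r * e * G)"
    by (simp_all add: k_def q_def r_def e_def G_def)
  show ?thesis
    unfolding Xa Xb k(2) matrix2_eq_iff matrix2_mult_nth mat2_nth unfolding k(1)
    using nz(1-4) by (simp add: field_simps)
qed

text \<open>Replacing a + 1 by -a turns the entry -\<open>\<eta>\<close>/(a + 1) of the triangular
  factor into \<open>\<eta>\<close>/a. The difference is \<open>\<eta>\<close> (1/a + 1/(a + 1)),
  the off-diagonal coefficient; the scalar comes from the swapped columns and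
  \<open>Q_ratio_reflect\<close>.\<close>

lemma Xi_reflect:
  assumes a: "Im a \<noteq> 0"
  shows "Xi (- 1 - a) \<eta> = mat2 (1 / (Q_ratio a * phase a))
     ((2 * a + 1) / (a * (a + 1)) * \<eta> / (Q_ratio a * phase a)) 0 (1 / (Q_ratio a * phase a)) ** Xi a \<eta>"
proof -
  define h where "h = h_inf a \<eta>"
  define s where "s = s_inf a \<eta>"
  define h' where "h' = deriv (h_inf a) \<eta>"
  define s' where "s' = deriv (s_inf a) \<eta>"
  define e where "e = phase a"
  define r where "r = Q_ratio a"
  have nz: "e \<noteq> 0" "r \<noteq> 0" "a \<noteq> 0" "a + 1 \<noteq> 0"
    using Q_ratio_nonzero[OF a] phase_nonzero[of a] a by (auto simp: e_def r_def complex_eq_iff)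
  have hs: "h_inf (- 1 - a) = s_inf a" "s_inf (- 1 - a) = h_inf a"
    unfolding s_inf_eq_h_inf by simp_all
  have Xa: "Xi a \<eta> = mat2 (- e * (h - \<eta> * h' / (a + 1)) + r * (s - \<eta> * s' / (a + 1)))
      ((h - \<eta> * h' / (a + 1)) + r * e * (s - \<eta> * s' / (a + 1))) (- e * h' + r * s') (h' + r * e * s')"
    by (simp add: Xi_def Let_def e_def r_def h_def s_def h'_def s'_def)
  have Xb: "Xi (- 1 - a) \<eta> = mat2 (- (- 1 / e) * (s + \<eta> * s' / a) + (- 1 / r) * (h + \<eta> * h' / a))
      ((s + \<eta> * s' / a) + (- 1 / r) * (- 1 / e) * (h + \<eta> * h' / a)) (- (- 1 / e) * s' + (- 1 / r) * h')
      (s' + (- 1 / r) * (- 1 / e) * h')"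
    unfolding Xi_def Let_def phase_reflect Q_ratio_reflect[OF a] hs e_def r_def h_def s_def h'_def s'_def
    by simp
  define w where "w = a + 1"
  have w: "2 * a + 1 = a + w" "w \<noteq> 0" using nz by (simp_all add: w_def)
  show ?thesis
    unfolding Xa Xb matrix2_eq_iff matrix2_mult_nth mat2_nth e_def[symmetric] r_def[symmetric]
      w_def[symmetric] w(1)
    using nz(1-3) w(2) by (simp add: divide_simps) algebra
qed

text \<open>\<open>M1\<close> is a Moebius map sending bL, 0, bR to 0, infinity, 1. Hence real
  values x <= 0 or x >= 1 correspond to 1/z <= 1/bL or 1/z >= 1/bR, that is, to z in the excluded
  interval.\<close>

lemma M1_in_eta_domain:
  assumes b: "bL < 0" "0 < bR" and z: "z \<notin> complex_of_real ` {bL..bR}"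
  shows "M1 bL bR z \<in> eta_domain"
proof -
  have z0: "z \<noteq> 0"
    using z b by (metis atLeastAtMost_iff image_eqI less_imp_le of_real_0)
  define E where "E = bR / (bR - bL)"
  have E: "0 < E" "E < 1" using b by (simp_all add: E_def)
  have "of_real bR - of_real bL \<noteq> (0 :: complex)"
    using b by (simp flip: of_real_diff)
  then have M: "M1 bL bR z = of_real E - of_real (E * bL) / z"
  proof -
    have "u * (z - w) / (z * D) = u / D - (u / D * w) / z" if "D \<noteq> 0" for u w D :: complex
      using that z0 by (simp add: field_simps)
    moreover have "complex_of_real E = of_real bR / (of_real bR - of_real bL)"
      by (simp add: E_def)
    ultimately show ?thesis
      using \<open>of_real bR - of_real bL \<noteq> (0 :: complex)\<close> unfolding M1_def of_real_mult by simp
  qed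
  show ?thesis
  proof (rule ComplI)
    assume "M1 bL bR z \<in> complex_of_real ` ({..0} \<union> {1..})"
    then obtain x where x: "M1 bL bR z = of_real x" "x \<le> 0 \<or> 1 \<le> x" by auto
    define y where "y = (E - x) / (E * bL)"
    have EbL: "E * bL < 0" using E b by (simp add: mult_pos_neg)
    have "of_real (E * bL) / z = of_real (E - x)" using M x by (simp add: algebra_simps)
    moreover have "complex_of_real (E * bL) \<noteq> 0"
      using EbL by (metis less_irrefl of_real_eq_0_iff)
    ultimately have "1 / z = of_real (E - x) / of_real (E * bL)"
      by (simp only: eq_divide_eq not_False_eq_True if_True) simp
    then have yz: "1 / z = of_real y"
      by (simp add: y_def)
    have "z = 1 / (1 / z)" by simp
    also have "\<dots> = of_real (1 / y)" unfolding yz by simp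
    finally have "z = of_real (1 / y)" .
    moreover have "bL \<le> 1 / y \<and> 1 / y \<le> bR"
      using x(2)
    proof
      assume "x \<le> 0"
      then have "y \<le> E / (E * bL)" 
        unfolding y_def using EbL by (intro divide_right_mono_neg) simp_all
      then have y: "y \<le> 1 / bL" using E by simp
      moreover have "1 / bL < 0" using b by simp
      ultimately have "y < 0" by linarith
      moreover have "bL * y \<ge> 1" using b y by (simp add: field_simps)
      ultimately have "y < 0" "bL * y \<ge> 1" by simp_all
      then have "bL \<le> 1 / y" by (simp add: field_simps)
      moreover have "1 / y \<le> bR" using \<open>y < 0\<close> b by (smt (verit) divide_neg_neg zero_le_divide_1_iff)
      ultimately show ?thesis ..
    next
      assume "1 \<le> x"
      then have "y \<ge> (E - 1) / (E * bL)" 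
        unfolding y_def using EbL by (intro divide_right_mono_neg) simp_all
      moreover have "(E - 1) / (E * bL) = 1 / bR"
      proof -
        have "bR - bL \<noteq> 0" using b by simp
        then have "E - 1 = bL / (bR - bL)" by (simp add: E_def field_simps)
        then show ?thesis using b \<open>bR - bL \<noteq> 0\<close> by (simp add: E_def)
      qed
      ultimately have y: "y \<ge> 1 / bR" by simp
      moreover have "1 / bR > 0" using b by simp
      ultimately have "y > 0" by linarith
      moreover have "bR * y \<ge> 1" using b y by (simp add: field_simps)
      ultimately have "y > 0" "bR * y \<ge> 1" by simp_all
      then have "1 / y \<le> bR" by (simp add: field_simps)
      moreover have "1 / y > 0" using \<open>y > 0\<close> by simp
      ultimately show ?thesis using b by linarith
    qed
    ultimately show False using z by (metis atLeastAtMost_iff image_eqI)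
  qed
qed

lemma M1_infinity_in_eta_domain:
  assumes "bL < 0" "0 < bR"
  shows "M1_infinity bL bR \<in> eta_domain"
proof -
  have "M1_infinity bL bR = of_real (bR / (bR - bL))" by (simp add: M1_infinity_def)
  moreover have "0 < bR / (bR - bL)" "bR / (bR - bL) < 1" using assms by simp_all
  ultimately show ?thesis by (auto simp: of_real_image_iff)
qed

section \<open>Symmetries of Gamma and comparison with the explicit vectors\<close>

context
  fixes bL bR :: real and z :: complex
  assumes b: "bL < 0" "0 < bR" and z: "z \<notin> complex_of_real ` {bL..bR}"
begin

lemma z_nonzero: "z \<noteq> 0"
  using z b by (metis atLeastAtMost_iff image_eqI less_imp_le of_real_0)

lemmas in_eta_domain = M1_infinity_in_eta_domain[OF b] M1_in_eta_domain[OF b z]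

text \<open>The left factor in \<open>Xi_minus\<close> is the same at both points and cancels; the
  right factor is an involution and remains as the conjugation.\<close>

lemma Gamma_a_minus:
  assumes a: "Im a \<noteq> 0"
  shows "Gamma_a bL bR z (- a) = mat2 (- 1) 0 0 1 ** Gamma_a bL bR z a ** mat2 (- 1) 0 0 1"
proof -
  have a': "Im (- a) \<noteq> 0" using a by simp
  define L where "L = (let k = 1 / (Q_ratio a * phase a * ladder (- a))
    in mat2 (k * (a + 1) / (1 - a)) 0 (- 2 * k * (a + 1)) (- k))"
  define S :: "complex^2^2" where "S = mat2 (- 1) 0 0 1"
  have S: "S ** S = mat 1"
    by (simp add: S_def matrix2_eq_iff matrix2_mult_nth mat1_nth)
  have X: "Xi (- a) \<eta> = L ** Xi a \<eta> ** S" if "\<eta> \<in> eta_domain" for \<eta>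
    unfolding L_def S_def Let_def by (rule Xi_minus[OF a that])
  have "Xi (- a) (M1_infinity bL bR) ** (S ** Gamma_a bL bR z a ** S)
      = L ** (Xi a (M1_infinity bL bR) ** (S ** S) ** Gamma_a bL bR z a) ** S"
    unfolding X[OF in_eta_domain(1)] by (simp only: matrix_mul_assoc)
  also have "\<dots> = Xi (- a) (M1 bL bR z)"
    unfolding S matrix_mul_rid Gamma_a_char[OF a b z_nonzero in_eta_domain(1)] X[OF in_eta_domain(2)] ..
  also have "\<dots> = Xi (- a) (M1_infinity bL bR) ** Gamma_a bL bR z (- a)"
    by (rule Gamma_a_char[OF a' b z_nonzero in_eta_domain(1), symmetric])
  finally show ?thesis
    using matrix_cancel_left[OF det_Xi(2)[OF a' in_eta_domain(1)]] unfolding S_def by metis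
qed

text \<open>Equals the identity plus d times the column (w, -v) times the row (v, w), where (v, w)
  is the second row of \<open>Xi\<close>; the two vectors are orthogonal, so this part is
  nilpotent.\<close>

definition jump_matrix :: "complex \<Rightarrow> complex^2^2" where
  "jump_matrix a =
     (let h' = deriv (h_inf a) (M1 bL bR z); s' = deriv (s_inf a) (M1 bL bR z);
          v = - phase a * h' + Q_ratio a * s'; w = h' + Q_ratio a * phase a * s';
          d = - of_real (bL * bR / (bR - bL)) / z / (a * (a + 1) * Q_ratio a * (1 + (phase a)\<^sup>2))
      in mat2 (1 + d * w * v) (d * w * w) (- d * v * v) (1 - d * v * w))"

text \<open>The left factors of \<open>Xi_reflect\<close> at the two points differ by a unipotent
  matrix with entry c (\<open>\<eta>\<close> - \<open>\<eta>0\<close>). Conjugating it by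
  \<open>Xi\<close> at \<open>\<eta>\<close> gives the jump: the first column of the inverse is (w,
  -v) over the determinant, hence d times the determinant is c (\<open>\<eta>\<close> -
  \<open>\<eta>0\<close>).\<close>

lemma Gamma_a_reflect:
  assumes a: "Im a \<noteq> 0"
  shows "Gamma_a bL bR z (- 1 - a) = Gamma_a bL bR z a ** jump_matrix a"
proof -
  have a': "Im (- 1 - a) \<noteq> 0" using a by simp
  define c where "c = (2 * a + 1) / (a * (a + 1))"
  define k where "k = 1 / (Q_ratio a * phase a)"
  define L where "L \<eta> = mat2 k (c * \<eta> * k) 0 k" for \<eta>
  define \<eta>0 where "\<eta>0 = M1_infinity bL bR"
  define \<eta> where "\<eta> = M1 bL bR z"
  define d where "d = - of_real (bL * bR / (bR - bL)) / z / (a * (a + 1) * Q_ratio a * (1 + (phase a)\<^sup>2))"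
  have X: "Xi (- 1 - a) \<eta> = L \<eta> ** Xi a \<eta>" for \<eta>
    using Xi_reflect[OF a, of \<eta>] by (simp add: L_def c_def k_def)
  define D where "D = det (Xi a \<eta>)"
  have "of_real bR - of_real bL \<noteq> (0 :: complex)"
    using b by (simp flip: of_real_diff)
  then have B: "\<eta> - \<eta>0 = - of_real (bL * bR / (bR - bL)) / z"
    unfolding \<eta>0_def \<eta>_def M1_def M1_infinity_def using z_nonzero
    by (simp add: divide_simps) (simp add: algebra_simps)
  have "d * D = c * (\<eta> - \<eta>0)"
  proof -
    have nz: "Q_ratio a \<noteq> 0" "1 + (phase a)\<^sup>2 \<noteq> 0"
      using Q_ratio_nonzero[OF a] phase_square_nontrivial(3)[OF a] by auto
    have "d * D = (\<eta> - \<eta>0) / (a * (a + 1) * Q_ratio a * (1 + (phase a)\<^sup>2))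
        * ((2 * a + 1) * Q_ratio a * (1 + (phase a)\<^sup>2))"
      unfolding d_def B[symmetric] D_def \<eta>_def det_Xi(1)[OF a in_eta_domain(2)] ..
    also have "\<dots> = (\<eta> - \<eta>0) * (2 * a + 1) / (a * (a + 1))"
      using nz by simp
    finally show ?thesis by (simp add: c_def mult_ac)
  qed
  then have dD: "d * (ent (Xi a \<eta>) 1 1 * ent (Xi a \<eta>) 2 2 - ent (Xi a \<eta>) 1 2 * ent (Xi a \<eta>) 2 1) = c * (\<eta> - \<eta>0)"
    unfolding D_def det_2 .
  have J: "jump_matrix a = mat2 (1 + d * ent (Xi a \<eta>) 2 2 * ent (Xi a \<eta>) 2 1) (d * ent (Xi a \<eta>) 2 2 * ent (Xi a \<eta>) 2 2)
     (- d * ent (Xi a \<eta>) 2 1 * ent (Xi a \<eta>) 2 1) (1 - d * ent (Xi a \<eta>) 2 1 * ent (Xi a \<eta>) 2 2)"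
    unfolding jump_matrix_def Let_def d_def \<eta>_def Xi_def mat2_nth ..
  have *: "L \<eta>0 ** (Xi a \<eta> ** jump_matrix a) = L \<eta> ** Xi a \<eta>"
  proof -
    define p where "p = ent (Xi a \<eta>) 1 1"
    define q where "q = ent (Xi a \<eta>) 1 2"
    define v where "v = ent (Xi a \<eta>) 2 1"
    define w where "w = ent (Xi a \<eta>) 2 2"
    have dD: "d * (p * w - q * v) = c * (\<eta> - \<eta>0)"
      using dD unfolding p_def q_def v_def w_def .
    have "k * (p * (1 + d * w * v) + q * (- d * v * v)) + c * \<eta>0 * k * (v * (1 + d * w * v) + w * (- d * v * v))
        = k * p + c * \<eta> * k * v"
      using dD by algebra
    moreover have "k * (p * (d * w * w) + q * (1 - d * v * w)) + c * \<eta>0 * k * (v * (d * w * w) + w * (1 - d * v * w))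
        = k * q + c * \<eta> * k * w"
      using dD by algebra
    moreover have "k * (v * (1 + d * w * v) + w * (- d * v * v)) = k * v"
      "k * (v * (d * w * w) + w * (1 - d * v * w)) = k * w"
      by algebra+
    ultimately show ?thesis
      unfolding matrix2_eq_iff matrix2_mult_nth J L_def mat2_nth p_def[symmetric] q_def[symmetric]
        v_def[symmetric] w_def[symmetric] by simp
  qed
  have "Xi (- 1 - a) \<eta>0 ** (Gamma_a bL bR z a ** jump_matrix a)
      = L \<eta>0 ** (Xi a \<eta>0 ** Gamma_a bL bR z a ** jump_matrix a)"
    unfolding X by (simp only: matrix_mul_assoc)
  also have "\<dots> = L \<eta> ** Xi a \<eta>"
    unfolding \<eta>0_def Gamma_a_char[OF a b z_nonzero in_eta_domain(1)]
    unfolding \<eta>0_def[symmetric] \<eta>_def[symmetric] by (rule *)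
  also have "\<dots> = Xi (- 1 - a) \<eta>"
    by (rule X[symmetric])
  also have "\<dots> = Xi (- 1 - a) \<eta>0 ** Gamma_a bL bR z (- 1 - a)"
    unfolding \<eta>0_def \<eta>_def by (rule Gamma_a_char[OF a' b z_nonzero in_eta_domain(1), symmetric])
  finally show ?thesis
    using matrix_cancel_left[OF det_Xi(2)[OF a' in_eta_domain(1)]] unfolding \<eta>0_def by metis
qed

text \<open>Matches the prefactor of \<open>f2\<close> with the constant d of
  \<open>jump_matrix\<close>. The relation m tan(a pi) (1 + e^2) = -e, valid at the boundary value
  of \<open>a\<close>, trades m for the trigonometric factors.\<close>

lemma alpha_a_boundary:
  assumes m: "0 < m" "m < 1 / 2"
  defines "a \<equiv> a_boundary m"
  shows "2 * of_real m * (2 * a + 1) * (alpha a)\<^sup>2 = - 1 / (a * (a + 1) * Q_ratio a * (1 + (phase a)\<^sup>2))"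
proof -
  have a: "Im a \<noteq> 0" unfolding a_def by (rule a_boundary_nonreal[OF m])
  define e where "e = phase a"
  define t where "t = tan (a * of_real pi)"
  define r where "r = Q_ratio a"
  have nz: "e \<noteq> 0" "1 + e\<^sup>2 \<noteq> 0" "r \<noteq> 0" "2 * a + 1 \<noteq> 0" "a \<noteq> 0" "a + 1 \<noteq> 0"
    using phase_nonzero phase_square_nontrivial(3)[OF a] Q_ratio_nonzero[OF a] nonreal_add_of_nat[OF a]
    by (auto simp: e_def r_def)
  have me: "of_real m * (e\<^sup>2 - 1) = - \<i> * e"
    unfolding e_def a_def phase_def by (rule exp_a_boundary[OF m])
  have te: "t * (1 + e\<^sup>2) = - \<i> * (e\<^sup>2 - 1)"
    unfolding t_def tan_phase e_def[symmetric] using nz(2) by (simp add: add.commute)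
  have "of_real m * (t * (1 + e\<^sup>2)) = - \<i> * (of_real m * (e\<^sup>2 - 1))"
    unfolding te by (rule mult.left_commute)
  also have "\<dots> = - e" unfolding me by simp
  finally have mt: "of_real m * (t * (1 + e\<^sup>2)) = - e" .
  define u where "u = 2 * a + 1"
  have "(alpha a)\<^sup>2 * r = t / (2 * e * u * a * (a + 1))"
    unfolding r_def t_def e_def u_def by (rule alpha_eq(2)[OF a])
  then have A: "(alpha a)\<^sup>2 * r * (2 * e * u * a * (a + 1)) = t"
    using nz by (simp add: u_def)
  have "2 * of_real m * u * (alpha a)\<^sup>2 * (a * (a + 1) * r * (1 + e\<^sup>2)) * e = - 1 * e"
  proof -
    have "2 * of_real m * u * (alpha a)\<^sup>2 * (a * (a + 1) * r * (1 + e\<^sup>2)) * e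
        = of_real m * (((alpha a)\<^sup>2 * r * (2 * e * u * a * (a + 1))) * (1 + e\<^sup>2))"
      by (simp only: mult_ac)
    then show ?thesis unfolding A mt by simp
  qed
  then have "2 * of_real m * u * (alpha a)\<^sup>2 * (a * (a + 1) * r * (1 + e\<^sup>2)) = - 1"
    using nz(1) by (simp only: mult_cancel_right simp_thms)
  moreover have "a * (a + 1) * r * (1 + e\<^sup>2) \<noteq> 0" using nz by simp
  ultimately show ?thesis
    unfolding u_def r_def e_def by (metis nonzero_eq_divide_eq)
qed

text \<open>Both \<open>x\<close> and \<open>y\<close> carry a factor \<open>alpha a\<close>, so
  every quadratic entry carries its square, and \<open>c\<close> times this square is d.\<close>

lemma jump_entries:
  assumes m: "0 < m" "m < 1 / 2"
  defines "a \<equiv> a_boundary m" and "x \<equiv> d_R bL bR z (- m)" and "y \<equiv> d_L bL bR z (- m)"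
    and "c \<equiv> 2 * of_real bR * of_real bL * of_real m * (2 * a_boundary m + 1) / (of_real bR - of_real bL) / z"
  shows "jump_matrix a = mat2 (1 + c * x * y) (c * x * x) (- c * y * y) (1 - c * x * y)"
proof -
  have a: "Im a \<noteq> 0" unfolding a_def by (rule a_boundary_nonreal[OF m])
  define h' where "h' = deriv (h_inf a) (M1 bL bR z)"
  define s' where "s' = deriv (s_inf a) (M1 bL bR z)"
  define v where "v = - phase a * h' + Q_ratio a * s'"
  define w where "w = h' + Q_ratio a * phase a * s'"
  define d where "d = - of_real (bL * bR / (bR - bL)) / z / (a * (a + 1) * Q_ratio a * (1 + (phase a)\<^sup>2))"
  have e': "exp (- a * of_real pi * \<i>) = 1 / phase a"
    using phase_minus[of a] by (simp add: phase_def)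
  have x: "x = alpha a * w"
    unfolding x_def d_R_def Let_def a_minus_eq[OF m] a_def[symmetric] alpha_eq(1)[OF a] w_def h'_def s'_def
    by (simp add: algebra_simps)
  have y: "y = alpha a * v"
    unfolding y_def d_L_def Let_def a_minus_eq[OF m] a_def[symmetric] alpha_eq(1)[OF a] e' v_def h'_def s'_def
    using phase_nonzero[of a] by (simp add: phase_def algebra_simps)
  have cd: "c * (alpha a)\<^sup>2 = d"
  proof -
    have "c * (alpha a)\<^sup>2 = of_real (bL * bR / (bR - bL)) / z * (2 * of_real m * (2 * a + 1) * (alpha a)\<^sup>2)"
      unfolding c_def a_def by (simp add: mult_ac)
    also have "\<dots> = d"
      unfolding alpha_a_boundary[OF m, folded a_def] d_def by simp
    finally show ?thesis .
  qed
  have "c * x * y = d * w * v" "c * x * x = d * w * w" "c * y * y = d * v * v"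
    unfolding x y cd[symmetric] by (simp_all add: power2_eq_square mult_ac)
  then show ?thesis
    unfolding jump_matrix_def Let_def h'_def[symmetric] s'_def[symmetric] v_def[symmetric] w_def[symmetric]
      d_def[symmetric] by (simp add: mult_ac)
qed

lemma outer_f2_g2:
  assumes m: "0 < m" "m < 1 / 2" and l: "\<bar>l\<bar> = m"
  defines "x \<equiv> d_R bL bR z (- m)" and "y \<equiv> d_L bL bR z (- m)"
    and "c \<equiv> 2 * of_real bR * of_real bL * of_real m * (2 * a_boundary m + 1) / (of_real bR - of_real bL) / z"
  shows "mat 1 - (\<chi> i j. 1 / z * outer (f2 bL bR z l) (g2 bL bR z l) $ i $ j)
    = mat2 (1 - c * of_real (sgn l) * x * y) (c * x * x)
       (- c * (of_real (sgn l))\<^sup>2 * y * y) (1 + c * of_real (sgn l) * x * y)"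
  unfolding matrix2_eq_iff f2_def g2_def outer_def l a_minus_eq[OF m] x_def[symmetric] y_def[symmetric]
  by (simp add: mat1_nth c_def power2_eq_square mult_ac)

end

section \<open>The jump on both halves of the interval\<close>

theorem theorem3p6:
  fixes bL bR l :: real and z :: complex
  assumes "bL < 0" and "0 < bR"
    and "z \<notin> complex_of_real ` {bL..bR}"
    and "l \<in> {-1/2<..<0} \<union> {0<..<1/2}"
  shows "\<exists>Gp Gm :: complex^2^2.
           (Gamma_RHP bL bR z \<longlongrightarrow> Gp) (at (complex_of_real l) within {m. Im m > 0}) \<and>
           (Gamma_RHP bL bR z \<longlongrightarrow> Gm) (at (complex_of_real l) within {m. Im m < 0}) \<and>
           Gp = Gm ** (mat 1 - (\<chi> i j. 1 / z * outer (f2 bL bR z l) (g2 bL bR z l) $ i $ j))"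
proof -
  note asm = assms(1-3)
  define m where "m = \<bar>l\<bar>"
  have m: "0 < m" "m < 1 / 2" using assms(4) by (auto simp: m_def)
  define a where "a = a_boundary m"
  have a: "Im a \<noteq> 0" unfolding a_def by (rule a_boundary_nonreal[OF m])
  define x where "x = d_R bL bR z (- m)"
  define y where "y = d_L bL bR z (- m)"
  define c where "c = 2 * of_real bR * of_real bL * of_real m * (2 * a + 1) / (of_real bR - of_real bL) / z"
  note F = outer_f2_g2[OF asm m m_def[symmetric], folded a_def x_def y_def, folded c_def]
  note J = jump_entries[OF asm m, folded a_def x_def y_def, folded c_def]
  have lim: "(Gamma_RHP bL bR z \<longlongrightarrow> Gamma_a bL bR z a') (at (of_real l) within A)"
    if "(a_fun \<longlongrightarrow> a') (at (of_real l) within A)" "Im a' \<noteq> 0" for a' A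
    unfolding Gamma_RHP_eq
    by (rule isCont_tendsto_compose[OF isCont_Gamma_a[OF that(2) asm(1,2) z_nonzero[OF asm]
            in_eta_domain[OF asm]] that(1)])
  note lims = a_fun_limits[OF m, folded a_def]
  show ?thesis
  proof (cases "l < 0")
    case True
    then have l: "l = - m" "sgn l = - 1" by (auto simp: m_def)
    have "mat 1 - (\<chi> i j. 1 / z * outer (f2 bL bR z l) (g2 bL bR z l) $ i $ j) = jump_matrix bL bR z a"
      unfolding F J l(2) by (simp add: matrix2_eq_iff)
    moreover have "(Gamma_RHP bL bR z \<longlongrightarrow> Gamma_a bL bR z (- 1 - a)) (at (of_real l) within {m. Im m > 0})"
      using lims(1) a unfolding l(1)[symmetric] by (intro lim) auto
    moreover have "(Gamma_RHP bL bR z \<longlongrightarrow> Gamma_a bL bR z a) (at (of_real l) within {m. Im m < 0})"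
      using lims(2) a unfolding l(1)[symmetric] by (intro lim) auto
    ultimately show ?thesis
      using Gamma_a_reflect[OF asm a] by auto
  next
    case False
    then have l: "l = m" "sgn l = 1" using m by (auto simp: m_def)
    define S :: "complex^2^2" where "S = mat2 (- 1) 0 0 1"
    have S: "S ** S = mat 1"
      by (simp add: S_def matrix2_eq_iff matrix2_mult_nth mat1_nth)
    define X where "X = mat 1 - (\<chi> i j. 1 / z * outer (f2 bL bR z l) (g2 bL bR z l) $ i $ j)"
    \<comment> \<open>This says that \<open>X\<close> is the inverse of the jump conjugated by
      \<open>S\<close>. Inversion negates the nilpotent part and conjugation restores its
      off-diagonal entries, so only the diagonal changes sign, as \<open>sgn l\<close> = 1 instead
      of -1 requires.\<close>
    have X: "jump_matrix bL bR z a ** (S ** X) = S"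
      unfolding X_def F J l(2) S_def matrix2_eq_iff matrix2_mult_nth by (simp add: algebra_simps)
    have "Im (- 1 - a) \<noteq> 0" using a by simp
    from Gamma_a_minus[OF asm this]
    have "Gamma_a bL bR z (a + 1) = S ** Gamma_a bL bR z (- 1 - a) ** S"
      by (simp add: S_def add.commute)
    then have "Gamma_a bL bR z (a + 1) ** X = S ** Gamma_a bL bR z a ** (jump_matrix bL bR z a ** (S ** X))"
      unfolding Gamma_a_reflect[OF asm a] by (simp only: matrix_mul_assoc)
    also have "\<dots> = Gamma_a bL bR z (- a)"
      unfolding X unfolding Gamma_a_minus[OF asm a] S_def ..
    finally have G: "Gamma_a bL bR z (- a) = Gamma_a bL bR z (a + 1) ** X" ..
    have "(Gamma_RHP bL bR z \<longlongrightarrow> Gamma_a bL bR z (- a)) (at (of_real l) within {m. Im m > 0})"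
      using lims(3) a unfolding l(1)[symmetric] by (intro lim) auto
    moreover have "(Gamma_RHP bL bR z \<longlongrightarrow> Gamma_a bL bR z (a + 1)) (at (of_real l) within {m. Im m < 0})"
      using lims(4) a unfolding l(1)[symmetric] by (intro lim) auto
    ultimately show ?thesis
      using G unfolding X_def by blast
  qed
qed

end
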